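(* Let $p,q$ be positive integers, let $a,b\in\mathbb{R}$, and let $s>5/2$. Consider the Cauchy problem on the circle $\mathbb{T}$ $$\begin{cases} m_t+v^pm_x+av^{p-1}v_xm=0,\\ n_t+u^qn_x+bu^{q-1}u_xn=0,\\ u(x,0)=u_0(x),\quad v(x,0)=v_0(x),\end{cases}\qquad t>0,\ x\in\mathbb{T},$$ where $m=u-u_{xx}$ and $n=v-v_{xx}$. Then the data-to-solution map $(u_0,v_0)\mapsto (u,v)$ of this Cauchy problem is not uniformly continuous from $H^s(\mathbb{T})\times H^s(\mathbb{T})$ into $C([0,T];H^s(\mathbb{T})\times H^s(\mathbb{T}))$. That is, for some $T>0$ there exist $\varepsilon>0$ and two sequences of solutions $(u_n,v_n)$, $(w_n,y_n)$ in $C([0,T];H^s(\mathbb{T})\times H^s(\mathbb{T}))$ such that $$\lim_{n\to\infty}\big(\|u_n(0)-w_n(0)\|_{H^s}+\|v_n(0)-y_n(0)\|_{H^s}\big)=0$$ while $$\sup_{t\in[0,T]}\big(\|u_n(t)-w_n(t)\|_{H^s}+\|v_n(t)-y_n(t)\|_{H^s}\big)\ge\varepsilon\quad\text{for all } n .$$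
   Context: $\mathbb{T}=\mathbb{R}/2\pi\mathbb{Z}$, and $H^s=H^s(\mathbb{T})$ is the usual $L^2$-based Sobolev space with norm $\|f\|_{H^s}=\|(1-\partial_x^2)^{s/2}f\|_{L^2}$. The operator $(1-\partial_x^2)^{-1}$ is the Fourier multiplier with symbol $1/(1+\xi^2)$. The system is understood in its nonlocal form $$u_t+v^pu_x+I_1(u,v)=0,\qquad v_t+u^qv_x+I_2(u,v)=0,$$ with $$I_1(u,v)=(1-\partial_x^2)^{-1}\Big[\tfrac ap(v^p)_xu+\tfrac{p-a}{p}(v^p)_xu_{xx}\Big]+(1-\partial_x^2)^{-1}\partial_x\big((v^p)_xu_x\big),$$ $$I_2(u,v)=(1-\partial_x^2)^{-1}\Big[\tfrac bq(u^q)_xv+\tfrac{q-b}{q}(u^q)_xv_{xx}\Big]+(1-\partial_x^2)^{-1}\partial_x\big((u^q)_xv_x\big).$$ For $s>5/2$ the Cauchy problem is known to be locally well-posed: each $(u_0,v_0)\in H^s\times H^s$ has a unique solution $(u,v)\in C([0,T);H^s\times H^s)\cap C^1([0,T);H^{s-1}\times H^{s-1})$ for some $T>0$ depending on the data. The data-to-solution map sends $(u_0,v_0)$ to this solution; in the statement, $T$ is a time up to which the solutions under consideration exist. *)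

theory Defs
  imports "HOL-Analysis.Analysis"
begin

text \<open>Functions on the circle \<open>\<real>/2\<pi>\<int>\<close> are rendered as \<open>2\<pi>\<close>-periodic functions on the line;
  elements of \<open>L\<^sup>2\<close> are represented by Borel functions, without passing to the quotient by a.e. equality.\<close>

definition L2_circle :: "(real \<Rightarrow> real) set" where
  "L2_circle = {f. (\<forall>x. f (x + 2 * pi) = f x) \<and> f \<in> borel_measurable borel \<and>
                   set_integrable lborel {0..2 * pi} (\<lambda>x. (f x)\<^sup>2)}"

definition L2_norm :: "(real \<Rightarrow> real) \<Rightarrow> real" where
  "L2_norm f = sqrt (LINT x:{0..2 * pi}|lborel. (f x)\<^sup>2)"

definition fourier_coeff :: "(real \<Rightarrow> real) \<Rightarrow> int \<Rightarrow> complex" where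
  "fourier_coeff f k =
     complex_of_real (1 / (2 * pi)) *
     (LINT x:{0..2 * pi}|lborel. complex_of_real (f x) * cis (- (of_int k * x)))"

text \<open>\<open>is_fourier_multiplier \<sigma> f g\<close> says that \<open>g\<close> is an \<open>L\<^sup>2\<close> representative of the image of \<open>f\<close> under the
  Fourier multiplier with symbol \<open>\<sigma>\<close>; it determines \<open>g\<close> up to a.e. equality. Only even real symbols
  are used, so real-valued \<open>g\<close> suffice.\<close>

definition is_fourier_multiplier ::
    "(real \<Rightarrow> real) \<Rightarrow> (real \<Rightarrow> real) \<Rightarrow> (real \<Rightarrow> real) \<Rightarrow> bool" where
  "is_fourier_multiplier \<sigma> f g \<longleftrightarrow>
     f \<in> L2_circle \<and> g \<in> L2_circle \<and>
     (\<forall>k::int. fourier_coeff g k = complex_of_real (\<sigma> (of_int k)) * fourier_coeff f k)"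

text \<open>The Sobolev space of order \<open>s \<ge> 0\<close> and its norm, the \<open>L\<^sup>2\<close> norm of \<open>(1 - \<partial>\<^sub>x\<^sup>2)\<^bsup>s/2\<^esup> f\<close>
  (which does not depend on the representative chosen). For negative \<open>s\<close>, where distributions would
  be needed, the definition is not meaningful.\<close>

definition sobolev_symbol :: "real \<Rightarrow> real \<Rightarrow> real" where
  "sobolev_symbol s \<xi> = (1 + \<xi>\<^sup>2) powr (s / 2)"

definition sobolev :: "real \<Rightarrow> (real \<Rightarrow> real) set" where
  "sobolev s = {f \<in> L2_circle. \<exists>g. is_fourier_multiplier (sobolev_symbol s) f g}"

definition sobolev_norm :: "real \<Rightarrow> (real \<Rightarrow> real) \<Rightarrow> real" where
  "sobolev_norm s f = L2_norm (SOME g. is_fourier_multiplier (sobolev_symbol s) f g)"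

text \<open>\<open>(1 - \<partial>\<^sub>x\<^sup>2)\<^bsup>-1\<^esup> f\<close>, taken as its unique continuous representative.\<close>

definition helmholtz_inv :: "(real \<Rightarrow> real) \<Rightarrow> real \<Rightarrow> real" where
  "helmholtz_inv f =
     (THE g. continuous_on UNIV g \<and> is_fourier_multiplier (\<lambda>\<xi>. 1 / (1 + \<xi>\<^sup>2)) f g)"

text \<open>Here \<open>nonlocal_term p a u v\<close> is \<open>I\<^sub>1(u,v)\<close>, and \<open>nonlocal_term q b v u\<close> is \<open>I\<^sub>2(u,v)\<close>. The spatial
  derivatives are classical: it is applied to continuous functions in \<open>H\<^sup>s\<close> with \<open>s > 5/2\<close>, which
  are of class \<open>C\<^sup>2\<close>.\<close>

definition nonlocal_term ::
    "nat \<Rightarrow> real \<Rightarrow> (real \<Rightarrow> real) \<Rightarrow> (real \<Rightarrow> real) \<Rightarrow> real \<Rightarrow> real" where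
  "nonlocal_term p a u v x =
     helmholtz_inv (\<lambda>y. a / real p * deriv (\<lambda>z. v z ^ p) y * u y +
                        (real p - a) / real p * deriv (\<lambda>z. v z ^ p) y * deriv (deriv u) y) x +
     helmholtz_inv (deriv (\<lambda>y. deriv (\<lambda>z. v z ^ p) y * deriv u y)) x"

definition sobolev_path :: "real \<Rightarrow> real \<Rightarrow> (real \<Rightarrow> real \<Rightarrow> real) \<Rightarrow> bool" where
  "sobolev_path s T u \<longleftrightarrow>
     (\<forall>t\<in>{0..T}. u t \<in> sobolev s \<and>
        ((\<lambda>\<tau>. sobolev_norm s (\<lambda>x. u \<tau> x - u t x)) \<longlongrightarrow> 0) (at t within {0..T}))"

definition sobolev_time_deriv ::
    "real \<Rightarrow> real \<Rightarrow> (real \<Rightarrow> real \<Rightarrow> real) \<Rightarrow> (real \<Rightarrow> real \<Rightarrow> real) \<Rightarrow> bool" where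
  "sobolev_time_deriv r T u u' \<longleftrightarrow>
     (\<forall>t\<in>{0..T}.
        ((\<lambda>\<tau>. sobolev_norm r (\<lambda>x. (u \<tau> x - u t x) / (\<tau> - t) - u' t x)) \<longlongrightarrow> 0)
          (at t within {0..T}))"

text \<open>Solutions in \<open>C([0,T]; H\<^sup>s \<times> H\<^sup>s) \<inter> C\<^sup>1([0,T]; H\<^bsup>s-1\<^esup> \<times> H\<^bsup>s-1\<^esup>)\<close> of the nonlocal system; \<open>u t\<close> is the
  function \<open>x \<mapsto> u(x,t)\<close>, in its continuous representative. The time derivatives \<open>u'\<close>, \<open>v'\<close> are
  continuous in \<open>x\<close> because of the equations.\<close>

definition is_solution ::
    "nat \<Rightarrow> nat \<Rightarrow> real \<Rightarrow> real \<Rightarrow> real \<Rightarrow> real \<Rightarrow>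
     (real \<Rightarrow> real \<Rightarrow> real) \<Rightarrow> (real \<Rightarrow> real \<Rightarrow> real) \<Rightarrow> bool" where
  "is_solution p q a b s T u v \<longleftrightarrow>
     sobolev_path s T u \<and> sobolev_path s T v \<and>
     (\<forall>t\<in>{0..T}. continuous_on UNIV (u t) \<and> continuous_on UNIV (v t)) \<and>
     (\<exists>u' v'.
        sobolev_path (s - 1) T u' \<and> sobolev_time_deriv (s - 1) T u u' \<and>
        sobolev_path (s - 1) T v' \<and> sobolev_time_deriv (s - 1) T v v' \<and>
        (\<forall>t\<in>{0..T}. \<forall>x.
           u' t x + v t x ^ p * deriv (u t) x + nonlocal_term p a (u t) (v t) x = 0 \<and>
           v' t x + u t x ^ q * deriv (v t) x + nonlocal_term q b (v t) (u t) x = 0))"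

end

theory Submission
  imports Defs
begin

text \<open>The sequences of solutions need not be bounded, so one travelling wave suffices. The system is
  invariant under the scaling \<open>(u, v) \<mapsto> (\<lambda>\<^bsup>1/q\<^esup> u(\<lambda>t), \<lambda>\<^bsup>1/p\<^esup> v(\<lambda>t))\<close>, and a travelling wave of speed \<open>1\<close>
  becomes one of speed \<open>\<lambda>\<close>. For \<open>\<lambda> = n\<^sup>q\<close> and \<open>\<lambda>' = n\<^sup>q + 1/n\<close> the initial data differ by \<open>O(1/n)\<close>, while the
  phases drift apart by \<open>t/n\<close>, which is multiplied by the amplitude \<open>n\<close> of \<open>u\<close>.

  A travelling wave of speed \<open>1\<close> satisfies \<open>m (v\<^sup>p - 1)\<^bsup>a/p\<^esup> = const\<close> and \<open>n (u\<^sup>q - 1)\<^bsup>b/q\<^esup> = const\<close>. If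
  \<open>a b = 0\<close>, a cosine paired with the constant \<open>1\<close> works. Otherwise \<open>U = u/\<alpha>\<close>, \<open>V = v/\<beta>\<close> solve
  \<open>U - U'' = (1 + x(V\<^sup>p - 1))\<^bsup>-a/p\<^esup>\<close>, \<open>V - V'' = (1 + y(U\<^sup>q - 1))\<^bsup>-b/q\<^esup>\<close> with \<open>\<beta>\<^sup>p = x/(x-1)\<close> and
  \<open>\<alpha>\<^sup>q = y/(y-1)\<close>. The linearisation at \<open>U = V = 1\<close> has the kernel \<open>cos\<close> among even functions if \<open>a b x y = 4\<close>;
  moving \<open>x\<close> slightly, a contraction argument produces even solutions that bifurcate from \<open>(1, 1)\<close>.\<close>

section \<open>Uniqueness of Fourier coefficients\<close>

text \<open>\<open>helmholtz_inv\<close> and \<open>sobolev_norm\<close> are given by description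
  and choice, so they can be evaluated only once Fourier coefficients are known to determine a
  function. Norms are then treated crudely: from below by a single Fourier coefficient, from above
  by the suprema of a smooth function and of one high derivative. The obstacle in building a wave is
  resonance. On cos the operator 1 - d^2/dx^2 acts as 2, so the linearised pair is singular exactly
  if (-a x)(-b y) = 2 * 2. Rescaling the deviations of U and V from 1 makes both coefficients equal
  to 2; their sum then meets a singular operator, their difference an invertible one. The relative
  shift \<tau> of x is a third unknown, spent on the solvability condition at frequency 1, while
  evenness disposes of sin. Supremum norms suffice because both inverse symbols are summable over
  the integers; smoothness is recovered afterwards from the equations. The signs of x and y are
  dictated by \<beta> and \<alpha>: x/(x-1) and y/(y-1) must be positive for real roots to exist for
  every p and q.\<close>

lemma set_integrable_fourier:
  assumes "set_integrable lborel {0..2*pi} h"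
  shows "set_integrable lborel {0..2*pi} (\<lambda>x. complex_of_real (h x) * cis (- (of_int k * x)))"
proof -
  have 1: "set_integrable lborel {0..2*pi} (\<lambda>x. complex_of_real (h x))"
  proof -
    have "(\<lambda>x. indicator {0..2*pi} x *\<^sub>R complex_of_real (h x)) = (\<lambda>x. complex_of_real (indicator {0..2*pi} x *\<^sub>R h x))"
      by (auto simp: scaleR_conv_of_real)
    then show ?thesis
      using assms unfolding set_integrable_def by (simp only: complex_of_real_integrable_eq)
  qed
  have m: "(\<lambda>x. cis (- (of_int k * x))) \<in> borel_measurable lborel"
    by (auto intro!: borel_measurable_continuous_onI continuous_intros)
  show ?thesis
  proof (rule set_integrable_bound[OF 1])
    have "(\<lambda>x. indicator {0..2*pi} x *\<^sub>R complex_of_real (h x)) \<in> borel_measurable lborel"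
      using 1 unfolding set_integrable_def by (rule borel_measurable_integrable)
    then have "(\<lambda>x. (indicator {0..2*pi} x *\<^sub>R complex_of_real (h x)) * cis (- (of_int k * x))) \<in> borel_measurable lborel"
      using m by (rule borel_measurable_times)
    then show "set_borel_measurable lborel {0..2*pi} (\<lambda>x. complex_of_real (h x) * cis (- (of_int k * x)))"
      unfolding set_borel_measurable_def by (simp only: mult_scaleR_left)
  qed (auto simp: norm_mult)
qed

lemma set_integrable_mult_continuous:
  fixes h f :: "real \<Rightarrow> real"
  assumes h: "set_integrable lborel {a..b} h" and f: "continuous_on UNIV f"
  shows "set_integrable lborel {a..b} (\<lambda>x. h x * f x)"
proof -
  have "compact (f ` {a..b})"
    by (intro compact_continuous_image continuous_on_subset[OF f]) auto
  then obtain B where B: "\<And>x. x \<in> {a..b} \<Longrightarrow> \<bar>f x\<bar> \<le> B"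
    using compact_imp_bounded[of "f ` {a..b}"] unfolding bounded_real by (metis imageI)
  have m: "f \<in> borel_measurable lborel"
    using f by (simp add: borel_measurable_continuous_onI)
  show ?thesis
  proof (rule set_integrable_bound[where f="\<lambda>x. B * h x"])
    show "set_integrable lborel {a..b} (\<lambda>x. B * h x)" using h by simp
    have "(\<lambda>x. indicator {a..b} x *\<^sub>R h x) \<in> borel_measurable lborel"
      using h unfolding set_integrable_def by (rule borel_measurable_integrable)
    then have "(\<lambda>x. (indicator {a..b} x *\<^sub>R h x) * f x) \<in> borel_measurable lborel"
      using m by (rule borel_measurable_times)
    then show "set_borel_measurable lborel {a..b} (\<lambda>x. h x * f x)"
      unfolding set_borel_measurable_def by (simp add: mult.assoc)
    show "AE x in lborel. x \<in> {a..b} \<longrightarrow> norm (h x * f x) \<le> norm (B * h x)"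
    proof (intro AE_I2 impI)
      fix x assume "x \<in> {a..b}"
      then have "\<bar>f x\<bar> \<le> \<bar>B\<bar>" using B by fastforce
      then have "\<bar>h x\<bar> * \<bar>f x\<bar> \<le> \<bar>h x\<bar> * \<bar>B\<bar>" by (rule mult_left_mono) simp
      then show "norm (h x * f x) \<le> norm (B * h x)" by (simp add: abs_mult mult.commute)
    qed
  qed
qed

lemma fourier_coeff_add:
  assumes "set_integrable lborel {0..2*pi} f" "set_integrable lborel {0..2*pi} g"
  shows "fourier_coeff (\<lambda>x. f x + g x) k = fourier_coeff f k + fourier_coeff g k"
  unfolding fourier_coeff_def
  using set_integral_add(2)[OF assms[THEN set_integrable_fourier[where k=k]]]
  by (simp only: of_real_add distrib_left distrib_right)

lemma fourier_coeff_diff: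
  assumes "set_integrable lborel {0..2*pi} f" "set_integrable lborel {0..2*pi} g"
  shows "fourier_coeff (\<lambda>x. f x - g x) k = fourier_coeff f k - fourier_coeff g k"
  unfolding fourier_coeff_def
  using set_integral_diff(2)[OF assms[THEN set_integrable_fourier[where k=k]]]
  by (simp only: of_real_diff left_diff_distrib right_diff_distrib)

lemma fourier_coeff_cmult:
  "fourier_coeff (\<lambda>x. c * f x) k = complex_of_real c * fourier_coeff f k"
proof -
  have "(\<lambda>x. complex_of_real (c * f x) * cis (- (of_int k * x)))
      = (\<lambda>x. complex_of_real c * (complex_of_real (f x) * cis (- (of_int k * x))))" by (auto simp: algebra_simps)
  then show ?thesis unfolding fourier_coeff_def by simp
qed

text \<open>cos and sin are the coordinates of \<open>cis\<close>, and multiplying by them only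
  moves frequencies by one. This is what lets vanishing coefficients survive multiplication by
  polynomials on the circle.\<close>

lemma fourier_coeff_times_cos:
  assumes h: "set_integrable lborel {0..2*pi} h"
  shows "fourier_coeff (\<lambda>x. h x * cos x) k = (fourier_coeff h (k-1) + fourier_coeff h (k+1)) / 2"
proof -
  let ?e = "\<lambda>j x. complex_of_real (h x) * cis (- (of_int j * x))"
  have eq: "complex_of_real (h x * cos x) * cis (- (of_int k * x)) = (?e (k-1) x + ?e (k+1) x) / 2" for x
    by (auto simp: complex_eq_iff algebra_simps cos_add sin_add cos_diff sin_diff)
  show ?thesis
    unfolding fourier_coeff_def eq set_integral_divide_zero
      set_integral_add(2)[OF set_integrable_fourier[OF h, of "k-1"] set_integrable_fourier[OF h, of "k+1"]]
    by (simp only: distrib_left times_divide_eq_right)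
qed

lemma fourier_coeff_times_sin:
  assumes h: "set_integrable lborel {0..2*pi} h"
  shows "fourier_coeff (\<lambda>x. h x * sin x) k = (fourier_coeff h (k-1) - fourier_coeff h (k+1)) / (2 * \<i>)"
proof -
  let ?e = "\<lambda>j x. complex_of_real (h x) * cis (- (of_int j * x))"
  have "2 * \<i> * (complex_of_real (h x * sin x) * cis (- (of_int k * x))) = ?e (k-1) x - ?e (k+1) x" for x
    by (auto simp: complex_eq_iff algebra_simps cos_add sin_add cos_diff sin_diff)
  then have eq: "complex_of_real (h x * sin x) * cis (- (of_int k * x)) = (?e (k-1) x - ?e (k+1) x) / (2 * \<i>)" for x
    by (subst nonzero_eq_divide_eq) (simp, simp only: mult.commute)
  show ?thesis
    unfolding fourier_coeff_def eq set_integral_divide_zero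
      set_integral_diff(2)[OF set_integrable_fourier[OF h, of "k-1"] set_integrable_fourier[OF h, of "k+1"]]
    by (simp only: right_diff_distrib times_divide_eq_right)
qed

text \<open>The product case of the induction needs the statement for all \<open>h\<close> with vanishing coefficients.\<close>

lemma fourier_coeff_times_polynomial_eq_0:
  fixes P :: "complex \<Rightarrow> real"
  assumes "real_polynomial_function P" "set_integrable lborel {0..2*pi} h" "\<And>k. fourier_coeff h k = 0"
  shows "fourier_coeff (\<lambda>x. h x * P (cis x)) k = 0"
proof -
  have cont: "continuous_on UNIV (\<lambda>x. P (cis x))" if "real_polynomial_function P" for P
    using that by (intro continuous_on_compose2[OF continuous_on_polymonial_function[of P UNIV]] continuous_intros)
      (auto simp: real_polynomial_function_eq)
  show ?thesis using assms
  proof (induction arbitrary: h k rule: real_polynomial_function.induct)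
    case (linear f)
    have f: "f (cis x) = f 1 * cos x + f \<i> * sin x" for x
    proof -
      interpret bounded_linear f by fact
      have "cis x = cos x *\<^sub>R 1 + sin x *\<^sub>R \<i>" by (simp add: complex_eq_iff)
      then show ?thesis by (simp only: add scaleR) simp
    qed
    have eq: "(\<lambda>x. h x * f (cis x)) = (\<lambda>x. f 1 * (h x * cos x) + f \<i> * (h x * sin x))"
      by (auto simp: f algebra_simps)
    have c: "set_integrable lborel {0..2*pi} (\<lambda>x. h x * cos x)" "set_integrable lborel {0..2*pi} (\<lambda>x. h x * sin x)"
      by (intro set_integrable_mult_continuous linear continuous_intros)+
    show ?case unfolding eq
      using c linear by (subst fourier_coeff_add) (auto simp: fourier_coeff_cmult fourier_coeff_times_cos fourier_coeff_times_sin)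
  next
    case (const c)
    have "(\<lambda>x. h x * c) = (\<lambda>x. c * h x)" by auto
    then show ?case using const fourier_coeff_cmult[of c h k] by simp
  next
    case (add f g)
    have "(\<lambda>x. h x * (f (cis x) + g (cis x))) = (\<lambda>x. h x * f (cis x) + h x * g (cis x))"
      by (auto simp: algebra_simps)
    then show ?case
      using add by (simp add: fourier_coeff_add set_integrable_mult_continuous cont)
  next
    case (mult f g)
    have "(\<lambda>x. h x * (f (cis x) * g (cis x))) = (\<lambda>x. (h x * f (cis x)) * g (cis x))"
      by (auto simp: algebra_simps)
    moreover have "set_integrable lborel {0..2*pi} (\<lambda>x. h x * f (cis x))"
      using mult by (intro set_integrable_mult_continuous cont)
    ultimately show ?case using mult by auto
  qed
qed

text \<open>Stone-Weierstrass on the unit circle: polynomials in the coordinates of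
  \<open>cis x\<close> approximate \<Phi> uniformly, which is enough against an integrable
  weight.\<close>

lemma set_integral_times_circle_eq_0:
  fixes \<Phi> :: "complex \<Rightarrow> real"
  assumes h: "set_integrable lborel {0..2*pi} h" "\<And>k. fourier_coeff h k = 0"
    and \<Phi>: "continuous_on UNIV \<Phi>"
  shows "(LINT x:{0..2*pi}|lborel. h x * \<Phi> (cis x)) = 0"
proof (rule ccontr)
  assume ne: "\<not> ?thesis"
  let ?J = "LINT x:{0..2*pi}|lborel. h x * \<Phi> (cis x)"
  let ?N = "LINT x:{0..2*pi}|lborel. \<bar>h x\<bar>"
  have N: "?N \<ge> 0" unfolding set_lebesgue_integral_def by (intro integral_nonneg_AE) auto
  \<comment> \<open>Chosen so that the approximation error, at most e times the L1 norm of h, stays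
    below the supposedly nonzero integral; the + 1 covers a vanishing norm.\<close>
  define e where "e = \<bar>?J\<bar> / (2 * (?N + 1))"
  have e: "e > 0" using ne N by (auto simp: e_def)
  obtain P where P: "real_polynomial_function P" "\<And>x. x \<in> sphere 0 1 \<Longrightarrow> \<bar>\<Phi> x - P x\<bar> < e"
    using Stone_Weierstrass_real_polynomial_function[OF _ continuous_on_subset[OF \<Phi> subset_UNIV] e, of "sphere 0 1"]
    by auto
  have cont: "continuous_on UNIV (\<lambda>x. P (cis x))"
    using P by (intro continuous_on_compose2[OF continuous_on_polymonial_function[of P UNIV]] continuous_intros)
      (auto simp: real_polynomial_function_eq)
  have cont2: "continuous_on UNIV (\<lambda>x. \<Phi> (cis x))"
    by (intro continuous_on_compose2[OF \<Phi>] continuous_intros) auto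
  have i1: "set_integrable lborel {0..2*pi} (\<lambda>x. h x * P (cis x))"
    and i2: "set_integrable lborel {0..2*pi} (\<lambda>x. h x * \<Phi> (cis x))"
    using set_integrable_mult_continuous h cont cont2 by blast+
  have "fourier_coeff (\<lambda>x. h x * P (cis x)) 0 = 0"
    using fourier_coeff_times_polynomial_eq_0[OF P(1) h] .
  then have "complex_of_real (LINT x:{0..2*pi}|lborel. h x * P (cis x)) = 0"
    unfolding fourier_coeff_def by (subst set_integral_complex_of_real[symmetric]) simp
  then have 0: "(LINT x:{0..2*pi}|lborel. h x * P (cis x)) = 0" by simp
  have "?J = (LINT x:{0..2*pi}|lborel. h x * \<Phi> (cis x) - h x * P (cis x))"
    using set_integral_diff(2)[OF i2 i1] 0 by simp
  also have "\<bar>\<dots>\<bar> \<le> (LINT x:{0..2*pi}|lborel. norm (h x * \<Phi> (cis x) - h x * P (cis x)))"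
    using set_integral_norm_bound[OF set_integral_diff(1)[OF i2 i1]] by simp
  also have "\<dots> \<le> (LINT x:{0..2*pi}|lborel. e * \<bar>h x\<bar>)"
  proof (rule set_integral_mono)
    show "set_integrable lborel {0..2*pi} (\<lambda>x. norm (h x * \<Phi> (cis x) - h x * P (cis x)))"
      using set_integral_diff(1)[OF i2 i1] by (rule set_integrable_norm)
    show "set_integrable lborel {0..2*pi} (\<lambda>x. e * \<bar>h x\<bar>)" using set_integrable_abs[OF h(1)] by simp
    fix x :: real
    have "\<bar>\<Phi> (cis x) - P (cis x)\<bar> < e" using P(2)[of "cis x"] by simp
    then show "norm (h x * \<Phi> (cis x) - h x * P (cis x)) \<le> e * \<bar>h x\<bar>"
      by (simp add: abs_mult right_diff_distrib[symmetric]) (metis abs_ge_zero less_imp_le mult.commute mult_right_mono)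
  qed
  also have "\<dots> = e * ?N" by simp
  finally have "\<bar>?J\<bar> \<le> e * ?N" .
  moreover have "e * ?N < \<bar>?J\<bar>"
  proof -
    have "e * ?N < e * (2 * (?N + 1))" using e N by (intro mult_strict_left_mono) auto
    also have "\<dots> = \<bar>?J\<bar>" using N unfolding e_def by simp
    finally show ?thesis .
  qed
  ultimately show False by simp
qed

text \<open>The indicator of \<open>cis ` K\<close> is a bounded limit of continuous functions on the circle; the two end points,
  which \<open>cis\<close> identifies, form a null set.\<close>

lemma set_integral_closed_eq_0:
  assumes h: "set_integrable lborel {0..2*pi} h" "\<And>k. fourier_coeff h k = 0"
    and K: "closed K"
  shows "(LINT x:K|lborel. indicator {0..2*pi} x * h x) = 0"
proof (cases "K \<inter> {0..2*pi} = {}")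
  case True
  then have "indicator K x *\<^sub>R (indicator {0..2*pi} x * h x) = 0" for x
    by (auto simp: indicator_def)
  then show ?thesis unfolding set_lebesgue_integral_def by (simp only: integral_zero)
next
  case False
  define C where "C = cis ` (K \<inter> {0..2*pi})"
  have "compact C" unfolding C_def
    by (intro compact_continuous_image continuous_intros closed_Int_compact K) auto
  then have C: "closed C" "C \<noteq> {}" using False by (auto simp: C_def compact_imp_closed)
  \<comment> \<open>Tents of slope n over C: equal to 1 on C, and eventually 0 at any point off C
    because C is closed.\<close>
  define \<Phi> where "\<Phi> n z = max 0 (1 - real n * infdist z C)" for n z
  have \<Phi>: "continuous_on UNIV (\<Phi> n)" for n
    unfolding \<Phi>_def by (intro continuous_intros)
  have \<Phi>01: "0 \<le> \<Phi> n z" "\<Phi> n z \<le> 1" for n z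
    unfolding \<Phi>_def by (auto simp: infdist_nonneg)
  have lim: "(\<lambda>n. \<Phi> n z) \<longlonglongrightarrow> indicator C z" for z
  proof (cases "z \<in> C")
    case True
    then show ?thesis by (auto simp: \<Phi>_def)
  next
    case False
    then have d: "infdist z C > 0" using C in_closed_iff_infdist_zero[of C z] infdist_nonneg[of z C] by force
    have "eventually (\<lambda>n. real n \<ge> 1 / infdist z C) sequentially"
      by (rule eventually_compose_filterlim[OF eventually_ge_at_top filterlim_real_sequentially])
    then have "eventually (\<lambda>n. \<Phi> n z = 0) sequentially"
      by eventually_elim (use d in \<open>auto simp: \<Phi>_def field_simps\<close>)
    then show ?thesis using False by (simp add: tendsto_eventually)
  qed
  have hm: "(\<lambda>x. indicator {0..2*pi} x *\<^sub>R h x) \<in> borel_measurable lborel"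
    using h(1) unfolding set_integrable_def by (rule borel_measurable_integrable)
  have Phim: "(\<lambda>x. \<Phi> n (cis x)) \<in> borel_measurable borel" for n
    by (intro borel_measurable_continuous_onI continuous_on_compose2[OF \<Phi>] continuous_intros) auto
  have Cm: "(\<lambda>x. indicat_real C (cis x)) \<in> borel_measurable borel"
    by (rule borel_measurable_LIMSEQ_real[OF lim Phim])
  have "(\<lambda>n. LINT x|lborel. (indicator {0..2*pi} x *\<^sub>R h x) * \<Phi> n (cis x))
      \<longlonglongrightarrow> (LINT x|lborel. (indicator {0..2*pi} x *\<^sub>R h x) * indicat_real C (cis x))"
  proof (rule integral_dominated_convergence[where w="\<lambda>x. norm (indicator {0..2*pi} x *\<^sub>R h x)"])
    show "integrable lborel (\<lambda>x. norm (indicator {0..2*pi} x *\<^sub>R h x))"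
      using h(1) unfolding set_integrable_def by (rule integrable_norm)
    show "AE x in lborel. (\<lambda>n. (indicator {0..2*pi} x *\<^sub>R h x) * \<Phi> n (cis x))
        \<longlonglongrightarrow> (indicator {0..2*pi} x *\<^sub>R h x) * indicat_real C (cis x)"
      by (intro AE_I2 tendsto_intros lim)
    show "(\<lambda>x. (indicator {0..2*pi} x *\<^sub>R h x) * indicat_real C (cis x)) \<in> borel_measurable lborel"
      "(\<lambda>x. (indicator {0..2*pi} x *\<^sub>R h x) * \<Phi> n (cis x)) \<in> borel_measurable lborel" for n
      using hm Cm Phim by auto
    fix n
    show "AE x in lborel. norm ((indicator {0..2*pi} x *\<^sub>R h x) * \<Phi> n (cis x)) \<le> norm (indicator {0..2*pi} x *\<^sub>R h x)"
    proof (intro AE_I2)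
      fix x
      show "norm ((indicator {0..2*pi} x *\<^sub>R h x) * \<Phi> n (cis x)) \<le> norm (indicator {0..2*pi} x *\<^sub>R h x)"
        using \<Phi>01[of n "cis x"] by (simp add: abs_mult mult_left_le)
    qed
  qed
  moreover have "(LINT x|lborel. (indicator {0..2*pi} x *\<^sub>R h x) * \<Phi> n (cis x)) = 0" for n
    using set_integral_times_circle_eq_0[OF h \<Phi>, of n] by (simp add: set_lebesgue_integral_def mult.assoc)
  ultimately have 0: "(LINT x|lborel. (indicator {0..2*pi} x *\<^sub>R h x) * indicat_real C (cis x)) = 0"
    by (simp only: LIMSEQ_const_iff)
  have "(LINT x:K|lborel. indicator {0..2*pi} x * h x)
      = (LINT x|lborel. (indicator {0..2*pi} x *\<^sub>R h x) * indicat_real C (cis x))"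
    unfolding set_lebesgue_integral_def
  proof (rule integral_cong_AE)
    show "(\<lambda>x. indicator K x *\<^sub>R (indicator {0..2*pi} x * h x)) \<in> borel_measurable lborel"
      using hm K by (simp add: borel_closed)
    show "(\<lambda>x. (indicator {0..2*pi} x *\<^sub>R h x) * indicat_real C (cis x)) \<in> borel_measurable lborel"
      using hm Cm by auto
    have "AE x in lborel. x \<notin> {0, 2*pi}"
      by (intro AE_not_in finite_imp_null_set_lborel) auto
    then show "AE x in lborel. indicator K x *\<^sub>R (indicator {0..2*pi} x * h x)
        = (indicator {0..2*pi} x *\<^sub>R h x) * indicat_real C (cis x)"
    proof eventually_elim
      case (elim x)
      \<comment> \<open>\<open>cis\<close> is injective on a period apart from its end points: two
        preimages differ by 2 pi n, and with x in the open interval only n = 0 is possible.\<close>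
      have "x \<in> K \<longleftrightarrow> cis x \<in> C" if "x \<in> {0..2*pi}"
      proof
        assume "cis x \<in> C"
        then obtain y where y: "y \<in> K" "y \<in> {0..2*pi}" "cis x = cis y" unfolding C_def by auto
        then have "sin x = sin y \<and> cos x = cos y" by (auto simp: complex_eq_iff)
        then obtain n :: int where n: "x = y + 2 * pi * n" using sin_cos_eq_iff by blast
        have "n < 1"
        proof (rule ccontr)
          assume "\<not> n < 1"
          then have "2 * pi * 1 \<le> 2 * pi * of_int n" by (intro mult_left_mono) auto
          then have "y + 2 * pi \<le> x" using n by linarith
          then show False using that y elim by auto
        qed
        moreover have "n > -1"
        proof (rule ccontr)
          assume "\<not> n > -1"
          then have "2 * pi * of_int n \<le> 2 * pi * (-1)" by (intro mult_left_mono) auto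
          then have "x \<le> y - 2 * pi" using n by linarith
          then show False using that y elim by auto
        qed
        ultimately have "n = 0" by simp
        then show "x \<in> K" using n y by simp
      qed (use that in \<open>auto simp: C_def\<close>)
      then show ?case by (auto simp: indicator_def)
    qed
  qed
  then show ?thesis using 0 by simp
qed

text \<open>Closed sets form an intersection-stable generator of the Borel sets, and the sets over
  which the integral vanishes are stable under complements and disjoint unions. A density whose
  integral vanishes over every Borel set is zero almost everywhere.\<close>

lemma AE_zero_if_fourier_coeff_zero:
  assumes h: "set_integrable lborel {0..2*pi} h" "\<And>k. fourier_coeff h k = 0"
  shows "AE x in lborel. indicator {0..2*pi} x * h x = 0"
proof (rule density_unique_real)
  let ?f = "\<lambda>x. indicator {0..2*pi} x * h x"
  show i: "integrable lborel ?f" using h(1) by (simp add: set_integrable_def)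
  show "integrable lborel (\<lambda>x. 0 :: real)" by simp
  have iA: "set_integrable lborel A ?f" if "A \<in> sets borel" for A
    unfolding set_integrable_def by (rule integrable_mult_indicator[OF _ i]) (use that in simp)
  have univ: "(LINT x:UNIV|lborel. ?f x) = 0"
    using set_integral_closed_eq_0[OF h] by blast
  fix A :: "real set" assume "A \<in> sets lborel"
  then have "A \<in> sigma_sets UNIV {K. closed K}" by (simp add: borel_eq_closed)
  then have "(LINT x:A|lborel. ?f x) = 0"
  proof (induction rule: sigma_sets_induct_disjoint[rotated 2, consumes 1, case_names closed empty compl union])
    case (closed A)
    then show ?case using set_integral_closed_eq_0[OF h] by auto
  next
    case (compl A)
    then have A: "A \<in> sets borel" by (simp add: borel_eq_closed)
    have "(LINT x:A \<union> (UNIV - A)|lborel. ?f x) = (LINT x:A|lborel. ?f x) + (LINT x:UNIV - A|lborel. ?f x)"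
      by (rule set_integral_Un) (use A in \<open>auto intro!: iA\<close>)
    then show ?case using compl univ by simp
  next
    case (union A)
    then have A: "A i \<in> sets borel" for i by (auto simp: borel_eq_closed)
    have "(LINT x:(\<Union>i. A i)|lborel. ?f x) = (\<Sum>i. (LINT x:A i|lborel. ?f x))"
      by (rule lebesgue_integral_countable_add) (use A union in \<open>auto intro!: iA simp: disjoint_family_on_def\<close>)
    then show ?case using union by simp
  qed (auto simp: Int_stable_def set_lebesgue_integral_def)
  then show "(LINT x:A|lborel. ?f x) = (LINT x:A|lborel. 0)" by simp
qed

section \<open>Continuous functions on the circle\<close>

text \<open>The working class: its members are determined at every point by their Fourier
  coefficients, whereas those of \<open>L2_circle\<close> are determined only almost
  everywhere.\<close>

definition circle_cont :: "(real \<Rightarrow> real) \<Rightarrow> bool" where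
  "circle_cont f \<longleftrightarrow> continuous_on UNIV f \<and> (\<forall>x. f (x + 2 * pi) = f x)"

lemma circle_contI:
  "continuous_on UNIV f \<Longrightarrow> (\<And>x. f (x + 2 * pi) = f x) \<Longrightarrow> circle_cont f"
  by (simp add: circle_cont_def)

lemma circle_cont_on: "circle_cont f \<Longrightarrow> continuous_on S f"
  unfolding circle_cont_def using continuous_on_subset by blast

lemma circle_cont_periodic: "circle_cont f \<Longrightarrow> f (x + 2 * pi) = f x"
  unfolding circle_cont_def by blast

lemma circle_cont_comp2:
  assumes "circle_cont f" "circle_cont g" "continuous_on UNIV (\<lambda>(a,b). G a b)"
  shows "circle_cont (\<lambda>x. G (f x) (g x))"
proof (rule circle_contI)
  have "continuous_on UNIV (\<lambda>x. (\<lambda>(a,b). G a b) (f x, g x))"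
    by (rule continuous_on_compose2[OF assms(3)])
       (use assms in \<open>auto intro!: continuous_intros simp: circle_cont_on\<close>)
  then show "continuous_on UNIV (\<lambda>x. G (f x) (g x))" by simp
qed (use assms in \<open>simp add: circle_cont_periodic\<close>)

lemma circle_cont_add [intro]:
  "circle_cont f \<Longrightarrow> circle_cont g \<Longrightarrow> circle_cont (\<lambda>x. f x + g x)"
  and circle_cont_diff [intro]:
  "circle_cont f \<Longrightarrow> circle_cont g \<Longrightarrow> circle_cont (\<lambda>x. f x - g x)"
  and circle_cont_mult [intro]:
  "circle_cont f \<Longrightarrow> circle_cont g \<Longrightarrow> circle_cont (\<lambda>x. f x * g x)"
  by (rule circle_cont_comp2, assumption+, simp add: case_prod_beta, intro continuous_intros)+

lemma circle_cont_const [intro]: "circle_cont (\<lambda>x. c)"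
  by (simp add: circle_cont_def)

lemma circle_cont_cos [intro]: "circle_cont cos"
  by (auto intro!: circle_contI continuous_intros)

lemma periodic_add_int:
  fixes f :: "real \<Rightarrow> 'a"
  assumes "\<And>x. f (x + 2 * pi) = f x"
  shows "f (x + 2 * pi * of_int n) = f x"
proof -
  have nat: "f (x + 2 * pi * real m) = f x" for x m
  proof (induction m)
    case (Suc m)
    have "f (x + 2 * pi * real (Suc m)) = f ((x + 2 * pi * real m) + 2 * pi)" by (simp add: algebra_simps)
    then show ?case using Suc assms by simp
  qed simp
  show ?thesis
  proof (cases "n \<ge> 0")
    case True then show ?thesis using nat[of x "nat n"] by simp
  next
    case False
    then show ?thesis using nat[of "x + 2 * pi * of_int n" "nat (-n)"] by simp
  qed
qed

text \<open>The point y is chosen before the function, so that two periodic functions can be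
  compared at the same representative.\<close>

lemma periodic_representative:
  fixes x :: real
  shows "\<exists>y\<in>{0..2*pi}. \<forall>f :: real \<Rightarrow> real. (\<forall>x. f (x + 2 * pi) = f x) \<longrightarrow> f x = f y"
proof -
  define n where "n = \<lfloor>x / (2*pi)\<rfloor>"
  have "of_int n \<le> x / (2*pi)" "x / (2*pi) < of_int n + 1" unfolding n_def by linarith+
  then have "x - 2 * pi * of_int n \<in> {0..2*pi}" by (simp add: field_simps)
  moreover have "f x = f (x - 2 * pi * of_int n)" if "\<forall>x. f (x + 2 * pi) = f x" for f :: "real \<Rightarrow> real"
    using periodic_add_int[of f "x - 2 * pi * of_int n" n] that by simp
  ultimately show ?thesis by blast
qed

lemma circle_cont_bounded:
  assumes "circle_cont f"
  obtains B where "B \<ge> 0" "\<And>x. \<bar>f x\<bar> \<le> B"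
proof -
  have "compact (f ` {0..2*pi})"
    using assms by (intro compact_continuous_image circle_cont_on) auto
  then obtain B where B: "\<forall>y\<in>f ` {0..2*pi}. \<bar>y\<bar> \<le> B"
    using compact_imp_bounded[of "f ` {0..2*pi}"] unfolding bounded_real by blast
  have "\<bar>f x\<bar> \<le> B" for x
  proof -
    obtain y where "y \<in> {0..2*pi}" and y: "\<forall>f :: real \<Rightarrow> real. (\<forall>x. f (x + 2 * pi) = f x) \<longrightarrow> f x = f y"
      using periodic_representative[of x] by (elim bexE)
    then show ?thesis using B y[rule_format, of f, OF circle_cont_periodic[OF assms]] by auto
  qed
  moreover from this[of 0] have "B \<ge> 0" by linarith
  ultimately show ?thesis using that by blast
qed

lemma circle_cont_integrable: "circle_cont f \<Longrightarrow> set_integrable lborel {0..2*pi} f"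
  by (rule borel_integrable_atLeastAtMost') (rule circle_cont_on)

lemma circle_cont_L2: "circle_cont f \<Longrightarrow> f \<in> L2_circle"
  unfolding L2_circle_def circle_cont_def
  by (auto intro!: borel_measurable_continuous_onI borel_integrable_atLeastAtMost' continuous_intros
      intro: continuous_on_subset)

lemma L2_circle_integrable:
  assumes "f \<in> L2_circle"
  shows "set_integrable lborel {0..2*pi} f"
proof (rule set_integrable_bound[where f="\<lambda>x. 1 + (f x)\<^sup>2"])
  show "set_integrable lborel {0..2*pi} (\<lambda>x. 1 + (f x)\<^sup>2)"
    using assms by (intro set_integral_add(1)[OF borel_integrable_atLeastAtMost']) (auto simp: L2_circle_def)
  have "f \<in> borel_measurable lborel" using assms by (simp add: L2_circle_def)
  then show "set_borel_measurable lborel {0..2*pi} f"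
    unfolding set_borel_measurable_def by (intro borel_measurable_scaleR borel_measurable_indicator) auto
  show "AE x in lborel. x \<in> {0..2 * pi} \<longrightarrow> norm (f x) \<le> norm (1 + (f x)\<^sup>2)"
  proof (intro AE_I2 impI)
    fix x
    have "0 \<le> (\<bar>f x\<bar> - 1)\<^sup>2 + \<bar>f x\<bar>" by simp
    then show "norm (f x) \<le> norm (1 + (f x)\<^sup>2)" by (simp add: power2_diff)
  qed
qed

section \<open>Recovering functions and norms from Fourier coefficients\<close>

lemma fourier_coeff_eq_imp_AE_eq:
  assumes "set_integrable lborel {0..2*pi} f" "set_integrable lborel {0..2*pi} g"
    and "\<And>k. fourier_coeff f k = fourier_coeff g k"
  shows "AE x in lborel. x \<in> {0..2*pi} \<longrightarrow> f x = g x"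
proof -
  have "AE x in lborel. indicator {0..2*pi} x * (f x - g x) = 0"
    using assms by (intro AE_zero_if_fourier_coeff_zero) (auto simp: fourier_coeff_diff intro: set_integral_diff)
  then show ?thesis by eventually_elim (auto simp: indicator_def)
qed

text \<open>Makes the arbitrary choice in \<open>sobolev_norm\<close> harmless: any two admissible
  multiplier images have the same norm.\<close>

lemma L2_norm_eqI:
  assumes "f \<in> L2_circle" "g \<in> L2_circle" "\<And>k. fourier_coeff f k = fourier_coeff g k"
  shows "L2_norm f = L2_norm g"
proof -
  have "(LINT x:{0..2*pi}|lborel. (f x)\<^sup>2) = (LINT x:{0..2*pi}|lborel. (g x)\<^sup>2)"
  proof (rule set_lebesgue_integral_cong_AE)
    show "AE x\<in>{0..2*pi} in lborel. (f x)\<^sup>2 = (g x)\<^sup>2"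
      using fourier_coeff_eq_imp_AE_eq[OF assms(1,2)[THEN L2_circle_integrable] assms(3)]
      by eventually_elim auto
  qed (use assms in \<open>auto simp: L2_circle_def\<close>)
  then show ?thesis by (simp add: L2_norm_def)
qed

text \<open>The squared difference is continuous with zero integral over a period, so it vanishes
  there everywhere; periodicity does the rest.\<close>

lemma circle_cont_eqI:
  assumes fg: "circle_cont f" "circle_cont g" "\<And>k. fourier_coeff f k = fourier_coeff g k"
  shows "f = g"
proof
  fix x
  let ?d = "\<lambda>x. (f x - g x)\<^sup>2"
  have c: "continuous_on S ?d" for S
    using fg by (intro continuous_intros circle_cont_on)
  have "(LINT x:{0..2*pi}|lborel. ?d x) = (LINT x:{0..2*pi}|lborel. 0)"
  proof (rule set_lebesgue_integral_cong_AE)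
    show "AE x\<in>{0..2*pi} in lborel. ?d x = 0"
      using fourier_coeff_eq_imp_AE_eq[OF fg(1,2)[THEN circle_cont_integrable] fg(3)]
      by eventually_elim auto
  qed (use c in \<open>auto intro: borel_measurable_continuous_onI\<close>)
  moreover have "set_integrable lborel {0..2*pi} ?d" by (intro borel_integrable_atLeastAtMost' c)
  ultimately have "(?d has_integral 0) (cbox 0 (2*pi))"
    using set_borel_integral_eq_integral[of "{0..2*pi}" ?d] by (simp add: has_integral_iff)
  then have 0: "?d y = 0" if "y \<in> {0..2*pi}" for y
    by (rule has_integral_0_cbox_imp_0[OF c, rotated]) (use that pi_gt_zero in \<open>auto simp del: pi_gt_zero\<close>)
  obtain y where "y \<in> {0..2*pi}" and y: "\<forall>f :: real \<Rightarrow> real. (\<forall>x. f (x + 2 * pi) = f x) \<longrightarrow> f x = f y"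
    using periodic_representative[of x] by (elim bexE)
  then show "f x = g x"
    using 0[of y] y[rule_format, of f, OF circle_cont_periodic[OF fg(1)]] y[rule_format, of g, OF circle_cont_periodic[OF fg(2)]] by simp
qed

lemma norm_fourier_coeff_le:
  assumes "circle_cont f" "\<And>x. \<bar>f x\<bar> \<le> B"
  shows "norm (fourier_coeff f k) \<le> B"
proof -
  let ?e = "\<lambda>x. complex_of_real (f x) * cis (- (of_int k * x))"
  have i: "set_integrable lborel {0..2*pi} ?e"
    by (intro set_integrable_fourier circle_cont_integrable assms)
  have "norm (LINT x:{0..2*pi}|lborel. ?e x) \<le> (LINT x:{0..2*pi}|lborel. norm (?e x))"
    by (rule set_integral_norm_bound[OF i])
  also have "\<dots> \<le> (LINT x:{0..2*pi}|lborel. B)"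
    by (intro set_integral_mono set_integrable_norm i borel_integrable_atLeastAtMost') (use assms in \<open>auto simp: norm_mult\<close>)
  also have "\<dots> = 2 * pi * B" by (simp add: set_lebesgue_integral_def)
  finally show ?thesis unfolding fourier_coeff_def by (simp add: norm_mult norm_divide field_simps)
qed

lemma fourier_coeff_uminus_freq: "fourier_coeff f (- k) = cnj (fourier_coeff f k)"
proof -
  have "cnj (LINT x:{0..2*pi}|lborel. complex_of_real (f x) * cis (- (of_int k * x)))
     = (LINT x|lborel. cnj (indicator {0..2*pi} x *\<^sub>R (complex_of_real (f x) * cis (- (of_int k * x)))))"
    unfolding set_lebesgue_integral_def by (simp only: Bochner_Integration.integral_cnj)
  also have "\<dots> = (LINT x:{0..2*pi}|lborel. complex_of_real (f x) * cis (- (of_int (- k) * x)))"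
    unfolding set_lebesgue_integral_def by (intro Bochner_Integration.integral_cong) (auto simp: cis_cnj)
  finally show ?thesis unfolding fourier_coeff_def by simp
qed

section \<open>Derivatives, primitives and translations of periodic functions\<close>

lemma set_integral_FTC:
  fixes F :: "real \<Rightarrow> complex"
  assumes "\<And>x. (F has_vector_derivative f x) (at x)" "continuous_on UNIV f"
  shows "(LINT x:{0..2*pi}|lborel. f x) = F (2*pi) - F 0"
  unfolding set_lebesgue_integral_def
  by (rule integral_FTC_atLeastAtMost)
     (use assms in \<open>auto intro: has_vector_derivative_at_within continuous_on_subset\<close>)

lemma cis_two_pi_int [simp]: "cis (2 * pi * of_int k) = 1" "cis (of_int k * (2 * pi)) = 1"
  "cis (- (of_int k * (2 * pi))) = 1"
  by (auto simp: complex_eq_iff mult.commute[of "of_int k"] cos_int_2pin sin_int_2pin)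

text \<open>Integration by parts over one period; periodicity of F and of \<open>cis\<close> makes
  the boundary terms cancel.\<close>

lemma fourier_coeff_deriv:
  assumes F: "\<And>x. (F has_real_derivative f x) (at x)" and per: "\<And>x. F (x + 2 * pi) = F x"
    and f: "circle_cont f"
  shows "fourier_coeff f k = \<i> * of_int k * fourier_coeff F k"
proof -
  have cF: "continuous_on S F" for S
    using F by (meson DERIV_isCont continuous_at_imp_continuous_on)
  have F': "circle_cont F" by (intro circle_contI cF per)
  let ?e = "\<lambda>g x. complex_of_real (g x) * cis (- (of_int k * x))"
  have i: "set_integrable lborel {0..2*pi} (?e F)" "set_integrable lborel {0..2*pi} (?e f)"
    by (intro set_integrable_fourier circle_cont_integrable F' f)+
  have D: "(?e F has_vector_derivative (?e f x - \<i> * of_int k * ?e F x)) (at x)" for x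
    unfolding has_vector_derivative_complex_iff
    by (auto intro!: derivative_eq_intros F simp: algebra_simps)
  have c: "continuous_on UNIV (\<lambda>x. ?e f x - \<i> * of_int k * ?e F x)"
    by (intro continuous_intros cF circle_cont_on f)
  have "(LINT x:{0..2*pi}|lborel. ?e f x - \<i> * of_int k * ?e F x) = ?e F (2*pi) - ?e F 0"
    by (rule set_integral_FTC[OF D c])
  also have "\<dots> = 0" using per[of 0] by simp
  finally have "(LINT x:{0..2*pi}|lborel. ?e f x - \<i> * of_int k * ?e F x) = 0" .
  moreover have "set_integrable lborel {0..2*pi} (\<lambda>x. \<i> * of_int k * ?e F x)"
    using i(1) by (rule set_integrable_mult_right[rotated])
  ultimately have "(LINT x:{0..2*pi}|lborel. ?e f x) = (LINT x:{0..2*pi}|lborel. \<i> * of_int k * ?e F x)"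
    using set_integral_diff(2)[OF i(2)] by (simp only: right_minus_eq)
  then show ?thesis unfolding fourier_coeff_def by (simp only: set_integral_mult_right ac_simps)
qed

lemma antiderivative_exists:
  fixes f :: "real \<Rightarrow> real"
  assumes "continuous_on UNIV f"
  obtains F where "\<And>x. (F has_real_derivative f x) (at x)"
proof
  fix x :: real
  let ?a = "- \<bar>x\<bar> - 1" and ?b = "\<bar>x\<bar> + 1"
  have "((\<lambda>u. LBINT y=0..u. f y) has_vector_derivative f x) (at x within {?a..?b})"
    using interval_integral_FTC2[of ?a 0 ?b f x] continuous_on_subset[OF assms subset_UNIV]
    by (auto simp: zero_ereal_def)
  moreover have "at x within {?a..?b} = at x"
    by (rule at_within_interior) auto
  ultimately show "((\<lambda>u. LBINT y=0..u. f y) has_real_derivative f x) (at x)"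
    by (simp add: has_real_derivative_iff_has_vector_derivative)
qed

text \<open>The increment over a period has derivative g(x + 2 pi) - g(x) = 0. This yields both the
  translation invariance of the integral and, for mean zero, periodicity of the primitive.\<close>

lemma antiderivative_period_increment:
  assumes G: "\<And>x. (G has_real_derivative g x) (at x)" and g: "circle_cont g"
  shows "G (x + 2*pi) - G x = G (y + 2*pi) - G y"
proof -
  have "((\<lambda>x. G (x + 2*pi) - G x) has_real_derivative 0) (at x)" for x
    using DERIV_diff[OF iffD1[OF DERIV_shift G[of "x + 2*pi"]] G[of x]] circle_cont_periodic[OF g] by simp
  then show ?thesis by (intro DERIV_isconst_all allI)
qed

lemma set_integral_periodic_shift:
  fixes g :: "real \<Rightarrow> real"
  assumes g: "circle_cont g"
  shows "(LINT x:{0..2*pi}|lborel. g (x - c)) = (LINT x:{0..2*pi}|lborel. g x)"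
proof -
  obtain G where G: "\<And>x. (G has_real_derivative g x) (at x)"
    using antiderivative_exists[OF circle_cont_on[OF g]] by blast
  have I: "(LINT x:{0..2*pi}|lborel. g (x - c)) = G (2*pi - c) - G (0 - c)" for c
    unfolding set_lebesgue_integral_def
  proof (rule integral_FTC_atLeastAtMost)
    show "continuous_on {0..2*pi} (\<lambda>x. g (x - c))"
      by (rule continuous_on_compose2[OF circle_cont_on[OF g, of UNIV]]) (auto intro!: continuous_intros)
    fix x
    have "((\<lambda>x. G (x - c)) has_real_derivative g (x - c)) (at x)"
      using DERIV_shift[of G "g (x - c)" x "- c"] G[of "x - c"] by simp
    then show "((\<lambda>x. G (x - c)) has_vector_derivative g (x - c)) (at x within {0..2*pi})"
      by (auto simp: has_real_derivative_iff_has_vector_derivative intro: has_vector_derivative_at_within)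
  qed auto
  from antiderivative_period_increment[OF G g, of "-c" 0] show ?thesis using I[of c] I[of 0] by (simp add: add.commute)
qed

lemma circle_cont_shift:
  assumes "circle_cont f" shows "circle_cont (\<lambda>x. f (x - c))"
proof (rule circle_contI)
  show "continuous_on UNIV (\<lambda>x. f (x - c))"
    by (rule continuous_on_compose2[OF circle_cont_on[OF assms, of UNIV]]) (auto intro!: continuous_intros)
  show "f (x + 2 * pi - c) = f (x - c)" for x
    using circle_cont_periodic[OF assms, of "x - c"] by (simp add: algebra_simps)
qed

text \<open>Reduces complex coefficients to real integrals, to which translation invariance and
  parity arguments apply.\<close>

lemma fourier_coeff_Re_Im:
  assumes "circle_cont f"
  shows "fourier_coeff f k = Complex ((LINT x:{0..2*pi}|lborel. f x * cos (of_int k * x)) / (2*pi))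
                                     (- (LINT x:{0..2*pi}|lborel. f x * sin (of_int k * x)) / (2*pi))"
proof -
  let ?e = "\<lambda>x. complex_of_real (f x) * cis (- (of_int k * x))"
  have i: "integrable lborel (\<lambda>x. indicator {0..2*pi} x *\<^sub>R ?e x)"
    using set_integrable_fourier[OF circle_cont_integrable[OF assms]] unfolding set_integrable_def .
  have "Re (LINT x:{0..2*pi}|lborel. ?e x) = (LINT x:{0..2*pi}|lborel. f x * cos (of_int k * x))"
    unfolding set_lebesgue_integral_def by (subst integral_Re[OF i, symmetric]) simp
  moreover have "Im (LINT x:{0..2*pi}|lborel. ?e x) = (LINT x:{0..2*pi}|lborel. - (f x * sin (of_int k * x)))"
    unfolding set_lebesgue_integral_def by (subst integral_Im[OF i, symmetric]) simp
  moreover have "(LINT x:{0..2*pi}|lborel. - (f x * sin (of_int k * x))) = - (LINT x:{0..2*pi}|lborel. f x * sin (of_int k * x))"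
    unfolding set_lebesgue_integral_def by simp
  ultimately show ?thesis unfolding fourier_coeff_def by (simp add: complex_eq_iff)
qed

lemma circle_cont_harmonic:
  "circle_cont (\<lambda>x. cos (of_int k * x))" "circle_cont (\<lambda>x. sin (of_int k * x))"
proof -
  have "of_int k * (x + 2 * pi) = of_int k * x + 2 * pi * of_int k" for x :: real by (simp add: algebra_simps)
  then show "circle_cont (\<lambda>x. cos (of_int k * x))" "circle_cont (\<lambda>x. sin (of_int k * x))"
    by (auto intro!: circle_contI continuous_intros simp: cos_add sin_add)
qed

text \<open>A translation becomes a phase factor; for travelling waves of different speeds these
  factors produce the lower bound on the distance.\<close>

lemma fourier_coeff_shift:
  assumes f: "circle_cont f"
  shows "fourier_coeff (\<lambda>x. f (x - c)) k = cis (- (of_int k * c)) * fourier_coeff f k"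
proof -
  define C where "C = (LINT x:{0..2*pi}|lborel. f x * cos (of_int k * x))"
  define S where "S = (LINT x:{0..2*pi}|lborel. f x * sin (of_int k * x))"
  have ci: "circle_cont (\<lambda>x. f x * cos (of_int k * x))" "circle_cont (\<lambda>x. f x * sin (of_int k * x))"
    by (intro circle_cont_mult f circle_cont_harmonic)+
  have "(LINT x:{0..2*pi}|lborel. f (x - c) * cos (of_int k * x))
      = (LINT x:{0..2*pi}|lborel. f (x - c) * cos (of_int k * (x - c) + of_int k * c))" by (simp add: algebra_simps)
  also have "\<dots> = (LINT x:{0..2*pi}|lborel. f x * cos (of_int k * x + of_int k * c))"
    by (rule set_integral_periodic_shift[of "\<lambda>x. f x * cos (of_int k * x + of_int k * c)"])
      (use f circle_cont_harmonic in \<open>auto simp only: cos_add intro!: circle_cont_mult circle_cont_diff circle_cont_const\<close>)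
  also have "\<dots> = (LINT x:{0..2*pi}|lborel. cos (of_int k * c) * (f x * cos (of_int k * x)) - sin (of_int k * c) * (f x * sin (of_int k * x)))"
    by (simp add: cos_add algebra_simps)
  also have "\<dots> = cos (of_int k * c) * C - sin (of_int k * c) * S"
    unfolding C_def S_def using ci[THEN circle_cont_integrable] by (subst set_integral_diff(2)) auto
  finally have 1: "(LINT x:{0..2*pi}|lborel. f (x - c) * cos (of_int k * x)) = cos (of_int k * c) * C - sin (of_int k * c) * S" .
  have "(LINT x:{0..2*pi}|lborel. f (x - c) * sin (of_int k * x))
      = (LINT x:{0..2*pi}|lborel. f (x - c) * sin (of_int k * (x - c) + of_int k * c))" by (simp add: algebra_simps)
  also have "\<dots> = (LINT x:{0..2*pi}|lborel. f x * sin (of_int k * x + of_int k * c))"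
    by (rule set_integral_periodic_shift[of "\<lambda>x. f x * sin (of_int k * x + of_int k * c)"])
      (use f circle_cont_harmonic in \<open>auto simp only: sin_add intro!: circle_cont_mult circle_cont_add circle_cont_const\<close>)
  also have "\<dots> = (LINT x:{0..2*pi}|lborel. cos (of_int k * c) * (f x * sin (of_int k * x)) + sin (of_int k * c) * (f x * cos (of_int k * x)))"
    by (simp add: sin_add algebra_simps)
  also have "\<dots> = cos (of_int k * c) * S + sin (of_int k * c) * C"
    unfolding C_def S_def using ci[THEN circle_cont_integrable] by (subst set_integral_add(2)) auto
  finally have 2: "(LINT x:{0..2*pi}|lborel. f (x - c) * sin (of_int k * x)) = cos (of_int k * c) * S + sin (of_int k * c) * C" .
  show ?thesis
    unfolding fourier_coeff_Re_Im[OF f] fourier_coeff_Re_Im[OF circle_cont_shift[OF f]] 1 2 C_def[symmetric] S_def[symmetric]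
    by (simp add: complex_eq_iff field_simps)
qed

text \<open>Cauchy-Schwarz against the constant function; the normalisation of the coefficients
  leaves a spare factor \<open>sqrt (2 * pi)\<close>, which is discarded.\<close>

lemma norm_fourier_coeff_le_L2:
  assumes g: "g \<in> L2_circle"
  shows "norm (fourier_coeff g k) \<le> L2_norm g"
proof -
  let ?e = "\<lambda>x. complex_of_real (g x) * cis (- (of_int k * x))"
  define I where "I = (LINT x:{0..2*pi}|lborel. \<bar>g x\<bar>)"
  define J where "J = (LINT x:{0..2*pi}|lborel. (g x)\<^sup>2)"
  have ig: "set_integrable lborel {0..2*pi} g" by (rule L2_circle_integrable[OF g])
  have i2: "set_integrable lborel {0..2*pi} (\<lambda>x. (g x)\<^sup>2)" using g by (simp add: L2_circle_def)
  have "norm (LINT x:{0..2*pi}|lborel. ?e x) \<le> (LINT x:{0..2*pi}|lborel. norm (?e x))"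
    by (rule set_integral_norm_bound[OF set_integrable_fourier[OF ig]])
  then have 1: "norm (LINT x:{0..2*pi}|lborel. ?e x) \<le> I" by (simp add: norm_mult I_def)
  \<comment> \<open>The mean of |g|: expanding the integral of (|g| - m)^2 \<ge> 0 with this m gives
    the Cauchy-Schwarz inequality.\<close>
  define m where "m = I / (2*pi)"
  have I0: "I \<ge> 0" unfolding I_def set_lebesgue_integral_def by (intro integral_nonneg_AE) auto
  have ia: "set_integrable lborel {0..2*pi} (\<lambda>x. \<bar>g x\<bar>)" by (rule set_integrable_abs[OF ig])
  have ic: "set_integrable lborel {0..2*pi} (\<lambda>x. m\<^sup>2)" by (intro borel_integrable_atLeastAtMost') auto
  have "0 \<le> (LINT x:{0..2*pi}|lborel. (\<bar>g x\<bar> - m)\<^sup>2)"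
    unfolding set_lebesgue_integral_def by (intro integral_nonneg_AE) auto
  also have "\<dots> = (LINT x:{0..2*pi}|lborel. ((g x)\<^sup>2 + m\<^sup>2) - 2 * m * \<bar>g x\<bar>)"
    by (simp add: power2_diff mult.commute mult.left_commute)
  also have "\<dots> = J + 2 * pi * m\<^sup>2 - 2 * m * I"
    using i2 ia ic by (subst set_integral_diff(2)) (auto simp: I_def J_def set_integral_add, simp add: set_lebesgue_integral_def)
  finally have "I\<^sup>2 \<le> 2 * pi * J" by (simp add: m_def power2_eq_square field_simps)
  have "norm (fourier_coeff g k) \<le> I / (2 * pi)"
    unfolding fourier_coeff_def using 1 by (simp add: norm_mult norm_divide field_simps)
  also have "\<dots> \<le> I / sqrt (2 * pi)"
  proof -
    have "sqrt (2 * pi) \<le> 2 * pi" using pi_ge_two by (intro real_le_lsqrt) (auto simp: power2_eq_square)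
    then show ?thesis using I0 by (intro divide_left_mono) auto
  qed
  also have "\<dots> \<le> sqrt (2 * pi * J) / sqrt (2 * pi)"
    using \<open>I\<^sup>2 \<le> 2 * pi * J\<close> by (intro divide_right_mono real_le_rsqrt) auto
  also have "\<dots> = L2_norm g" by (simp add: L2_norm_def J_def real_sqrt_mult)
  finally show ?thesis .
qed

section \<open>Fourier multipliers\<close>

text \<open>The real form of a two-sided Fourier series: only frequencies n \<ge> 0 are stored, and
  the conjugate coefficient at -n is accounted for by twice the real part.\<close>

definition trig_series :: "(nat \<Rightarrow> complex) \<Rightarrow> real \<Rightarrow> real" where
  "trig_series c x = Re (c 0) + (\<Sum>n. 2 * Re (c (Suc n) * cis (real (Suc n) * x)))"

lemma integral_cis:
  "(LINT x:{0..2*pi}|lborel. cis (of_int j * x)) = (if j = 0 then 2 * pi else 0)"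
proof (cases "j = 0")
  case True
  have "(LINT x:{0..2*pi}|lborel. (1::complex)) = complex_of_real (2*pi)"
    unfolding set_lebesgue_integral_def by (simp add: scaleR_conv_of_real)
  then show ?thesis using True by (simp add: cis_zero)
next
  case False
  let ?F = "\<lambda>x. cis (of_int j * x) * Complex 0 (- 1 / of_int j)"
  have "(?F has_vector_derivative cis (of_int j * x)) (at x)" for x
    unfolding has_vector_derivative_complex_iff using False
    by (auto intro!: derivative_eq_intros)
  then have "(LINT x:{0..2*pi}|lborel. cis (of_int j * x)) = ?F (2*pi) - ?F 0"
    by (rule set_integral_FTC) (intro continuous_intros)
  then show ?thesis using False by simp
qed

lemma circle_cont_trig_term: "circle_cont (\<lambda>x. 2 * Re (c * cis (real n * x)))"
proof -
  have "circle_cont (\<lambda>x. 2 * Re c * cos (of_int (int n) * x) - 2 * Im c * sin (of_int (int n) * x))"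
    by (intro circle_cont_diff circle_cont_mult circle_cont_const circle_cont_harmonic)
  then show ?thesis by (simp add: algebra_simps)
qed

lemma fourier_coeff_trig_term:
  assumes "n > 0"
  shows "fourier_coeff (\<lambda>x. 2 * Re (c * cis (real n * x))) k
       = (if k = int n then c else if k = - int n then cnj c else 0)"
proof -
  have eq: "complex_of_real (2 * Re (c * cis (real n * x))) * cis (- (of_int k * x))
      = c * cis (of_int (int n - k) * x) + cnj c * cis (of_int (- int n - k) * x)" for x
    by (auto simp: complex_eq_iff algebra_simps cos_add sin_add cos_diff sin_diff)
  have i: "set_integrable lborel {0..2*pi} (\<lambda>x. d * cis (of_int j * x))" for d j
    by (intro borel_integrable_atLeastAtMost' continuous_intros)
  show ?thesis
    unfolding fourier_coeff_def eq set_integral_add(2)[OF i i] set_integral_mult_right integral_cis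
    using assms by auto
qed

lemma fourier_coeff_const: "fourier_coeff (\<lambda>x. r) k = (if k = 0 then of_real r else 0)"
  unfolding fourier_coeff_def
  using integral_cis[of "-k"] by (simp only: set_integral_mult_right) (auto simp: mult.commute)

context
  fixes c :: "nat \<Rightarrow> complex"
  assumes sum: "summable (\<lambda>n. norm (c (Suc n)))"
begin

lemma trig_term_le: "norm (2 * Re (c (Suc n) * cis (real (Suc n) * x))) \<le> 2 * norm (c (Suc n))"
proof -
  have "\<bar>Re (c (Suc n) * cis (real (Suc n) * x))\<bar> \<le> norm (c (Suc n) * cis (real (Suc n) * x))"
    by (rule abs_Re_le_cmod)
  then show ?thesis by (simp add: norm_mult)
qed

lemma trig_series_uniform_limit:
  "uniform_limit UNIV (\<lambda>N x. Re (c 0) + (\<Sum>n<N. 2 * Re (c (Suc n) * cis (real (Suc n) * x)))) (trig_series c) sequentially"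
  unfolding trig_series_def
  by (intro uniform_limit_intros Weierstrass_m_test[where M="\<lambda>n. 2 * norm (c (Suc n))"] trig_term_le summable_mult sum)

lemma circle_cont_partial_trig_series:
  "circle_cont (\<lambda>x. Re (c 0) + (\<Sum>n<N. 2 * Re (c (Suc n) * cis (real (Suc n) * x))))"
proof (induction N)
  case (Suc N)
  then show ?case
    using circle_cont_add[OF Suc circle_cont_trig_term[of "c (Suc N)" "Suc N"]]
    by (simp only: sum.lessThan_Suc add.assoc)
qed (auto intro: circle_cont_const)

lemma circle_cont_trig_series: "circle_cont (trig_series c)"
proof (rule circle_contI)
  show "continuous_on UNIV (trig_series c)"
    by (rule uniform_limit_theorem[OF _ trig_series_uniform_limit])
      (intro always_eventually allI circle_cont_on[OF circle_cont_partial_trig_series], simp)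
  fix x
  show "trig_series c (x + 2 * pi) = trig_series c x"
    unfolding trig_series_def using circle_cont_periodic[OF circle_cont_trig_term] by (simp only: )
qed

lemma abs_trig_series_le: "\<bar>trig_series c x\<bar> \<le> norm (c 0) + 2 * (\<Sum>n. norm (c (Suc n)))"
proof -
  have sm: "summable (\<lambda>n. norm (2 * Re (c (Suc n) * cis (real (Suc n) * x))))"
    by (rule summable_comparison_test'[OF summable_mult[OF sum, of 2]]) (use trig_term_le in auto)
  from sm have "norm (\<Sum>n. 2 * Re (c (Suc n) * cis (real (Suc n) * x))) \<le> (\<Sum>n. norm (2 * Re (c (Suc n) * cis (real (Suc n) * x))))"
    by (rule summable_norm)
  also have "\<dots> \<le> (\<Sum>n. 2 * norm (c (Suc n)))"
    by (rule suminf_le[OF trig_term_le sm summable_mult[OF sum]])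
  also have "\<dots> = 2 * (\<Sum>n. norm (c (Suc n)))" by (rule suminf_mult[OF sum])
  finally show ?thesis unfolding trig_series_def using abs_Re_le_cmod[of "c 0"] by simp
qed

text \<open>Partial sums have the right coefficient as soon as they reach the frequency |k|, and
  uniform convergence carries coefficients to the limit.\<close>

lemma fourier_coeff_trig_series:
  assumes "Im (c 0) = 0"
  shows "fourier_coeff (trig_series c) k = (if k \<ge> 0 then c (nat k) else cnj (c (nat (- k))))" (is "_ = ?v")
proof -
  let ?s = "\<lambda>N x. Re (c 0) + (\<Sum>n<N. 2 * Re (c (Suc n) * cis (real (Suc n) * x)))"
  have fs: "fourier_coeff (?s N) k = (if nat \<bar>k\<bar> \<le> N then ?v else 0)" for N
  proof (induction N)
    case 0
    show ?case using assms by (auto simp: fourier_coeff_const complex_eq_iff)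
  next
    case (Suc N)
    have "?s (Suc N) = (\<lambda>x. ?s N x + 2 * Re (c (Suc N) * cis (real (Suc N) * x)))"
      by (simp only: sum.lessThan_Suc add.assoc)
    then have "fourier_coeff (?s (Suc N)) k = fourier_coeff (?s N) k + fourier_coeff (\<lambda>x. 2 * Re (c (Suc N) * cis (real (Suc N) * x))) k"
      using fourier_coeff_add[OF circle_cont_integrable[OF circle_cont_partial_trig_series]
        circle_cont_integrable[OF circle_cont_trig_term]] by (simp only:)
    also have "\<dots> = (if nat \<bar>k\<bar> \<le> Suc N then ?v else 0)"
      unfolding Suc.IH fourier_coeff_trig_term[OF zero_less_Suc]
    proof -
      consider "k = int (Suc N)" | "k = - int (Suc N)" | "nat \<bar>k\<bar> \<le> N" | "nat \<bar>k\<bar> > Suc N" by linarith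
      then show "(if nat \<bar>k\<bar> \<le> N then ?v else 0) + (if k = int (Suc N) then c (Suc N) else if k = - int (Suc N) then cnj (c (Suc N)) else 0)
        = (if nat \<bar>k\<bar> \<le> Suc N then ?v else 0)"
        by cases (simp_all del: of_nat_Suc, auto)
    qed
    finally show ?case .
  qed
  have "norm (fourier_coeff (trig_series c) k - ?v) \<le> e" if "e > 0" for e
  proof -
    from uniform_limitD[OF trig_series_uniform_limit that]
    obtain N0 where N0: "\<And>N x. N \<ge> N0 \<Longrightarrow> dist (?s N x) (trig_series c x) < e"
      unfolding eventually_sequentially by blast
    define N where "N = max N0 (nat \<bar>k\<bar>)"
    have "fourier_coeff (trig_series c) k - ?v = fourier_coeff (\<lambda>x. trig_series c x - ?s N x) k"
      using fs[of N] fourier_coeff_diff[OF circle_cont_integrable[OF circle_cont_trig_series]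
        circle_cont_integrable[OF circle_cont_partial_trig_series], of N k]
      by (simp only: N_def max.cobounded2 if_True)
    also have "norm \<dots> \<le> e"
      using N0[of N] by (intro norm_fourier_coeff_le circle_cont_diff circle_cont_trig_series circle_cont_partial_trig_series)
        (auto simp: dist_real_def N_def abs_minus_commute intro: less_imp_le)
    finally show ?thesis .
  qed
  then have "norm (fourier_coeff (trig_series c) k - ?v) \<le> 0" by (rule dense_ge)
  then show ?thesis by simp
qed

end

section \<open>Multiplier operators as absolutely convergent series\<close>

lemma summable_inverse_Suc_square: "summable (\<lambda>n. 1 / (real (Suc n))\<^sup>2)"
  using inverse_power_summable[of 2, where 'a=real]
  by (intro summable_Suc_iff[THEN iffD2, of "\<lambda>n. 1 / (real n)\<^sup>2"]) (simp add: inverse_eq_divide)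

text \<open>An everywhere defined candidate for the multiplier image. Since negative frequencies are
  filled in by conjugation, it realises \<sigma> on all frequencies when \<sigma> is even.\<close>

definition fourier_mult :: "(real \<Rightarrow> real) \<Rightarrow> (real \<Rightarrow> real) \<Rightarrow> real \<Rightarrow> real" where
  "fourier_mult \<sigma> h = trig_series (\<lambda>n. of_real (\<sigma> (real n)) * fourier_coeff h (int n))"

lemma fourier_coeff_fourier_mult:
  assumes "summable (\<lambda>n. \<bar>\<sigma> (real (Suc n))\<bar> * norm (fourier_coeff h (int (Suc n))))" and even: "\<And>\<xi>. \<sigma> (- \<xi>) = \<sigma> \<xi>"
  shows "fourier_coeff (fourier_mult \<sigma> h) k = of_real (\<sigma> (of_int k)) * fourier_coeff h k"
proof -
  have "cnj (fourier_coeff h 0) = fourier_coeff h 0" using fourier_coeff_uminus_freq[of h 0] by simp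
  then have "Im (fourier_coeff h 0) = 0" by (simp add: complex_eq_iff)
  then have "fourier_coeff (fourier_mult \<sigma> h) k = (if k \<ge> 0 then of_real (\<sigma> (real (nat k))) * fourier_coeff h (int (nat k))
      else cnj (of_real (\<sigma> (real (nat (-k)))) * fourier_coeff h (int (nat (-k)))))"
    unfolding fourier_mult_def
    by (subst fourier_coeff_trig_series) (use assms in \<open>auto simp: norm_mult\<close>)
  then show ?thesis by (auto simp: fourier_coeff_uminus_freq even)
qed

lemma circle_cont_fourier_mult:
  assumes "summable (\<lambda>n. \<bar>\<sigma> (real (Suc n))\<bar> * norm (fourier_coeff h (int (Suc n))))"
  shows "circle_cont (fourier_mult \<sigma> h)"
  unfolding fourier_mult_def
  by (rule circle_cont_trig_series) (use assms in \<open>simp add: norm_mult\<close>)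

lemma abs_fourier_mult_le:
  assumes "summable (\<lambda>n. \<bar>\<sigma> (real (Suc n))\<bar> * norm (fourier_coeff h (int (Suc n))))"
  shows "\<bar>fourier_mult \<sigma> h x\<bar> \<le> \<bar>\<sigma> 0\<bar> * norm (fourier_coeff h 0) + 2 * (\<Sum>n. \<bar>\<sigma> (real (Suc n))\<bar> * norm (fourier_coeff h (int (Suc n))))"
  using abs_trig_series_le[of "\<lambda>n. of_real (\<sigma> (real n)) * fourier_coeff h (int n)" x] assms
  unfolding fourier_mult_def by (simp add: norm_mult)

text \<open>Coefficients of a continuous periodic function are bounded, so a symbol decaying like
  1/n^2 gives absolute convergence. This is the existence half of the description in
  \<open>helmholtz_inv\<close>.\<close>

lemma circle_cont_helmholtz:
  assumes "circle_cont A"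
  shows "circle_cont (fourier_mult (\<lambda>\<xi>. 1 / (1 + \<xi>\<^sup>2)) A)"
    and "is_fourier_multiplier (\<lambda>\<xi>. 1 / (1 + \<xi>\<^sup>2)) A (fourier_mult (\<lambda>\<xi>. 1 / (1 + \<xi>\<^sup>2)) A)"
proof -
  obtain B where B: "B \<ge> 0" "\<And>x. \<bar>A x\<bar> \<le> B" using circle_cont_bounded[OF assms] by blast
  have "summable (\<lambda>n. B * (1 / real ((Suc n)^2)))"
    using summable_inverse_Suc_square by (intro summable_mult) simp
  then have s: "summable (\<lambda>n. \<bar>1 / (1 + (real (Suc n))\<^sup>2)\<bar> * norm (fourier_coeff A (int (Suc n))))"
  proof (rule summable_comparison_test')
    fix n
    have "\<bar>1 / (1 + (real (Suc n))\<^sup>2)\<bar> * norm (fourier_coeff A (int (Suc n))) \<le> (1 / (real (Suc n))\<^sup>2) * B"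
    proof (intro mult_mono norm_fourier_coeff_le[OF assms B(2)])
      show "\<bar>1 / (1 + (real (Suc n))\<^sup>2)\<bar> \<le> 1 / (real (Suc n))\<^sup>2"
      proof -
        have "0 < (real (Suc n))\<^sup>2" by simp
        then show ?thesis by (simp del: of_nat_Suc add: frac_le)
      qed
    qed auto
    then show "norm (\<bar>1 / (1 + (real (Suc n))\<^sup>2)\<bar> * norm (fourier_coeff A (int (Suc n)))) \<le> B * (1 / real ((Suc n)^2))"
      by (simp add: mult.commute)
  qed
  show c: "circle_cont (fourier_mult (\<lambda>\<xi>. 1 / (1 + \<xi>\<^sup>2)) A)"
    by (rule circle_cont_fourier_mult[OF s])
  show "is_fourier_multiplier (\<lambda>\<xi>. 1 / (1 + \<xi>\<^sup>2)) A (fourier_mult (\<lambda>\<xi>. 1 / (1 + \<xi>\<^sup>2)) A)"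
    unfolding is_fourier_multiplier_def
    using circle_cont_L2[OF assms] circle_cont_L2[OF c] fourier_coeff_fourier_mult[OF s] by simp
qed

lemma helmholtz_inv_eqI:
  assumes "circle_cont g" "is_fourier_multiplier (\<lambda>\<xi>. 1 / (1 + \<xi>\<^sup>2)) A g"
  shows "helmholtz_inv A = g"
  unfolding helmholtz_inv_def
proof (rule the_equality)
  show "continuous_on UNIV g \<and> is_fourier_multiplier (\<lambda>\<xi>. 1 / (1 + \<xi>\<^sup>2)) A g"
    using assms by (simp add: circle_cont_on)
  fix h assume h: "continuous_on UNIV h \<and> is_fourier_multiplier (\<lambda>\<xi>. 1 / (1 + \<xi>\<^sup>2)) A h"
  then have "circle_cont h" by (simp add: circle_cont_def is_fourier_multiplier_def L2_circle_def)
  then show "h = g"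
    using assms h by (intro circle_cont_eqI) (auto simp: is_fourier_multiplier_def)
qed

text \<open>\<open>nonlocal_term\<close> consists of two separate inverses that have no closed form
  for a wave; only their sum does. It is identified on the Fourier side, where 1 + k^2 never
  vanishes.\<close>

lemma helmholtz_inv_add_eq:
  assumes A: "circle_cont A" and B: "circle_cont B"
    and w: "\<And>x. (w has_real_derivative w' x) (at x)" "\<And>x. (w' has_real_derivative w'' x) (at x)"
      "circle_cont w" "circle_cont w'" "circle_cont w''"
    and eq: "\<And>x. w x - w'' x = A x + B x"
  shows "helmholtz_inv A x + helmholtz_inv B x = w x"
proof -
  define g h where "g = helmholtz_inv A" and "h = helmholtz_inv B"
  have g: "circle_cont g" "is_fourier_multiplier (\<lambda>\<xi>. 1 / (1 + \<xi>\<^sup>2)) A g"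
    and h: "circle_cont h" "is_fourier_multiplier (\<lambda>\<xi>. 1 / (1 + \<xi>\<^sup>2)) B h"
    unfolding g_def h_def using helmholtz_inv_eqI[OF circle_cont_helmholtz] circle_cont_helmholtz A B by auto
  have "(\<lambda>x. g x + h x) = w"
  proof (rule circle_cont_eqI)
    show "circle_cont (\<lambda>x. g x + h x)" using g h by blast
    fix k
    have "fourier_coeff w'' k = - (of_int k)\<^sup>2 * fourier_coeff w k"
      using fourier_coeff_deriv[OF w(2) circle_cont_periodic[OF w(4)] w(5)]
        fourier_coeff_deriv[OF w(1) circle_cont_periodic[OF w(3)] w(4)]
      by (simp add: power2_eq_square algebra_simps)
    moreover have "fourier_coeff (\<lambda>x. w x - w'' x) k = fourier_coeff (\<lambda>x. A x + B x) k" using eq by simp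
    ultimately have 1: "(1 + (of_int k)\<^sup>2) * fourier_coeff w k = fourier_coeff A k + fourier_coeff B k"
      unfolding fourier_coeff_add[OF A[THEN circle_cont_integrable] B[THEN circle_cont_integrable]]
        fourier_coeff_diff[OF w(3)[THEN circle_cont_integrable] w(5)[THEN circle_cont_integrable]]
      by (simp add: algebra_simps)
    have nz: "1 + (of_int k)\<^sup>2 \<noteq> (0::complex)"
    proof -
      have "1 + (of_int k)\<^sup>2 \<noteq> (0::real)" using zero_le_power2[of "real_of_int k"] by linarith
      then have "complex_of_real (1 + (of_int k)\<^sup>2) \<noteq> 0" by (simp only: of_real_eq_0_iff not_False_eq_True)
      then show ?thesis by simp
    qed
    have "fourier_coeff (\<lambda>x. g x + h x) k = (fourier_coeff A k + fourier_coeff B k) / (1 + (of_int k)\<^sup>2)"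
      using g h by (simp add: fourier_coeff_add circle_cont_integrable is_fourier_multiplier_def add_divide_distrib)
    also have "\<dots> = fourier_coeff w k" using nz unfolding 1[symmetric] by simp
    finally show "fourier_coeff (\<lambda>x. g x + h x) k = fourier_coeff w k" .
  qed (rule w)
  then show ?thesis unfolding g_def h_def by meson
qed

section \<open>Sobolev norms of smooth functions\<close>

text \<open>\<open>F n\<close> is the \<open>n\<close>-th derivative of the smooth periodic function \<open>F 0\<close>.\<close>

definition smooth_chain :: "(nat \<Rightarrow> real \<Rightarrow> real) \<Rightarrow> bool" where
  "smooth_chain F \<longleftrightarrow> (\<forall>n x. (F n has_real_derivative F (Suc n) x) (at x) \<and> F n (x + 2 * pi) = F n x)"

lemma smooth_chain_deriv: "smooth_chain F \<Longrightarrow> (F n has_real_derivative F (Suc n) x) (at x)"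
  and smooth_chain_periodic: "smooth_chain F \<Longrightarrow> F n (x + 2 * pi) = F n x"
  unfolding smooth_chain_def by blast+

lemma smooth_chain_circle_cont: "smooth_chain F \<Longrightarrow> circle_cont (F n)"
  by (intro circle_contI smooth_chain_periodic continuous_at_imp_continuous_on ballI DERIV_isCont[OF smooth_chain_deriv])

lemma smooth_chain_bounded:
  assumes "smooth_chain F"
  obtains B where "B \<ge> 0" "\<And>x. \<bar>F n x\<bar> \<le> B"
  using circle_cont_bounded[OF smooth_chain_circle_cont[OF assms]] by blast

lemma smooth_chain_bounded2:
  assumes F: "smooth_chain F"
  obtains B where "B \<ge> 0" "\<And>x. \<bar>F m x\<bar> \<le> B" "\<And>x. \<bar>F n x\<bar> \<le> B"
proof -
  obtain B0 B1 where B: "B0 \<ge> 0" "\<And>x. \<bar>F m x\<bar> \<le> B0" "\<And>x. \<bar>F n x\<bar> \<le> B1"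
    using smooth_chain_bounded[OF F] by metis
  show ?thesis
    by (rule that[of "max B0 B1"]) (use B max.coboundedI1 max.coboundedI2 in \<open>auto simp: le_max_iff_disj\<close>)
qed

lemma smooth_chain_tail: "smooth_chain F \<Longrightarrow> smooth_chain (\<lambda>n. F (m + n))"
  unfolding smooth_chain_def by simp

lemma smooth_chain_shift:
  assumes "smooth_chain F" shows "smooth_chain (\<lambda>n x. F n (x - c))"
  unfolding smooth_chain_def
proof safe
  fix n x
  show "((\<lambda>x. F n (x - c)) has_real_derivative F (Suc n) (x - c)) (at x)"
    using DERIV_shift[of "F n" "F (Suc n) (x - c)" x "- c"] smooth_chain_deriv[OF assms, of n "x - c"] by simp
  show "F n (x + 2 * pi - c) = F n (x - c)"
    using smooth_chain_periodic[OF assms, of n "x - c"] by (simp add: algebra_simps)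
qed

lemma smooth_chain_diff: "smooth_chain F \<Longrightarrow> smooth_chain G \<Longrightarrow> smooth_chain (\<lambda>n x. F n x - G n x)"
  and smooth_chain_cmult: "smooth_chain F \<Longrightarrow> smooth_chain (\<lambda>n x. c * F n x)"
  unfolding smooth_chain_def by (auto intro!: derivative_eq_intros)

lemma fourier_coeff_smooth_chain:
  assumes "smooth_chain F"
  shows "fourier_coeff (F n) k = (\<i> * of_int k) ^ n * fourier_coeff (F 0) k"
proof (induction n)
  case (Suc n)
  then show ?case
    using fourier_coeff_deriv[OF smooth_chain_deriv[OF assms] smooth_chain_periodic[OF assms] smooth_chain_circle_cont[OF assms], of n k]
    by simp
qed simp

lemma L2_norm_le:
  assumes "circle_cont f" "\<And>x. \<bar>f x\<bar> \<le> B"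
  shows "L2_norm f \<le> sqrt (2 * pi) * B"
proof -
  have "B \<ge> 0" using assms(2)[of 0] by linarith
  have "(LINT x:{0..2*pi}|lborel. (f x)\<^sup>2) \<le> (LINT x:{0..2*pi}|lborel. B\<^sup>2)"
    by (intro set_integral_mono borel_integrable_atLeastAtMost' continuous_intros circle_cont_on assms(1))
      (use assms(2) power_mono[of "\<bar>f _\<bar>" B 2] in \<open>auto\<close>)
  also have "\<dots> = 2 * pi * B\<^sup>2" by (simp add: set_lebesgue_integral_def)
  finally have "L2_norm f \<le> sqrt (2 * pi * B\<^sup>2)" unfolding L2_norm_def by (rule real_sqrt_le_mono)
  then show ?thesis using \<open>B \<ge> 0\<close> by (simp add: real_sqrt_mult)
qed

lemma sobolev_norm_eqI:
  assumes "is_fourier_multiplier (sobolev_symbol s) f g"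
  shows "sobolev_norm s f = L2_norm g"
proof -
  define h where "h = (SOME g. is_fourier_multiplier (sobolev_symbol s) f g)"
  have "is_fourier_multiplier (sobolev_symbol s) f h"
    unfolding h_def by (rule someI[of "is_fourier_multiplier (sobolev_symbol s) f", OF assms])
  then have "L2_norm h = L2_norm g"
    using assms by (intro L2_norm_eqI) (simp_all add: is_fourier_multiplier_def)
  then show ?thesis unfolding sobolev_norm_def h_def .
qed

text \<open>For s \<ge> 0 the symbol is at least 1, so any one frequency bounds the norm from below.
  Every lower bound on a Sobolev norm comes from here.\<close>

lemma norm_fourier_coeff_le_sobolev:
  assumes "f \<in> sobolev s" "s \<ge> 0"
  shows "norm (fourier_coeff f k) \<le> sobolev_norm s f"
proof -
  obtain g where g: "is_fourier_multiplier (sobolev_symbol s) f g" using assms(1) by (auto simp: sobolev_def)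
  have "1 \<le> sobolev_symbol s (of_int k)"
    unfolding sobolev_symbol_def using assms(2) by (intro ge_one_powr_ge_zero) auto
  then have "norm (fourier_coeff f k) \<le> sobolev_symbol s (of_int k) * norm (fourier_coeff f k)"
    using mult_right_mono[of 1 "sobolev_symbol s (of_int k)" "norm (fourier_coeff f k)"] by simp
  also have "\<dots> = norm (fourier_coeff g k)"
    using g \<open>1 \<le> _\<close> by (simp add: is_fourier_multiplier_def norm_mult)
  also have "\<dots> \<le> L2_norm g"
    using g by (intro norm_fourier_coeff_le_L2) (simp add: is_fourier_multiplier_def)
  finally show ?thesis using sobolev_norm_eqI[OF g] by simp
qed

lemma sobolev_norm_nonneg:
  assumes "f \<in> sobolev s" "s \<ge> 0"
  shows "0 \<le> sobolev_norm s f"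
  using norm_fourier_coeff_le_sobolev[OF assms, of 0] norm_ge_zero order_trans by blast

lemma sobolev_symbol_even: "sobolev_symbol s (- \<xi>) = sobolev_symbol s \<xi>"
  by (simp add: sobolev_symbol_def)

text \<open>The 1 accounts for frequency 0, \<open>2 powr (s / 2)\<close> for replacing 1 + m^2 by 2
  m^2 at frequencies m \<ge> 1, and \<open>sqrt (2 * pi)\<close> for passing from the supremum to
  the L2 norm.\<close>

definition sobolev_const :: "real \<Rightarrow> real" where
  "sobolev_const s = sqrt (2 * pi) * (1 + 2 * (2 powr (s / 2) * (\<Sum>n. 1 / (real (Suc n))\<^sup>2)))"

text \<open>The two extra derivatives supply the factor 1/m^2 that makes the series
  summable.\<close>

definition sobolev_order :: "real \<Rightarrow> nat" where
  "sobolev_order s = nat \<lceil>s\<rceil> + 2"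

text \<open>The symbol grows at most like m to the power \<lceil>s\<rceil>, while coefficients of
  the function are those of its derivative of order M divided by m^M in modulus. Hence two suprema
  control the whole norm, at the price of a far from optimal order.\<close>

lemma sobolev_smooth_chain:
  assumes F: "smooth_chain F" and s: "s \<ge> 0"
    and E: "\<And>x. \<bar>F 0 x\<bar> \<le> E" "\<And>x. \<bar>F (sobolev_order s) x\<bar> \<le> E"
  shows "F 0 \<in> sobolev s" "sobolev_norm s (F 0) \<le> sobolev_const s * E"
proof -
  let ?M = "sobolev_order s" and ?c = "\<lambda>n. sobolev_symbol s (real n) * norm (fourier_coeff (F 0) (int n))"
  have E0: "E \<ge> 0" using E(1)[of 0] by linarith
  have le: "\<bar>sobolev_symbol s (real (Suc n))\<bar> * norm (fourier_coeff (F 0) (int (Suc n))) \<le> 2 powr (s / 2) * E * (1 / (real (Suc n))\<^sup>2)" for n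
  proof -
    define m where "m = real (Suc n)"
    have m: "m \<ge> 1" by (simp add: m_def)
    have "1 + m\<^sup>2 \<le> 2 * m\<^sup>2" using m by (simp add: one_le_power)
    then have "sobolev_symbol s m \<le> (2 * m\<^sup>2) powr (s / 2)"
      unfolding sobolev_symbol_def using s by (intro powr_mono2) auto
    also have "\<dots> = 2 powr (s / 2) * m powr s"
      using m by (simp add: powr_mult powr_powr flip: powr_numeral)
    also have "\<dots> \<le> 2 powr (s / 2) * m ^ (nat \<lceil>s\<rceil>)"
    proof -
      have "m powr s \<le> m powr (real (nat \<lceil>s\<rceil>))"
        using m s by (intro powr_mono) linarith+
      then show ?thesis using m by (simp add: powr_realpow)
    qed
    finally have 1: "sobolev_symbol s m \<le> 2 powr (s / 2) * m ^ (nat \<lceil>s\<rceil>)" .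
    have "m ^ ?M * norm (fourier_coeff (F 0) (int (Suc n))) = norm (fourier_coeff (F ?M) (int (Suc n)))"
      unfolding fourier_coeff_smooth_chain[OF F, of ?M] m_def by (simp add: norm_mult norm_power del: of_nat_Suc)
    also have "\<dots> \<le> E" by (rule norm_fourier_coeff_le[OF smooth_chain_circle_cont[OF F] E(2)])
    finally have 2: "m ^ ?M * norm (fourier_coeff (F 0) (int (Suc n))) \<le> E" .
    have "sobolev_symbol s m * norm (fourier_coeff (F 0) (int (Suc n)))
        \<le> 2 powr (s / 2) * m ^ (nat \<lceil>s\<rceil>) * norm (fourier_coeff (F 0) (int (Suc n)))"
      by (intro mult_right_mono 1) auto
    also have "\<dots> = 2 powr (s / 2) * (m ^ ?M * norm (fourier_coeff (F 0) (int (Suc n)))) * (1 / m\<^sup>2)"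
      using m by (simp add: sobolev_order_def power_add power2_eq_square)
    also have "\<dots> \<le> 2 powr (s / 2) * E * (1 / m\<^sup>2)"
      by (intro mult_right_mono mult_left_mono 2) auto
    finally show ?thesis unfolding m_def by (simp add: sobolev_symbol_def)
  qed
  have s2: "summable (\<lambda>n. 2 powr (s / 2) * E * (1 / (real (Suc n))\<^sup>2))"
    by (intro summable_mult summable_inverse_Suc_square)
  then have sm: "summable (\<lambda>n. \<bar>sobolev_symbol s (real (Suc n))\<bar> * norm (fourier_coeff (F 0) (int (Suc n))))"
    by (rule summable_comparison_test') (use le in auto)
  define g where "g = fourier_mult (sobolev_symbol s) (F 0)"
  have g: "circle_cont g" unfolding g_def by (rule circle_cont_fourier_mult[OF sm])
  have m: "is_fourier_multiplier (sobolev_symbol s) (F 0) g"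
    unfolding is_fourier_multiplier_def using circle_cont_L2[OF g] circle_cont_L2[OF smooth_chain_circle_cont[OF F]]
      fourier_coeff_fourier_mult[OF sm] sobolev_symbol_even by (simp add: g_def)
  then show "F 0 \<in> sobolev s" unfolding sobolev_def by (auto simp: is_fourier_multiplier_def)
  have "\<bar>g x\<bar> \<le> E + 2 * (2 powr (s / 2) * E * (\<Sum>n. 1 / (real (Suc n))\<^sup>2))" for x
  proof -
    have "\<bar>g x\<bar> \<le> \<bar>sobolev_symbol s 0\<bar> * norm (fourier_coeff (F 0) 0)
        + 2 * (\<Sum>n. \<bar>sobolev_symbol s (real (Suc n))\<bar> * norm (fourier_coeff (F 0) (int (Suc n))))"
      unfolding g_def by (rule abs_fourier_mult_le[OF sm])
    also have "\<dots> \<le> 1 * E + 2 * (\<Sum>n. 2 powr (s / 2) * E * (1 / (real (Suc n))\<^sup>2))"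
    proof (intro add_mono mult_left_mono suminf_le[OF le sm s2])
      show "\<bar>sobolev_symbol s 0\<bar> * norm (fourier_coeff (F 0) 0) \<le> 1 * E"
        using norm_fourier_coeff_le[OF smooth_chain_circle_cont[OF F] E(1)] by (simp add: sobolev_symbol_def)
    qed simp
    also have "\<dots> = E + 2 * (2 powr (s / 2) * E * (\<Sum>n. 1 / (real (Suc n))\<^sup>2))"
      by (subst suminf_mult[OF summable_inverse_Suc_square]) simp
    finally show ?thesis .
  qed
  from L2_norm_le[OF g this] have "L2_norm g \<le> sobolev_const s * E"
    by (simp add: sobolev_const_def algebra_simps)
  then show "sobolev_norm s (F 0) \<le> sobolev_const s * E" using sobolev_norm_eqI[OF m] by simp
qed

lemma smooth_chain_sobolev:
  assumes "smooth_chain F" "s \<ge> 0" shows "F 0 \<in> sobolev s"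
proof -
  obtain B where "\<And>x. \<bar>F 0 x\<bar> \<le> B" "\<And>x. \<bar>F (sobolev_order s) x\<bar> \<le> B"
    using smooth_chain_bounded2[OF assms(1)] by blast
  then show ?thesis by (rule sobolev_smooth_chain(1)[OF assms])
qed

lemma abs_diff_le_of_deriv_bound:
  fixes f :: "real \<Rightarrow> real"
  assumes "\<And>x. (f has_real_derivative f' x) (at x)" "\<And>x. \<bar>f' x\<bar> \<le> B"
  shows "\<bar>f x - f y\<bar> \<le> B * \<bar>x - y\<bar>"
  using field_differentiable_bound[of UNIV f f' B x y] assms by auto

text \<open>By the mean value inequality translation is Lipschitz in the supremum norm on every
  derivative, hence Lipschitz in time in the Sobolev norm.\<close>

lemma sobolev_path_travelling:
  assumes F: "smooth_chain F" and s: "s \<ge> 0"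
  shows "sobolev_path s T (\<lambda>t x. F 0 (x - l * t))"
  unfolding sobolev_path_def
proof (intro ballI conjI)
  fix t
  show "(\<lambda>x. F 0 (x - l * t)) \<in> sobolev s"
    using smooth_chain_sobolev[OF smooth_chain_shift[OF F, of "l*t"] s] by simp
  obtain B where B: "\<And>x. \<bar>F (Suc 0) x\<bar> \<le> B" "\<And>x. \<bar>F (Suc (sobolev_order s)) x\<bar> \<le> B"
    using smooth_chain_bounded2[OF F] by blast
  let ?N = "\<lambda>\<tau>. sobolev_norm s (\<lambda>x. F 0 (x - l * \<tau>) - F 0 (x - l * t))"
  have N: "0 \<le> ?N \<tau> \<and> ?N \<tau> \<le> sobolev_const s * (B * (\<bar>l\<bar> * \<bar>\<tau> - t\<bar>))" for \<tau>
  proof -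
    have c: "smooth_chain (\<lambda>n x. F n (x - l * \<tau>) - F n (x - l * t))"
      by (intro smooth_chain_diff smooth_chain_shift F)
    have d: "\<bar>F n (x - l * \<tau>) - F n (x - l * t)\<bar> \<le> B * (\<bar>l\<bar> * \<bar>\<tau> - t\<bar>)" if "\<And>x. \<bar>F (Suc n) x\<bar> \<le> B" for n x
    proof -
      have "\<bar>F n (x - l * \<tau>) - F n (x - l * t)\<bar> \<le> B * \<bar>(x - l * \<tau>) - (x - l * t)\<bar>"
        by (rule abs_diff_le_of_deriv_bound[OF smooth_chain_deriv[OF F] that])
      also have "\<bar>(x - l * \<tau>) - (x - l * t)\<bar> = \<bar>l\<bar> * \<bar>\<tau> - t\<bar>"
        by (simp add: abs_mult[symmetric] algebra_simps abs_minus_commute)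
      finally show ?thesis .
    qed
    from sobolev_smooth_chain(2)[OF c s d[OF B(1)] d[OF B(2)]]
    show ?thesis using sobolev_norm_nonneg[OF smooth_chain_sobolev[OF c s] s] by simp
  qed
  have lim: "((\<lambda>\<tau>. sobolev_const s * (B * (\<bar>l\<bar> * \<bar>\<tau> - t\<bar>))) \<longlongrightarrow> 0) (at t within {0..T})"
    by (rule tendsto_eq_intros refl | simp)+
  have ev: "\<forall>\<^sub>F \<tau> in at t within {0..T}. 0 \<le> ?N \<tau>" "\<forall>\<^sub>F \<tau> in at t within {0..T}. ?N \<tau> \<le> sobolev_const s * (B * (\<bar>l\<bar> * \<bar>\<tau> - t\<bar>))"
    using N by (auto intro: always_eventually)
  show "(?N \<longlongrightarrow> 0) (at t within {0..T})"
    by (rule tendsto_sandwich[OF ev tendsto_const lim])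
qed

text \<open>The mean value inequality for \<open>f z - f' x * z\<close> on the segment from x to y;
  the factor 1/2 of the sharp remainder is given up.\<close>

lemma abs_taylor_le:
  fixes f :: "real \<Rightarrow> real"
  assumes f: "\<And>x. (f has_real_derivative f' x) (at x)" "\<And>x. (f' has_real_derivative f'' x) (at x)" and B: "\<And>x. \<bar>f'' x\<bar> \<le> B"
  shows "\<bar>f y - f x - f' x * (y - x)\<bar> \<le> B * (y - x)\<^sup>2"
proof -
  have d: "((\<lambda>z. f z - f' x * z) has_real_derivative (f' z - f' x)) (at z within S)" for z S
    by (rule DERIV_diff[OF has_field_derivative_at_within[OF f(1)] DERIV_cmult_Id[of "f' x"]])
  have "\<bar>(f y - f' x * y) - (f x - f' x * x)\<bar> \<le> (B * \<bar>y - x\<bar>) * \<bar>y - x\<bar>"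
  proof -
    have "norm ((f y - f' x * y) - (f x - f' x * x)) \<le> (B * \<bar>y - x\<bar>) * norm (y - x)"
    proof (rule field_differentiable_bound[OF _ d])
      show "convex (closed_segment x y)" by simp
      show "norm (f' z - f' x) \<le> B * \<bar>y - x\<bar>" if "z \<in> closed_segment x y" for z
      proof -
        have "B \<ge> 0" using B[of 0] by linarith
        have "\<bar>f' z - f' x\<bar> \<le> B * \<bar>z - x\<bar>" by (rule abs_diff_le_of_deriv_bound[OF f(2) B])
        also have "\<dots> \<le> B * \<bar>y - x\<bar>" using that \<open>B \<ge> 0\<close> by (intro mult_left_mono) (auto simp: closed_segment_eq_real_ivl split: if_splits)
        finally show ?thesis by simp
      qed
    qed auto
    then show ?thesis by simp
  qed
  then show ?thesis by (simp add: power2_eq_square algebra_simps flip: abs_mult)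
qed

lemma sobolev_time_deriv_travelling:
  assumes F: "smooth_chain F" and s: "s \<ge> 0"
  shows "sobolev_time_deriv s T (\<lambda>t x. F 0 (x - l * t)) (\<lambda>t x. - l * F 1 (x - l * t))"
  unfolding sobolev_time_deriv_def
proof (intro ballI)
  fix t
  obtain B where B: "\<And>x. \<bar>F (Suc (Suc 0)) x\<bar> \<le> B" "\<And>x. \<bar>F (Suc (Suc (sobolev_order s))) x\<bar> \<le> B"
    using smooth_chain_bounded2[OF F] by blast
  let ?N = "\<lambda>\<tau>. sobolev_norm s (\<lambda>x. (F 0 (x - l * \<tau>) - F 0 (x - l * t)) / (\<tau> - t) - (- l * F 1 (x - l * t)))"
  have N: "0 \<le> ?N \<tau> \<and> ?N \<tau> \<le> sobolev_const s * (B * (l\<^sup>2 * \<bar>\<tau> - t\<bar>))" if "\<tau> \<noteq> t" for \<tau>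
  proof -
    let ?G = "\<lambda>n x. inverse (\<tau> - t) * (F n (x - l * \<tau>) - F n (x - l * t)) - (- l) * F (1 + n) (x - l * t)"
    have c: "smooth_chain ?G"
      by (intro smooth_chain_diff smooth_chain_cmult smooth_chain_shift F smooth_chain_tail)
    have d: "\<bar>?G n x\<bar> \<le> B * (l\<^sup>2 * \<bar>\<tau> - t\<bar>)" if b: "\<And>x. \<bar>F (Suc (Suc n)) x\<bar> \<le> B" for n x
    proof -
      have eq: "?G n x = (F n (x - l * \<tau>) - F n (x - l * t) - F (Suc n) (x - l * t) * ((x - l * \<tau>) - (x - l * t))) / (\<tau> - t)"
        using \<open>\<tau> \<noteq> t\<close> by (simp add: field_simps)
      have "\<bar>F n (x - l * \<tau>) - F n (x - l * t) - F (Suc n) (x - l * t) * ((x - l * \<tau>) - (x - l * t))\<bar> \<le> B * ((x - l * \<tau>) - (x - l * t))\<^sup>2"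
        by (rule abs_taylor_le[OF smooth_chain_deriv[OF F] smooth_chain_deriv[OF F] b])
      also have "\<dots> = (B * (l\<^sup>2 * \<bar>\<tau> - t\<bar>)) * \<bar>\<tau> - t\<bar>"
      proof -
        have "((x - l * \<tau>) - (x - l * t))\<^sup>2 = l\<^sup>2 * (\<bar>\<tau> - t\<bar> * \<bar>\<tau> - t\<bar>)" by (simp add: power2_eq_square algebra_simps)
        then show ?thesis by simp
      qed
      finally show ?thesis unfolding eq abs_divide using \<open>\<tau> \<noteq> t\<close> by (simp add: pos_divide_le_eq)
    qed
    have "?G 0 = (\<lambda>x. (F 0 (x - l * \<tau>) - F 0 (x - l * t)) / (\<tau> - t) - (- l * F 1 (x - l * t)))"
      by (auto simp: field_simps)
    with sobolev_smooth_chain(2)[OF c s d[OF B(1)] d[OF B(2)]] sobolev_norm_nonneg[OF smooth_chain_sobolev[OF c s] s]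
    show ?thesis by simp
  qed
  have lim: "((\<lambda>\<tau>. sobolev_const s * (B * (l\<^sup>2 * \<bar>\<tau> - t\<bar>))) \<longlongrightarrow> 0) (at t within {0..T})"
    by (rule tendsto_eq_intros refl | simp)+
  have ev: "\<forall>\<^sub>F \<tau> in at t within {0..T}. 0 \<le> ?N \<tau>" "\<forall>\<^sub>F \<tau> in at t within {0..T}. ?N \<tau> \<le> sobolev_const s * (B * (l\<^sup>2 * \<bar>\<tau> - t\<bar>))"
    using N by (auto simp: eventually_at_filter)
  show "(?N \<longlongrightarrow> 0) (at t within {0..T})"
    by (rule tendsto_sandwich[OF ev tendsto_const lim])
qed

section \<open>Travelling waves and their scaling\<close>

text \<open>With \<open>m = F 0 - F 2\<close> the momentum, this is the first equation of the system for waves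
  \<open>u = F 0 (x - l t)\<close>, \<open>v = G 0 (x - l t)\<close>.\<close>

definition momentum_eq :: "nat \<Rightarrow> real \<Rightarrow> real \<Rightarrow> (nat \<Rightarrow> real \<Rightarrow> real) \<Rightarrow> (nat \<Rightarrow> real \<Rightarrow> real) \<Rightarrow> bool" where
  "momentum_eq p a l F G \<longleftrightarrow>
     (\<forall>x. (G 0 x ^ p - l) * (F 1 x - F 3 x) + a * G 0 x ^ (p - 1) * G 1 x * (F 0 x - F 2 x) = 0)"

lemma circle_cont_power [intro]: "circle_cont f \<Longrightarrow> circle_cont (\<lambda>x. f x ^ n)"
  by (induction n) (auto intro: circle_cont_const circle_cont_mult)

lemma smooth_chain_deriv_eq: "smooth_chain F \<Longrightarrow> deriv (F n) = F (Suc n)"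
  by (intro ext DERIV_imp_deriv smooth_chain_deriv)

text \<open>For a wave of speed l the equation forces the nonlocal term to be (l - v^p) u_x.
  Applying 1 - d^2/dx^2 to that expression returns the two brackets exactly because the momentum
  equation holds, so no inverse is ever computed.\<close>

lemma nonlocal_term_travelling:
  assumes F: "smooth_chain F" and G: "smooth_chain G" and p: "p \<ge> 1" and m: "momentum_eq p a l F G"
  shows "nonlocal_term p a (F 0) (G 0) x = (l - G 0 x ^ p) * F 1 x"
proof -
  define P1 where "P1 y = real p * G 0 y ^ (p - 1) * G 1 y" for y
  \<comment> \<open>\<open>P1\<close> and \<open>P2\<close> are the first and second derivatives of
    v^p. For p = 1 the truncated exponent \<open>p - 1 - 1\<close> is harmless, being multiplied by
    \<open>real (p - 1) = 0\<close>.\<close>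
  define P2 where "P2 y = real p * (real (p - 1) * G 0 y ^ (p - 1 - 1) * G 1 y) * G 1 y + real p * G 0 y ^ (p - 1) * G 2 y" for y
  note DF = smooth_chain_deriv[OF F] and DG = smooth_chain_deriv[OF G]
  have D: "(G 0 has_real_derivative G 1 y) (at y)" "(G 1 has_real_derivative G 2 y) (at y)"
    "(F 0 has_real_derivative F 1 y) (at y)" "(F 1 has_real_derivative F 2 y) (at y)" "(F 2 has_real_derivative F 3 y) (at y)" for y
  proof -
    have 3: "Suc 2 = 3" by simp
    show "(G 0 has_real_derivative G 1 y) (at y)" "(G 1 has_real_derivative G 2 y) (at y)"
      "(F 0 has_real_derivative F 1 y) (at y)" "(F 1 has_real_derivative F 2 y) (at y)" "(F 2 has_real_derivative F 3 y) (at y)"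
      using DG[of 0 y] DG[of 1 y] DF[of 0 y] DF[of 1 y] DF[of 2 y] unfolding One_nat_def[symmetric] Suc_1 3 .
  qed
  have DP0: "((\<lambda>y. G 0 y ^ p) has_real_derivative P1 y) (at y)" for y
    unfolding P1_def by (auto intro!: derivative_eq_intros D D[unfolded One_nat_def])
  have DP1: "(P1 has_real_derivative P2 y) (at y)" for y
    unfolding P1_def P2_def by (auto intro!: derivative_eq_intros D D[unfolded One_nat_def] simp: algebra_simps)
  have cF: "circle_cont (F n)" and cG: "circle_cont (G n)" for n
    using F G by (auto intro: smooth_chain_circle_cont)
  have c0: "circle_cont (\<lambda>y. G 0 y ^ p)" by (intro circle_cont_power cG)
  have c1: "circle_cont P1" unfolding P1_def by (intro circle_cont_mult circle_cont_const circle_cont_power cG)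
  have c2: "circle_cont P2" unfolding P2_def by (intro circle_cont_add circle_cont_mult circle_cont_const circle_cont_power cG)
  let ?A = "\<lambda>y. a / real p * P1 y * F 0 y + (real p - a) / real p * P1 y * F 2 y"
  let ?B = "\<lambda>y. P2 y * F 1 y + P1 y * F 2 y"
  have d0: "deriv (\<lambda>z. G 0 z ^ p) = P1" by (intro ext DERIV_imp_deriv DP0)
  have d1: "deriv (F 0) = F 1" "deriv (F 1) = F 2" using smooth_chain_deriv_eq[OF F] by (simp_all add: numeral_2_eq_2)
  have d2: "deriv (\<lambda>y. P1 y * F 1 y) = ?B"
    by (intro ext DERIV_imp_deriv) (auto intro!: derivative_eq_intros DP1 D D[unfolded One_nat_def] simp: algebra_simps)
  have "nonlocal_term p a (F 0) (G 0) x = helmholtz_inv ?A x + helmholtz_inv ?B x"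
    unfolding nonlocal_term_def d0 d1 d2 ..
  also have "\<dots> = (l - G 0 x ^ p) * F 1 x"
  proof (rule helmholtz_inv_add_eq)
    show "circle_cont ?A" "circle_cont ?B"
      by (intro circle_cont_add circle_cont_mult circle_cont_const cF c1 c2)+
    have DQ: "((\<lambda>y. l - G 0 y ^ p) has_real_derivative - P1 y) (at y)" for y
      using DERIV_diff[OF DERIV_const DP0] by simp
    show "((\<lambda>x. (l - G 0 x ^ p) * F 1 x) has_real_derivative (l - G 0 y ^ p) * F 2 y - P1 y * F 1 y) (at y)" for y
      by (rule DERIV_cong[OF DERIV_mult[OF DQ D(4)]]) (simp add: algebra_simps)
    show "((\<lambda>y. (l - G 0 y ^ p) * F 2 y - P1 y * F 1 y) has_real_derivative
      (l - G 0 y ^ p) * F 3 y - 2 * (P1 y * F 2 y) - P2 y * F 1 y) (at y)" for y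
      by (rule DERIV_cong[OF DERIV_diff[OF DERIV_mult[OF DQ D(5)] DERIV_mult[OF DP1 D(4)]]]) (simp add: algebra_simps)
    show "circle_cont (\<lambda>x. (l - G 0 x ^ p) * F 1 x)"
      "circle_cont (\<lambda>y. (l - G 0 y ^ p) * F 2 y - P1 y * F 1 y)"
      "circle_cont (\<lambda>y. (l - G 0 y ^ p) * F 3 y - 2 * (P1 y * F 2 y) - P2 y * F 1 y)"
      by (intro circle_cont_add circle_cont_diff circle_cont_mult circle_cont_const cF c0 c1 c2)+
    fix y
    define c where "c = a / real p"
    have pc: "(real p - a) / real p = 1 - c" using p by (simp add: c_def field_simps)
    have "(G 0 y ^ p - l) * (F 1 y - F 3 y) + c * P1 y * (F 0 y - F 2 y) = 0"
      using m p unfolding momentum_eq_def P1_def c_def by (simp add: mult.assoc)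
    \<comment> \<open>A polynomial identity: the defect in w - w'' = A + B is minus the left-hand
      side of the momentum equation.\<close>
    moreover have "(l - G 0 y ^ p) * F 1 y - ((l - G 0 y ^ p) * F 3 y - 2 * (P1 y * F 2 y) - P2 y * F 1 y)
        - (c * P1 y * F 0 y + (1 - c) * P1 y * F 2 y + ?B y)
        = - ((G 0 y ^ p - l) * (F 1 y - F 3 y) + c * P1 y * (F 0 y - F 2 y))"
      by (simp add: algebra_simps)
    ultimately show "(l - G 0 y ^ p) * F 1 y - ((l - G 0 y ^ p) * F 3 y - 2 * (P1 y * F 2 y) - P2 y * F 1 y) = ?A y + ?B y"
      unfolding pc c_def[symmetric] by linarith
  qed
  finally show ?thesis .
qed

text \<open>The time derivative -l u_x, the transport term v^p u_x and the nonlocal term (l - v^p)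
  u_x add up to zero. The bound s \<ge> 1 keeps the order s - 1 of the time derivative
  nonnegative.\<close>

lemma travelling_solution:
  assumes F: "smooth_chain F" and G: "smooth_chain G" and pq: "p \<ge> 1" "q \<ge> 1" and s: "s \<ge> 1"
    and m: "momentum_eq p a l F G" "momentum_eq q b l G F"
  shows "is_solution p q a b s T (\<lambda>t x. F 0 (x - l * t)) (\<lambda>t x. G 0 (x - l * t))"
proof -
  have shift: "smooth_chain (\<lambda>n x. F n (x - l * t))" "smooth_chain (\<lambda>n x. G n (x - l * t))" for t
    by (intro smooth_chain_shift F G)+
  have nt: "nonlocal_term p a (\<lambda>x. F 0 (x - l * t)) (\<lambda>x. G 0 (x - l * t)) x = (l - G 0 (x - l * t) ^ p) * F 1 (x - l * t)"
    "nonlocal_term q b (\<lambda>x. G 0 (x - l * t)) (\<lambda>x. F 0 (x - l * t)) x = (l - F 0 (x - l * t) ^ q) * G 1 (x - l * t)" for t x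
  proof -
    have "momentum_eq p a l (\<lambda>n x. F n (x - l * t)) (\<lambda>n x. G n (x - l * t))"
      "momentum_eq q b l (\<lambda>n x. G n (x - l * t)) (\<lambda>n x. F n (x - l * t))"
      using m by (simp_all add: momentum_eq_def)
    from nonlocal_term_travelling[OF shift(1)[of t] shift(2)[of t] pq(1) this(1), of x]
      nonlocal_term_travelling[OF shift(2)[of t] shift(1)[of t] pq(2) this(2), of x]
    show "nonlocal_term p a (\<lambda>x. F 0 (x - l * t)) (\<lambda>x. G 0 (x - l * t)) x = (l - G 0 (x - l * t) ^ p) * F 1 (x - l * t)"
      "nonlocal_term q b (\<lambda>x. G 0 (x - l * t)) (\<lambda>x. F 0 (x - l * t)) x = (l - F 0 (x - l * t) ^ q) * G 1 (x - l * t)"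
      by auto
  qed
  have d: "deriv (\<lambda>x. F 0 (x - l * t)) x = F 1 (x - l * t)" "deriv (\<lambda>x. G 0 (x - l * t)) x = G 1 (x - l * t)" for t x
    using smooth_chain_deriv_eq[OF shift(1)[of t], of 0] smooth_chain_deriv_eq[OF shift(2)[of t], of 0] by (auto dest: fun_cong)
  have c: "continuous_on UNIV (\<lambda>x. F 0 (x - l * t))" "continuous_on UNIV (\<lambda>x. G 0 (x - l * t))" for t
    using circle_cont_on[OF smooth_chain_circle_cont[OF shift(1)[of t], of 0]]
      circle_cont_on[OF smooth_chain_circle_cont[OF shift(2)[of t], of 0]] by auto
  have p1: "sobolev_path (s - 1) T (\<lambda>t x. - l * F 1 (x - l * t))" if "smooth_chain F" for F
    using sobolev_path_travelling[OF smooth_chain_cmult[OF smooth_chain_tail[OF that, of 1], of "- l"], of "s - 1" T l] s by simp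
  show ?thesis
    unfolding is_solution_def
  proof (intro conjI, goal_cases)
    case 4
    show ?case
    proof (rule exI[of _ "\<lambda>t x. - l * F 1 (x - l * t)"], rule exI[of _ "\<lambda>t x. - l * G 1 (x - l * t)"], intro conjI)
      show "sobolev_time_deriv (s - 1) T (\<lambda>t x. F 0 (x - l * t)) (\<lambda>t x. - l * F 1 (x - l * t))"
        "sobolev_time_deriv (s - 1) T (\<lambda>t x. G 0 (x - l * t)) (\<lambda>t x. - l * G 1 (x - l * t))"
        using sobolev_time_deriv_travelling F G s by auto
      show "sobolev_path (s - 1) T (\<lambda>t x. - l * F 1 (x - l * t))" by (rule p1[OF F])
      show "sobolev_path (s - 1) T (\<lambda>t x. - l * G 1 (x - l * t))" by (rule p1[OF G])
    qed (auto simp: nt d left_diff_distrib simp del: One_nat_def)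
  next
    case 3
    show ?case using c by simp
  qed (use sobolev_path_travelling F G s in auto)
qed

text \<open>The equation is linear in F, so r is free, while scaling G by \<open>root p l\<close>
  multiplies every term by l. Taking r = \<open>root q l\<close> makes the two equations of the
  system scale together.\<close>

lemma momentum_eq_scale:
  assumes "momentum_eq p a 1 F G" "p \<ge> 1" "l \<ge> 0"
  shows "momentum_eq p a l (\<lambda>n x. r * F n x) (\<lambda>n x. root p l * G n x)"
  unfolding momentum_eq_def
proof
  fix x
  let ?c = "root p l"
  have c: "?c ^ p = l" using assms by (intro real_root_pow_pos2) auto
  have 1: "?c ^ (p - 1) * ?c = l" using c assms(2) by (metis Suc_diff_1 less_le_trans mult.commute power_Suc zero_less_one)
  have "((?c * G 0 x) ^ p - l) * (r * F 1 x - r * F 3 x) + a * (?c * G 0 x) ^ (p - 1) * (?c * G 1 x) * (r * F 0 x - r * F 2 x)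
    = l * r * ((G 0 x ^ p - 1) * (F 1 x - F 3 x) + a * G 0 x ^ (p - 1) * G 1 x * (F 0 x - F 2 x))"
    unfolding power_mult_distrib c
  proof -
    have "a * (?c ^ (p - 1) * G 0 x ^ (p - 1)) * (?c * G 1 x) * (r * F 0 x - r * F 2 x)
        = (?c ^ (p - 1) * ?c) * (r * (a * G 0 x ^ (p - 1) * G 1 x * (F 0 x - F 2 x)))"
      by (simp only: ac_simps left_diff_distrib right_diff_distrib)
    then show "(l * G 0 x ^ p - l) * (r * F 1 x - r * F 3 x) + a * (?c ^ (p - 1) * G 0 x ^ (p - 1)) * (?c * G 1 x) * (r * F 0 x - r * F 2 x)
      = l * r * ((G 0 x ^ p - 1) * (F 1 x - F 3 x) + a * G 0 x ^ (p - 1) * G 1 x * (F 0 x - F 2 x))"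
      unfolding 1 by (simp add: algebra_simps)
  qed
  then show "((?c * G 0 x) ^ p - l) * (r * F 1 x - r * F 3 x) + a * (?c * G 0 x) ^ (p - 1) * (?c * G 1 x) * (r * F 0 x - r * F 2 x) = 0"
    using assms(1) by (simp add: momentum_eq_def)
qed

text \<open>On [1, \<infinity>) the map z^j - z = z (z^(j-1) - 1) is increasing, so powers expand
  distances there and roots do not.\<close>

lemma root_add_le:
  assumes "j \<ge> 1" "l \<ge> 1" "d \<ge> 0"
  shows "\<bar>root j l - root j (l + d)\<bar> \<le> d"
proof -
  let ?x = "root j l" and ?y = "root j (l + d)"
  have x: "?x \<ge> 1" and y: "?x \<le> ?y" using assms by auto
  have "?x ^ j = l" "?y ^ j = l + d" using assms by (auto intro!: real_root_pow_pos2)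
  moreover have "?y ^ j - ?x ^ j \<ge> ?y - ?x"
  proof -
    have "?x ^ (j - 1) \<le> ?y ^ (j - 1)" using x y by (intro power_mono) auto
    moreover have "1 \<le> ?x ^ (j - 1)" using x by (rule one_le_power)
    ultimately have "?x * (?x ^ (j - 1) - 1) \<le> ?y * (?y ^ (j - 1) - 1)" using x y by (intro mult_mono) auto
    moreover have "?x * ?x ^ (j - 1) = ?x ^ j" "?y * ?y ^ (j - 1) = ?y ^ j"
      using assms(1) by (simp_all add: power_eq_if)
    ultimately show ?thesis by (simp add: algebra_simps)
  qed
  ultimately show ?thesis using y by linarith
qed

text \<open>After rotation the imaginary part of the difference is a sine, and sin x \<ge> x/2 on
  [0,1] because cos \<ge> 1/2 there, 1 being less than pi/3.\<close>

lemma norm_cis_diff_ge: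
  assumes "\<bar>\<theta> - \<phi>\<bar> \<le> 1"
  shows "norm (cis \<theta> - cis \<phi>) \<ge> \<bar>\<theta> - \<phi>\<bar> / 2"
proof -
  define t where "t = \<theta> - \<phi>"
  have sin: "sin x \<ge> x / 2" if "0 \<le> x" "x \<le> 1" for x :: real
  proof (cases "x = 0")
    case False
    then have "x > 0" using that by simp
    then obtain z where z: "0 < z" "z < x" "sin x - sin 0 = (x - 0) * cos z"
      using MVT2[of 0 x sin cos] by auto
    have "cos z \<ge> cos (pi / 3)"
      using z that pi_gt3 by (intro cos_monotone_0_pi_le) auto
    then have "x * cos z \<ge> x * (1 / 2)" using that by (intro mult_left_mono) (auto simp: cos_60)
    then show ?thesis using z by simp
  qed simp
  have "\<bar>sin t\<bar> \<ge> \<bar>t\<bar> / 2"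
    using sin[of t] sin[of "- t"] assms unfolding t_def[symmetric] by (cases "t \<ge> 0") auto
  also have "\<bar>sin t\<bar> = \<bar>Im (cis t - 1)\<bar>" by simp
  also have "\<dots> \<le> norm (cis t - 1)" by (rule abs_Im_le_cmod)
  also have "\<dots> = norm (cis \<phi> * (cis t - 1))" by (simp add: norm_mult)
  also have "cis \<phi> * (cis t - 1) = cis \<theta> - cis \<phi>" by (simp add: algebra_simps cis_mult t_def)
  finally show ?thesis unfolding t_def .
qed


section \<open>Failure of uniform continuity from one nonconstant wave\<close>

lemma is_solution_swap: "is_solution p q a b s T u v \<longleftrightarrow> is_solution q p b a s T v u"
  unfolding is_solution_def by blast

text \<open>The conclusion of the theorem as a predicate, so that it can be transferred to the
  system with the two components exchanged.\<close>

definition nonuniform :: "nat \<Rightarrow> nat \<Rightarrow> real \<Rightarrow> real \<Rightarrow> real \<Rightarrow> bool" where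
  "nonuniform p q a b s \<longleftrightarrow> (\<exists>T>0. \<exists>\<epsilon>>0. \<exists>u v w y :: nat \<Rightarrow> real \<Rightarrow> real \<Rightarrow> real.
    (\<forall>n. is_solution p q a b s T (u n) (v n)) \<and>
    (\<forall>n. is_solution p q a b s T (w n) (y n)) \<and>
    (\<lambda>n. sobolev_norm s (\<lambda>x. u n 0 x - w n 0 x) +
          sobolev_norm s (\<lambda>x. v n 0 x - y n 0 x)) \<longlonglongrightarrow> 0 \<and>
    (\<forall>n. (SUP t\<in>{0..T}. sobolev_norm s (\<lambda>x. u n t x - w n t x) +
                         sobolev_norm s (\<lambda>x. v n t x - y n t x)) \<ge> \<epsilon>))"

text \<open>Everything is read off at one frequency k of F. The phase drift, multiplied by the
  growing amplitude, contributes at least 1/2, and the difference of the amplitudes takes away at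
  most 1/4.\<close>

lemma nonuniform_if_travelling:
  assumes F: "smooth_chain F" and G: "smooth_chain G" and pq: "p \<ge> 1" "q \<ge> 1" and s: "s \<ge> 1"
    and m: "momentum_eq p a 1 F G" "momentum_eq q b 1 G F"
    and k: "k \<noteq> 0" "fourier_coeff (F 0) k \<noteq> 0"
  shows "nonuniform p q a b s"
proof -
  have s0: "s \<ge> 0" using s by simp
  \<comment> \<open>At this time the phases at frequency k differ by exactly the difference
    \<open>d n\<close> of the speeds.\<close>
  define T where "T = 1 / \<bar>real_of_int k\<bar>"
  have T: "T > 0" using k by (simp add: T_def)
  \<comment> \<open>The offset 4 gives \<open>d n \<le> 1/4\<close>. The amplitude
    \<open>root q (l n)\<close> is then exactly \<open>1 / d n\<close>, which cancels the smallness
    of the phase drift.\<close>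
  define d where "d n = 1 / real (n + 4)" for n
  define l where "l n = real (n + 4) ^ q" for n
  define l' where "l' n = l n + d n" for n
  have d: "d n > 0" "d n \<le> 1 / 4" for n by (auto simp: d_def field_simps)
  have l: "l n \<ge> 1" "l' n \<ge> 1" for n
  proof -
    show "l n \<ge> 1" unfolding l_def by (rule one_le_power) simp
    then show "l' n \<ge> 1" using d(1)[of n] by (simp add: l'_def)
  qed
  have root_l: "root q (l n) = real (n + 4)" for n
    using pq by (simp add: l_def real_root_power_cancel)
  \<comment> \<open>One formula for both components: index q with F, and index p with G.\<close>
  define u where "u j H L t x = root j L * H 0 (x - L * t)" for j :: nat and H :: "nat \<Rightarrow> real \<Rightarrow> real" and L t x :: real
  have sol: "is_solution p q a b s T (u q F L) (u p G L)" if "L \<ge> 0" for L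
    unfolding u_def
    by (rule travelling_solution[where F="\<lambda>n x. root q L * F n x" and G="\<lambda>n x. root p L * G n x"])
      (intro smooth_chain_cmult F G pq s momentum_eq_scale m that)+
  have diff_chain: "smooth_chain (\<lambda>j x. root i L * H j (x - L * t) - root i L' * H j (x - L' * t))"
    if "smooth_chain H" for H i L L' t
    by (intro smooth_chain_diff smooth_chain_cmult smooth_chain_shift that)
  have nonneg: "0 \<le> sobolev_norm s (\<lambda>x. u i H L t x - u i H L' t x)" if "smooth_chain H" for H i L L' t
    unfolding u_def by (rule sobolev_norm_nonneg[OF smooth_chain_sobolev[OF diff_chain[OF that] s0] s0])
  have init: "\<exists>C\<ge>0. \<forall>n. sobolev_norm s (\<lambda>x. u i H (l n) 0 x - u i H (l' n) 0 x) \<le> C * d n"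
    if H: "smooth_chain H" and i: "i \<ge> 1" for H i
  proof -
    obtain B where B: "\<And>x. \<bar>H 0 x\<bar> \<le> B" "\<And>x. \<bar>H (sobolev_order s) x\<bar> \<le> B" "B \<ge> 0"
      using smooth_chain_bounded2[OF H] by blast
    have "sobolev_norm s (\<lambda>x. u i H (l n) 0 x - u i H (l' n) 0 x) \<le> sobolev_const s * (B * d n)" for n
    proof -
      have r: "\<bar>root i (l n) - root i (l' n)\<bar> \<le> d n"
        unfolding l'_def using i l d(1)[of n] by (intro root_add_le) auto
      have e: "\<bar>root i (l n) * H j (x - l n * 0) - root i (l' n) * H j (x - l' n * 0)\<bar> \<le> B * d n"
        if "\<And>x. \<bar>H j x\<bar> \<le> B" for j x
      proof -
        have "\<bar>root i (l n) * H j (x - l n * 0) - root i (l' n) * H j (x - l' n * 0)\<bar> = \<bar>H j x\<bar> * \<bar>root i (l n) - root i (l' n)\<bar>"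
          by (simp add: abs_mult[symmetric] algebra_simps)
        also have "\<dots> \<le> B * d n" using that[of x] r by (intro mult_mono) auto
        finally show ?thesis .
      qed
      show ?thesis unfolding u_def
        by (rule sobolev_smooth_chain(2)[OF diff_chain[OF H, of i "l n" 0 "l' n"] s0 e[OF B(1)] e[OF B(2)]])
    qed
    moreover have "sobolev_const s * B \<ge> 0"
      using B(3) by (auto simp: sobolev_const_def intro!: mult_nonneg_nonneg add_nonneg_nonneg suminf_nonneg summable_inverse_Suc_square simp del: of_nat_Suc)
    ultimately show ?thesis by (intro exI[of _ "sobolev_const s * B"]) (simp add: mult.assoc)
  qed
  \<comment> \<open>A value is at most the supremum only over a set bounded above, so a bound
    uniform in t is required.\<close>
  have bounded: "\<exists>C. \<forall>t. sobolev_norm s (\<lambda>x. u i H L t x - u i H L' t x) \<le> C"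
    if H: "smooth_chain H" for H i L L'
  proof -
    obtain B where B: "\<And>x. \<bar>H 0 x\<bar> \<le> B" "\<And>x. \<bar>H (sobolev_order s) x\<bar> \<le> B" "B \<ge> 0"
      using smooth_chain_bounded2[OF H] by blast
    have e: "\<bar>root i L * H j (x - L * t) - root i L' * H j (x - L' * t)\<bar> \<le> \<bar>root i L\<bar> * B + \<bar>root i L'\<bar> * B"
      if "\<And>x. \<bar>H j x\<bar> \<le> B" for j x t
      by (rule order_trans[OF abs_triangle_ineq4]) (auto simp: abs_mult intro!: add_mono mult_left_mono that)
    show ?thesis unfolding u_def
      by (intro exI allI, rule sobolev_smooth_chain(2)[OF diff_chain[OF H] s0 e[OF B(1)] e[OF B(2)]])
  qed
  define \<epsilon> where "\<epsilon> = norm (fourier_coeff (F 0) k) / 4"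
  have low: "\<epsilon> \<le> sobolev_norm s (\<lambda>x. u q F (l n) T x - u q F (l' n) T x)" for n
  proof -
    let ?D = "\<lambda>x. u q F (l n) T x - u q F (l' n) T x"
    define \<theta> \<phi> where "\<theta> = - (of_int k * (l n * T))" and "\<phi> = - (of_int k * (l' n * T))"
    have cF: "circle_cont (\<lambda>x. F 0 (x - c))" for c
      by (intro circle_cont_shift smooth_chain_circle_cont F)
    have "fourier_coeff ?D k = of_real (root q (l n)) * fourier_coeff (\<lambda>x. F 0 (x - l n * T)) k - of_real (root q (l' n)) * fourier_coeff (\<lambda>x. F 0 (x - l' n * T)) k"
      unfolding u_def
      by (subst fourier_coeff_diff) (auto simp: fourier_coeff_cmult intro!: circle_cont_integrable circle_cont_mult circle_cont_const cF)
    \<comment> \<open>Splits the difference into a phase part with fixed amplitude and an amplitude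
      part with fixed phase.\<close>
    also have "\<dots> = (of_real (root q (l n)) * (cis \<theta> - cis \<phi>) + of_real (root q (l n) - root q (l' n)) * cis \<phi>) * fourier_coeff (F 0) k"
      unfolding fourier_coeff_shift[OF smooth_chain_circle_cont[OF F]] \<theta>_def \<phi>_def by (simp add: algebra_simps)
    finally have eq: "norm (fourier_coeff ?D k) = norm (of_real (root q (l n)) * (cis \<theta> - cis \<phi>) + of_real (root q (l n) - root q (l' n)) * cis \<phi>) * norm (fourier_coeff (F 0) k)"
      by (simp only: norm_mult)
    have "\<theta> - \<phi> = of_int k * (d n * T)" by (simp add: \<theta>_def \<phi>_def l'_def algebra_simps)
    then have td: "\<bar>\<theta> - \<phi>\<bar> = d n" using k d(1)[of n] T by (simp add: abs_mult T_def)
    have "1 / 2 = real (n + 4) * (d n / 2)" by (simp add: d_def)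
    also have "\<dots> \<le> real (n + 4) * norm (cis \<theta> - cis \<phi>)"
      using norm_cis_diff_ge[of \<theta> \<phi>] td d(2)[of n] by (intro mult_left_mono) auto
    also have "\<dots> = norm (of_real (root q (l n)) * (cis \<theta> - cis \<phi>))" unfolding root_l by (simp add: norm_mult del: of_nat_add)
    finally have 1: "1 / 2 \<le> norm (of_real (root q (l n)) * (cis \<theta> - cis \<phi>))" .
    have "norm (of_real (root q (l n) - root q (l' n)) * cis \<phi>) = \<bar>root q (l n) - root q (l' n)\<bar>"
      by (simp add: norm_mult del: of_real_diff)
    also have "\<dots> \<le> d n" unfolding l'_def using pq l d(1)[of n] by (intro root_add_le) auto
    finally have 2: "norm (of_real (root q (l n) - root q (l' n)) * cis \<phi>) \<le> 1 / 4" using d(2)[of n] by linarith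
    have "1 / 4 \<le> norm (of_real (root q (l n)) * (cis \<theta> - cis \<phi>) + of_real (root q (l n) - root q (l' n)) * cis \<phi>)"
      using 1 2 norm_triangle_ineq2[of "of_real (root q (l n)) * (cis \<theta> - cis \<phi>)" "- (of_real (root q (l n) - root q (l' n)) * cis \<phi>)"]
      by (simp only: norm_minus_cancel diff_minus_eq_add)
    then have "1 / 4 * norm (fourier_coeff (F 0) k) \<le> norm (fourier_coeff ?D k)"
      unfolding eq by (rule mult_right_mono) simp
    also have "\<dots> \<le> sobolev_norm s ?D"
      unfolding u_def by (rule norm_fourier_coeff_le_sobolev[OF smooth_chain_sobolev[OF diff_chain[OF F] s0] s0])
    finally show ?thesis by (simp add: \<epsilon>_def)
  qed
  have "\<epsilon> > 0" using k by (simp add: \<epsilon>_def)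
  let ?N = "\<lambda>n t. sobolev_norm s (\<lambda>x. u q F (l n) t x - u q F (l' n) t x) + sobolev_norm s (\<lambda>x. u p G (l n) t x - u p G (l' n) t x)"
  have "(\<lambda>n. ?N n 0) \<longlonglongrightarrow> 0"
  proof -
    obtain C1 where C1: "\<And>n. sobolev_norm s (\<lambda>x. u q F (l n) 0 x - u q F (l' n) 0 x) \<le> C1 * d n"
      using init[OF F pq(2)] by blast
    obtain C2 where C2: "\<And>n. sobolev_norm s (\<lambda>x. u p G (l n) 0 x - u p G (l' n) 0 x) \<le> C2 * d n"
      using init[OF G pq(1)] by blast
    have "d \<longlonglongrightarrow> 0"
      unfolding d_def using LIMSEQ_ignore_initial_segment[OF lim_1_over_n, of 4] by simp
    then have lim: "(\<lambda>n. (C1 + C2) * d n) \<longlonglongrightarrow> 0" by (rule tendsto_mult_right_zero)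
    have "0 \<le> ?N n 0" "?N n 0 \<le> (C1 + C2) * d n" for n
      using nonneg[OF F, of q "l n" 0 "l' n"] nonneg[OF G, of p "l n" 0 "l' n"] C1[of n] C2[of n]
      by (simp_all add: distrib_right)
    then show ?thesis
      by (intro tendsto_sandwich[OF _ _ tendsto_const lim] always_eventually allI)
  qed
  note f3 = this
  have f4: "(SUP t\<in>{0..T}. ?N n t) \<ge> \<epsilon>" for n
  proof -
    obtain C1 where C1: "\<And>t. sobolev_norm s (\<lambda>x. u q F (l n) t x - u q F (l' n) t x) \<le> C1"
      using bounded[OF F] by blast
    obtain C2 where C2: "\<And>t. sobolev_norm s (\<lambda>x. u p G (l n) t x - u p G (l' n) t x) \<le> C2"
      using bounded[OF G] by blast
    have "\<epsilon> \<le> ?N n T" using low[of n] nonneg[OF G, of p "l n" T "l' n"] by simp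
    also have "\<dots> \<le> (SUP t\<in>{0..T}. ?N n t)"
      by (rule cSUP_upper) (use T C1 C2 in \<open>auto intro!: bdd_aboveI2[where M="C1 + C2"] add_mono\<close>)
    finally show ?thesis .
  qed
  have f12: "is_solution p q a b s T (u q F (l n)) (u p G (l n))" "is_solution p q a b s T (u q F (l' n)) (u p G (l' n))" for n
    using l[of n] by (auto intro: sol)
  show ?thesis
    unfolding nonuniform_def
    by (rule exI[of _ T], rule conjI[OF T], rule exI[of _ \<epsilon>], rule conjI[OF \<open>\<epsilon> > 0\<close>],
        rule exI[of _ "\<lambda>n. u q F (l n)"], rule exI[of _ "\<lambda>n. u p G (l n)"],
        rule exI[of _ "\<lambda>n. u q F (l' n)"], rule exI[of _ "\<lambda>n. u p G (l' n)"]) (intro conjI allI f12 f3 f4)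
qed

lemma exists_nonzero_frequency:
  assumes "circle_cont f" "f x \<noteq> f y"
  shows "\<exists>k. k \<noteq> 0 \<and> fourier_coeff f k \<noteq> 0"
proof (rule ccontr)
  assume "\<not> ?thesis"
  then have 0: "fourier_coeff f k = 0" if "k \<noteq> 0" for k using that by blast
  have "cnj (fourier_coeff f 0) = fourier_coeff f 0" using fourier_coeff_uminus_freq[of f 0] by simp
  then have "Im (fourier_coeff f 0) = 0" by (simp add: complex_eq_iff)
  then have "f = (\<lambda>x. Re (fourier_coeff f 0))"
    by (intro circle_cont_eqI[OF assms(1)]) (auto simp: fourier_coeff_const complex_eq_iff 0)
  then show False using assms(2) by metis
qed

section \<open>Even functions and second derivatives\<close>

text \<open>Shifting by pi replaces the period by the symmetric interval from -pi to pi, and a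
  primitive of an odd function takes equal values at its ends.\<close>

lemma odd_periodic_integral_eq_0:
  assumes g: "circle_cont g" and odd: "\<And>x. g (- x) = - g x"
  shows "(LINT x:{0..2*pi}|lborel. g x) = 0"
proof -
  obtain G where G: "\<And>x. (G has_real_derivative g x) (at x)"
    using antiderivative_exists[OF circle_cont_on[OF g]] by blast
  have I: "(LINT x:{0..2*pi}|lborel. g (x - pi)) = G (2*pi - pi) - G (0 - pi)"
    unfolding set_lebesgue_integral_def
  proof (rule integral_FTC_atLeastAtMost)
    show "continuous_on {0..2*pi} (\<lambda>x. g (x - pi))"
      by (intro circle_cont_on circle_cont_shift g)
    fix x
    have "((\<lambda>x. G (x - pi)) has_real_derivative g (x - pi)) (at x)"
      using DERIV_shift[of G "g (x - pi)" x "- pi"] G[of "x - pi"] by simp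
    then show "((\<lambda>x. G (x - pi)) has_vector_derivative g (x - pi)) (at x within {0..2*pi})"
      by (auto simp: has_real_derivative_iff_has_vector_derivative intro: has_vector_derivative_at_within)
  qed auto
  have "((\<lambda>x. G x - G (- x)) has_real_derivative 0) (at x)" for x
  proof -
    have "((\<lambda>x. G (- x)) has_real_derivative - g (- x)) (at x)"
      using DERIV_mirror[of G "g (- x)" x] G[of "- x"] by simp
    from DERIV_diff[OF G this] show ?thesis using odd by simp
  qed
  then have "G pi - G (- pi) = G 0 - G (- 0)"
    by (intro DERIV_isconst_all[of "\<lambda>x. G x - G (- x)"] allI)
  then show ?thesis using I set_integral_periodic_shift[OF g, of pi] by simp
qed

lemma Im_fourier_coeff_even:
  assumes "circle_cont h" "\<And>x. h (- x) = h x"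
  shows "Im (fourier_coeff h k) = 0"
proof -
  have "(LINT x:{0..2*pi}|lborel. h x * sin (of_int k * x)) = 0"
    by (rule odd_periodic_integral_eq_0) (use assms in \<open>auto intro: circle_cont_mult circle_cont_harmonic\<close>)
  then show ?thesis by (simp add: fourier_coeff_Re_Im[OF assms(1)])
qed

text \<open>Even functions have real coefficients, so only cosines remain in the series.\<close>

lemma fourier_mult_even:
  assumes "circle_cont h" "\<And>x. h (- x) = h x"
  shows "fourier_mult \<sigma> h (- x) = fourier_mult \<sigma> h x"
proof -
  have "Re (of_real (\<sigma> (real n)) * fourier_coeff h (int n) * cis (real n * (- x)))
      = Re (of_real (\<sigma> (real n)) * fourier_coeff h (int n) * cis (real n * x))" for n
    using Im_fourier_coeff_even[OF assms, of "int n"] by simp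
  then show ?thesis unfolding fourier_mult_def trig_series_def by (simp only:)
qed

text \<open>Composition with \<open>fold_angle\<close> turns any continuous function into an even periodic one, so the fixed
  point problem below can be posed for all bounded continuous functions.\<close>

definition fold_angle :: "real \<Rightarrow> real" where "fold_angle x = arccos (cos x)"

lemma continuous_fold_angle: "continuous_on S fold_angle"
  unfolding fold_angle_def by (intro continuous_on_arccos' continuous_on_compose2[OF continuous_on_arccos'] continuous_intros) (auto)

lemma fold_angle_even: "fold_angle (- x) = fold_angle x" and fold_angle_periodic: "fold_angle (x + 2 * pi) = fold_angle x"
  by (simp_all add: fold_angle_def)

text \<open>\<open>fold_angle x\<close> has the same cosine as x, hence equals x or -x up to a
  multiple of 2 pi.\<close>

lemma apply_fold_angle_eq:
  assumes "circle_cont f" "\<And>x. f (- x) = f x"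
  shows "f (fold_angle x) = f x"
proof -
  have "cos (fold_angle x) = cos x" unfolding fold_angle_def by (simp add: cos_arccos)
  then obtain n where n: "n \<in> \<int>" "fold_angle x = x + 2 * n * pi \<or> fold_angle x = - x + 2 * n * pi"
    unfolding cos_eq by blast
  then obtain k :: int where k: "n = of_int k" by (auto elim: Ints_cases)
  have per: "f (y + 2 * of_int k * pi) = f y" for y
    using periodic_add_int[of f y k] circle_cont_periodic[OF assms(1)] by (simp add: algebra_simps)
  from n(2) show ?thesis unfolding k using per[of x] per[of "- x"] assms(2) by auto
qed

lemma circle_cont_comp_fold_angle: "continuous_on UNIV f \<Longrightarrow> circle_cont (\<lambda>x. f (fold_angle x))"
  by (intro circle_contI continuous_on_compose2[OF _ continuous_fold_angle]) (auto simp: fold_angle_periodic)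

text \<open>For a summable symbol, a bound of \<open>fourier_mult \<sigma>\<close> as an operator in
  the supremum norm.\<close>

definition mult_const :: "(real \<Rightarrow> real) \<Rightarrow> real" where
  "mult_const \<sigma> = \<bar>\<sigma> 0\<bar> + 2 * (\<Sum>n. \<bar>\<sigma> (real (Suc n))\<bar>)"

context
  fixes \<sigma> :: "real \<Rightarrow> real"
  assumes sum: "summable (\<lambda>n. \<bar>\<sigma> (real (Suc n))\<bar>)"
begin

lemma summable_fourier_mult:
  assumes h: "circle_cont h"
  shows "summable (\<lambda>n. \<bar>\<sigma> (real (Suc n))\<bar> * norm (fourier_coeff h (int (Suc n))))"
proof -
  obtain B where B: "\<And>x. \<bar>h x\<bar> \<le> B" using circle_cont_bounded[OF h] by blast
  show ?thesis
  proof (rule summable_comparison_test'[OF summable_mult2[OF sum, of B]])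
    fix n
    show "norm (\<bar>\<sigma> (real (Suc n))\<bar> * norm (fourier_coeff h (int (Suc n)))) \<le> \<bar>\<sigma> (real (Suc n))\<bar> * B"
      using norm_fourier_coeff_le[OF h B, of "int (Suc n)"] by (simp add: mult_left_mono del: of_nat_Suc)
  qed
qed

lemma abs_fourier_mult_bounded:
  assumes h: "circle_cont h" and B: "\<And>x. \<bar>h x\<bar> \<le> B"
  shows "\<bar>fourier_mult \<sigma> h x\<bar> \<le> mult_const \<sigma> * B"
proof -
  have "\<bar>fourier_mult \<sigma> h x\<bar> \<le> \<bar>\<sigma> 0\<bar> * norm (fourier_coeff h 0)
      + 2 * (\<Sum>n. \<bar>\<sigma> (real (Suc n))\<bar> * norm (fourier_coeff h (int (Suc n))))"
    by (rule abs_fourier_mult_le[OF summable_fourier_mult[OF h]])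
  also have "\<dots> \<le> \<bar>\<sigma> 0\<bar> * B + 2 * (\<Sum>n. \<bar>\<sigma> (real (Suc n))\<bar> * B)"
    by (intro add_mono mult_left_mono suminf_le summable_fourier_mult h summable_mult2 sum norm_fourier_coeff_le B) auto
  also have "\<dots> = mult_const \<sigma> * B"
    unfolding mult_const_def suminf_mult2[OF sum, symmetric] by (simp only: distrib_right mult.assoc)
  finally show ?thesis .
qed

lemma fourier_mult_diff_le:
  assumes h: "circle_cont h" "circle_cont g" and B: "\<And>x. \<bar>h x - g x\<bar> \<le> B"
  shows "\<bar>fourier_mult \<sigma> h x - fourier_mult \<sigma> g x\<bar> \<le> mult_const \<sigma> * B"
proof -
  have diff: "(\<lambda>x. fourier_mult \<sigma> h x - fourier_mult \<sigma> g x) = fourier_mult \<sigma> (\<lambda>x. h x - g x)"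
  proof -
    have s: "summable (\<lambda>n. 2 * Re (of_real (\<sigma> (real (Suc n))) * fourier_coeff f (int (Suc n)) * cis (real (Suc n) * x)))"
      if f: "circle_cont f" for f x
    proof (rule summable_comparison_test'[OF summable_mult[OF summable_fourier_mult[OF f], of 2]])
      fix n
      show "norm (2 * Re (of_real (\<sigma> (real (Suc n))) * fourier_coeff f (int (Suc n)) * cis (real (Suc n) * x)))
        \<le> 2 * (\<bar>\<sigma> (real (Suc n))\<bar> * norm (fourier_coeff f (int (Suc n))))"
        using abs_Re_le_cmod[of "of_real (\<sigma> (real (Suc n))) * fourier_coeff f (int (Suc n)) * cis (real (Suc n) * x)"]
        by (simp only: norm_mult norm_of_real norm_cis real_norm_def abs_mult)
    qed
    show ?thesis
      unfolding fourier_mult_def trig_series_def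
        fourier_coeff_diff[OF h[THEN circle_cont_integrable]]
      by (rule ext, simp only: right_diff_distrib left_diff_distrib minus_complex.sel suminf_diff[OF s[OF h(1)] s[OF h(2)], symmetric] add_diff_add)
  qed
  show ?thesis
    unfolding fun_cong[OF diff] by (rule abs_fourier_mult_bounded[OF circle_cont_diff[OF h] B])
qed

end

text \<open>h is integrated twice rather than g differentiated. The hypothesis at k = 0 makes the
  first primitive periodic, subtracting its mean does so for the second, and comparing coefficients
  shows that g is that primitive up to a constant.\<close>

lemma second_derivative_from_fourier_coeff:
  assumes g: "circle_cont g" and h: "circle_cont h"
    and eq: "\<And>k. fourier_coeff h k = - (of_int k)\<^sup>2 * fourier_coeff g k"
  shows "\<exists>g'. circle_cont g' \<and> (\<forall>x. (g has_real_derivative g' x) (at x)) \<and> (\<forall>x. (g' has_real_derivative h x) (at x))"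
proof -
  have prim: "\<exists>F. circle_cont F \<and> (\<forall>x. (F has_real_derivative f x) (at x))"
    if f: "circle_cont f" and 0: "fourier_coeff f 0 = 0" for f
  proof -
    obtain F where F: "\<And>x. (F has_real_derivative f x) (at x)"
      using antiderivative_exists[OF circle_cont_on[OF f]] by blast
    have "complex_of_real (LINT x:{0..2*pi}|lborel. f x) = 0"
      using 0 unfolding fourier_coeff_def by (subst set_integral_complex_of_real[symmetric]) simp
    moreover have "(LINT x:{0..2*pi}|lborel. f x) = F (2*pi) - F 0"
      unfolding set_lebesgue_integral_def
      by (rule integral_FTC_atLeastAtMost)
        (use F in \<open>auto simp: has_real_derivative_iff_has_vector_derivative intro: has_vector_derivative_at_within circle_cont_on[OF f]\<close>)
    ultimately have 1: "F (2*pi) = F 0" by simp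
    have "F (x + 2 * pi) = F x" for x
      using antiderivative_period_increment[OF F f, of x 0] 1 by simp
    then have "circle_cont F"
      using F by (intro circle_contI continuous_at_imp_continuous_on ballI DERIV_isCont)
    then show ?thesis using F by blast
  qed
  obtain H where H: "circle_cont H" "\<And>x. (H has_real_derivative h x) (at x)"
    using prim[OF h] eq[of 0] by auto
  define c where "c = Re (fourier_coeff H 0)"
  have real0: "Im (fourier_coeff f 0) = 0" for f
    using fourier_coeff_uminus_freq[of f 0] by (simp add: complex_eq_iff)
  define H1 where "H1 x = H x - c" for x
  have H1: "circle_cont H1" "\<And>x. (H1 has_real_derivative h x) (at x)"
    unfolding H1_def using H by (auto intro: circle_cont_diff circle_cont_const intro!: derivative_eq_intros)
  have "fourier_coeff H1 0 = 0"
    unfolding H1_def by (subst fourier_coeff_diff)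
      (use H real0[of H] in \<open>auto simp: fourier_coeff_const c_def complex_eq_iff intro: circle_cont_integrable circle_cont_const\<close>)
  then obtain K where K: "circle_cont K" "\<And>x. (K has_real_derivative H1 x) (at x)"
    using prim[OF H1(1)] by blast
  define d where "d = Re (fourier_coeff g 0 - fourier_coeff K 0)"
  have "g = (\<lambda>x. K x + d)"
  proof (rule circle_cont_eqI[OF g])
    show "circle_cont (\<lambda>x. K x + d)" using K by (auto intro: circle_cont_add circle_cont_const)
    fix k
    have Kd: "fourier_coeff (\<lambda>x. K x + d) k = fourier_coeff K k + (if k = 0 then of_real d else 0)"
      by (subst fourier_coeff_add) (auto simp: fourier_coeff_const intro: circle_cont_integrable K circle_cont_const)
    show "fourier_coeff g k = fourier_coeff (\<lambda>x. K x + d) k"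
    proof (cases "k = 0")
      case True
      then show ?thesis using real0[of g] real0[of K] unfolding Kd by (simp add: d_def complex_eq_iff)
    next
      case False
      have "fourier_coeff h k = \<i> * of_int k * (\<i> * of_int k * fourier_coeff K k)"
        using fourier_coeff_deriv[OF H1(2) circle_cont_periodic[OF H1(1)] h, of k]
          fourier_coeff_deriv[OF K(2) circle_cont_periodic[OF K(1)] H1(1), of k] by simp
      also have "\<dots> = - (of_int k)\<^sup>2 * fourier_coeff K k" by (simp add: power2_eq_square algebra_simps)
      finally have "(of_int k)\<^sup>2 * fourier_coeff g k = (of_int k)\<^sup>2 * fourier_coeff K k" using eq[of k] by simp
      then show ?thesis using False by (simp add: Kd)
    qed
  qed
  then have "(g has_real_derivative H1 x) (at x)" for x
    using K(2)[of x] by (auto intro!: derivative_eq_intros)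
  then show ?thesis using H1 by blast
qed

section \<open>The resonant fixed point problem\<close>

lemma circle_cont_divide: "circle_cont f \<Longrightarrow> circle_cont (\<lambda>x. f x / c)"
  using circle_cont_mult[OF _ circle_cont_const, of f "inverse c"] by (simp add: divide_inverse)

text \<open>The sum \<open>S = \<phi> + \<psi>\<close> and the difference \<open>R = \<phi> - \<psi>\<close> of a solution of
  \<open>\<phi> - \<phi>'' = 2\<psi> + f\<close>, \<open>\<psi> - \<psi>'' = 2\<phi> + g\<close> satisfy \<open>S'' + S = -(f + g)\<close> and \<open>R'' - 3R = -(f - g)\<close>. The first equation
  is solvable only if the Fourier coefficients of \<open>f + g\<close> at \<open>\<plusminus>1\<close> vanish.\<close>

definition S_symbol :: "real \<Rightarrow> real" where "S_symbol \<xi> = (if \<bar>\<xi>\<bar> = 1 then 0 else 1 / (\<xi>\<^sup>2 - 1))"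
definition R_symbol :: "real \<Rightarrow> real" where "R_symbol \<xi> = 1 / (\<xi>\<^sup>2 + 3)"

lemma summable_R_symbol: "summable (\<lambda>n. \<bar>R_symbol (real (Suc n))\<bar>)"
proof (rule summable_comparison_test'[OF summable_inverse_Suc_square])
  fix n
  have "0 < (real (Suc n))\<^sup>2" by simp
  then show "norm \<bar>R_symbol (real (Suc n))\<bar> \<le> 1 / (real (Suc n))\<^sup>2"
    unfolding R_symbol_def by (simp add: frac_le del: of_nat_Suc)
qed

lemma summable_S_symbol: "summable (\<lambda>n. \<bar>S_symbol (real (Suc n))\<bar>)"
proof (rule summable_comparison_test'[OF summable_mult[OF summable_inverse_Suc_square, of 2]])
  fix n
  define m where "m = real (Suc n)"
  show "norm \<bar>S_symbol (real (Suc n))\<bar> \<le> 2 * (1 / (real (Suc n))\<^sup>2)"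
  \<comment> \<open>n = 0 is the resonant frequency 1, where the symbol is 0; from frequency 2 on,
    m^2 - 1 \<ge> m^2 / 2.\<close>
  proof (cases "n = 0")
    case False
    then have "m \<ge> 2" by (simp add: m_def)
    then have "m\<^sup>2 \<ge> 2\<^sup>2" by (intro power_mono) auto
    then have m2: "m\<^sup>2 \<ge> 4" by simp
    then have "1 / (m\<^sup>2 - 1) \<le> 1 / (m\<^sup>2 / 2)" by (intro frac_le) auto
    then have "1 / (m\<^sup>2 - 1) \<le> 2 * (1 / m\<^sup>2)" "m\<^sup>2 - 1 > 0" using m2 by simp_all
    then show ?thesis unfolding m_def[symmetric] S_symbol_def by simp
  qed (simp add: S_symbol_def)
qed

lemma symbol_even: "S_symbol (- \<xi>) = S_symbol \<xi>" "R_symbol (- \<xi>) = R_symbol \<xi>"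
  by (simp_all add: S_symbol_def R_symbol_def)

lemma fourier_coeff_cos: "fourier_coeff cos k = (if \<bar>k\<bar> = 1 then 1 / 2 else 0)"
proof -
  have "fourier_coeff (\<lambda>x. 2 * Re (1 / 2 * cis (real 1 * x))) k = (if k = int 1 then 1 / 2 else if k = - int 1 then cnj (1 / 2) else 0)"
    by (rule fourier_coeff_trig_term) simp
  then show ?thesis by auto
qed

text \<open>The last coordinate is the bifurcation parameter, found together with the two
  functions.\<close>

type_synonym state = "(real \<Rightarrow>\<^sub>C real) \<times> (real \<Rightarrow>\<^sub>C real) \<times> real"

lemma abs_combination_le:
  fixes x :: real
  assumes "x = 2 * A + B + E" "\<bar>A\<bar> \<le> a" "\<bar>B\<bar> \<le> b" "\<bar>E\<bar> \<le> e"
  shows "\<bar>x\<bar> \<le> 2 * a + b + e"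
  using assms by linarith

lemma abs_half_sum_le:
  fixes s r c e :: real
  assumes "\<bar>s - 2 * c\<bar> \<le> e" "\<bar>r\<bar> \<le> e"
  shows "\<bar>(s + r) / 2 - c\<bar> \<le> e" "\<bar>(s - r) / 2 - c\<bar> \<le> e"
  using assms by (simp_all add: abs_le_iff field_simps)

text \<open>\<rho> is the radius of the ball around (cos, cos, 0) and \<delta> the Lipschitz
  constant of the remainders. They are scaled by the multiplier bound C so that C \<rho> = 1/200 and
  C \<delta> = \<rho>/200, which leaves ample room in the estimates. The remainder r1 involves
  \<tau> because the parameter sits inside the first nonlinearity.\<close>

locale resonant_perturbation =
  fixes C \<rho> \<delta> :: real and r1 :: "real \<Rightarrow> real \<Rightarrow> real" and r2 :: "real \<Rightarrow> real"
  assumes C: "C \<ge> 1" "mult_const S_symbol \<le> C" "mult_const R_symbol \<le> C"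
    and \<rho>: "\<rho> = 1 / (200 * C)" and \<delta>: "\<delta> = \<rho> / (200 * C)"
    and r1: "\<And>\<tau> \<tau>' x x'. \<bar>r1 \<tau> x - r1 \<tau>' x'\<bar> \<le> \<delta> * (\<bar>\<tau> - \<tau>'\<bar> + \<bar>x - x'\<bar>)" "\<And>\<tau>. r1 \<tau> 0 = 0"
    and r2: "\<And>x x'. \<bar>r2 x - r2 x'\<bar> \<le> \<delta> * \<bar>x - x'\<bar>" "r2 0 = 0"
begin

lemma small: "\<rho> > 0" "\<delta> > 0" "C * \<rho> = 1 / 200" "C * \<delta> = \<rho> / 200" "\<rho> \<le> 1 / 200" "\<delta> \<le> \<rho> / 200" "C * \<rho>\<^sup>2 = \<rho> / 200" "\<rho>\<^sup>2 \<le> \<rho> / 200"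
proof -
  show "\<rho> > 0" "\<delta> > 0" "C * \<rho> = 1 / 200" "C * \<delta> = \<rho> / 200" using C(1) by (auto simp: \<rho> \<delta>)
  then show "C * \<rho>\<^sup>2 = \<rho> / 200" by (simp add: power2_eq_square)
  show "\<rho> \<le> 1 / 200" using C(1) by (simp add: \<rho> field_simps)
  then show "\<rho>\<^sup>2 \<le> \<rho> / 200" using mult_left_mono[of \<rho> "1 / 200" \<rho>] \<open>\<rho> > 0\<close> by (simp add: power2_eq_square)
  have "\<delta> * (200 * C) = \<rho>" using C(1) by (simp add: \<delta>)
  moreover have "\<delta> * 200 \<le> \<delta> * (200 * C)" using C(1) \<open>\<delta> > 0\<close> by (intro mult_left_mono) auto
  ultimately show "\<delta> \<le> \<rho> / 200" by simp
qed

lemma continuous_r1: "continuous_on UNIV (r1 \<tau>)"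
  by (rule lipschitz_on_continuous_on[of \<delta>], rule lipschitz_onI)
    (use r1(1)[of \<tau> _ \<tau>] small(2) in \<open>auto simp: dist_real_def\<close>)

lemma continuous_r2: "continuous_on UNIV r2"
  by (rule lipschitz_on_continuous_on[of \<delta>], rule lipschitz_onI)
    (use r2(1) small(2) in \<open>auto simp: dist_real_def\<close>)

definition err :: "state \<Rightarrow> real \<Rightarrow> real" where
  "err z x = (case z of (\<phi>, \<psi>, \<tau>) \<Rightarrow>
     2 * \<tau> * (apply_bcontfun \<psi> (fold_angle x) - cos x) + r1 \<tau> (apply_bcontfun \<psi> (fold_angle x)) + r2 (apply_bcontfun \<phi> (fold_angle x)))"

text \<open>At a fixed point with \<open>\<tau> = new_par z\<close>, the first Fourier coefficient of \<open>force 1 z\<close> vanishes, because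
  \<open>force 1 z = 2 \<tau> cos + err z\<close>.\<close>

definition new_par :: "state \<Rightarrow> real" where
  "new_par z = - Re (fourier_coeff (err z) 1)"

text \<open>The linear term carries the updated parameter \<open>new_par z\<close>, not \<tau>: the
  map \<tau> \<mapsto> 2 \<tau> \<psi> has Lipschitz constant about 2 and would spoil the
  contraction, whereas \<open>new_par\<close> is quadratically small with a small Lipschitz
  constant. The factor c = 1 serves the equation of the sum, c = -1 that of the difference.\<close>

definition force :: "real \<Rightarrow> state \<Rightarrow> real \<Rightarrow> real" where
  "force c z x = (case z of (\<phi>, \<psi>, \<tau>) \<Rightarrow>
     2 * new_par z * apply_bcontfun \<psi> (fold_angle x) + r1 \<tau> (apply_bcontfun \<psi> (fold_angle x)) + c * r2 (apply_bcontfun \<phi> (fold_angle x)))"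

text \<open>The kernel element 2 cos fixes the amplitude at frequency 1, so the iteration cannot
  fall back to the trivial solution.\<close>

definition new_S :: "state \<Rightarrow> real \<Rightarrow> real" where
  "new_S z x = 2 * cos x + fourier_mult S_symbol (force 1 z) x"

definition new_R :: "state \<Rightarrow> real \<Rightarrow> real" where
  "new_R z = fourier_mult R_symbol (force (- 1) z)"

definition new_state :: "state \<Rightarrow> state" where
  "new_state z = (Bcontfun (\<lambda>x. (new_S z x + new_R z x) / 2), Bcontfun (\<lambda>x. (new_S z x - new_R z x) / 2), new_par z)"

lemma circle_cont_fold_comp:
  "circle_cont (\<lambda>x. apply_bcontfun f (fold_angle x))"
  "circle_cont (\<lambda>x. r1 \<tau> (apply_bcontfun f (fold_angle x)))"
  "circle_cont (\<lambda>x. r2 (apply_bcontfun f (fold_angle x)))"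
  using circle_cont_comp_fold_angle[of "apply_bcontfun f"]
    circle_cont_comp_fold_angle[of "\<lambda>x. r1 \<tau> (apply_bcontfun f x)"]
    circle_cont_comp_fold_angle[of "\<lambda>x. r2 (apply_bcontfun f x)"]
    continuous_on_compose2[OF continuous_r1, of UNIV "apply_bcontfun f"]
    continuous_on_compose2[OF continuous_r2, of UNIV "apply_bcontfun f"]
  by auto

lemma circle_cont_err: "circle_cont (err z)"
  and circle_cont_force: "circle_cont (force c z)"
  unfolding err_def[abs_def] force_def[abs_def] case_prod_beta
  by (intro circle_cont_add circle_cont_mult circle_cont_diff circle_cont_const circle_cont_cos circle_cont_fold_comp)+

lemma circle_cont_new: "circle_cont (new_S z)" "circle_cont (new_R z)"
  unfolding new_S_def[abs_def] new_R_def
  by (intro circle_cont_add circle_cont_mult circle_cont_const circle_cont_cos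
    circle_cont_fourier_mult summable_fourier_mult summable_S_symbol summable_R_symbol circle_cont_force)+

lemma new_even: "force c z (- x) = force c z x" "new_S z (- x) = new_S z x" "new_R z (- x) = new_R z x"
proof -
  have f: "force c z (- x) = force c z x" for c x by (simp add: force_def fold_angle_even)
  then show "force c z (- x) = force c z x" .
  show "new_S z (- x) = new_S z x" "new_R z (- x) = new_R z x"
    unfolding new_S_def new_R_def using fourier_mult_even[OF circle_cont_force f] by simp_all
qed

lemma apply_new_state:
  "apply_bcontfun (fst (new_state z)) = (\<lambda>x. (new_S z x + new_R z x) / 2)"
  "apply_bcontfun (fst (snd (new_state z))) = (\<lambda>x. (new_S z x - new_R z x) / 2)"
  "snd (snd (new_state z)) = new_par z"
proof -
  have "f \<in> bcontfun" if f: "circle_cont f" for f :: "real \<Rightarrow> real"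
  proof -
    obtain B where "\<And>x. \<bar>f x\<bar> \<le> B" using circle_cont_bounded[OF f] by blast
    then show ?thesis by (intro bcontfun_normI circle_cont_on[OF f]) simp
  qed
  moreover have "circle_cont (\<lambda>x. (new_S z x + new_R z x) / 2)" "circle_cont (\<lambda>x. (new_S z x - new_R z x) / 2)"
    by (intro circle_cont_divide circle_cont_add circle_cont_diff circle_cont_new)+
  ultimately show "apply_bcontfun (fst (new_state z)) = (\<lambda>x. (new_S z x + new_R z x) / 2)"
    "apply_bcontfun (fst (snd (new_state z))) = (\<lambda>x. (new_S z x - new_R z x) / 2)"
    unfolding new_state_def by (simp_all add: Bcontfun_inverse)
qed (simp add: new_state_def)

definition near :: "state set" where
  "near = {(\<phi>, \<psi>, \<tau>). (\<forall>x. \<bar>apply_bcontfun \<phi> x - cos x\<bar> \<le> \<rho>) \<and> (\<forall>x. \<bar>apply_bcontfun \<psi> x - cos x\<bar> \<le> \<rho>) \<and> \<bar>\<tau>\<bar> \<le> \<rho>}"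

lemma cos_fold_angle: "cos (fold_angle x) = cos x"
  using apply_fold_angle_eq[OF circle_cont_cos] by simp

lemma near_bounds:
  assumes "z \<in> near" "z = (\<phi>, \<psi>, \<tau>)"
  shows "\<bar>\<phi> (fold_angle x)\<bar> \<le> 2" "\<bar>\<psi> (fold_angle x)\<bar> \<le> 2" "\<bar>\<psi> (fold_angle x) - cos x\<bar> \<le> \<rho>" "\<bar>\<tau>\<bar> \<le> \<rho>"
    "\<bar>r1 \<tau> (\<psi> (fold_angle x))\<bar> \<le> 2 * \<delta>" "\<bar>r2 (\<phi> (fold_angle x))\<bar> \<le> 2 * \<delta>"
proof -
  have n: "\<bar>\<phi> (fold_angle x) - cos (fold_angle x)\<bar> \<le> \<rho>" "\<bar>\<psi> (fold_angle x) - cos (fold_angle x)\<bar> \<le> \<rho>" "\<bar>\<tau>\<bar> \<le> \<rho>"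
    using assms unfolding near_def by auto
  then show "\<bar>\<tau>\<bar> \<le> \<rho>" "\<bar>\<psi> (fold_angle x) - cos x\<bar> \<le> \<rho>" by (auto simp: cos_fold_angle)
  show a: "\<bar>\<phi> (fold_angle x)\<bar> \<le> 2" "\<bar>\<psi> (fold_angle x)\<bar> \<le> 2"
    using n(1,2) small(5) abs_cos_le_one[of x] unfolding cos_fold_angle by linarith+
  have "\<bar>r1 \<tau> (\<psi> (fold_angle x))\<bar> \<le> \<delta> * \<bar>\<psi> (fold_angle x)\<bar>" "\<bar>r2 (\<phi> (fold_angle x))\<bar> \<le> \<delta> * \<bar>\<phi> (fold_angle x)\<bar>"
    using r1(1)[of \<tau> "\<psi> (fold_angle x)" \<tau> 0] r2(1)[of "\<phi> (fold_angle x)" 0] r1(2) r2(2) by simp_all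
  then show "\<bar>r1 \<tau> (\<psi> (fold_angle x))\<bar> \<le> 2 * \<delta>" "\<bar>r2 (\<phi> (fold_angle x))\<bar> \<le> 2 * \<delta>"
    using mult_left_mono[OF a(1), of \<delta>] mult_left_mono[OF a(2), of \<delta>] small(2) by linarith+
qed

text \<open>In \<open>err\<close> the parameter only multiplies \<psi> - cos, a product of two
  factors of size \<rho>; hence the quadratic bound.\<close>

lemma new_par_le:
  assumes z: "z \<in> near"
  shows "\<bar>new_par z\<bar> \<le> 2 * \<rho>\<^sup>2 + 4 * \<delta>"
proof -
  obtain \<phi> \<psi> \<tau> where zz: "z = (\<phi>, \<psi>, \<tau>)" by (cases z)
  note b = near_bounds[OF z zz]
  have e: "\<bar>err z x\<bar> \<le> 2 * \<rho>\<^sup>2 + 4 * \<delta>" for x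
  proof -
    have "\<bar>\<tau> * (\<psi> (fold_angle x) - cos x)\<bar> \<le> \<rho> * \<rho>"
      unfolding abs_mult using b(3)[of x] b(4) small(1) by (intro mult_mono) auto
    then show ?thesis using b(5,6)[of x] unfolding zz err_def by (simp add: power2_eq_square)
  qed
  have "norm (fourier_coeff (err z) 1) \<le> 2 * \<rho>\<^sup>2 + 4 * \<delta>"
    by (rule norm_fourier_coeff_le[OF circle_cont_err e])
  then show ?thesis unfolding new_par_def using abs_Re_le_cmod[of "fourier_coeff (err z) 1"] by simp
qed

text \<open>Differences of products are telescoped so that each piece pairs a distance at most D
  with a small factor; the update of the parameter enters \<open>force\<close> through its own
  Lipschitz bound times |\<psi>| \<le> 2.\<close>

lemma new_par_diff_le:
  assumes z: "z \<in> near" "z' \<in> near" and d: "dist z z' = D"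
  shows "\<bar>new_par z - new_par z'\<bar> \<le> (4 * \<rho> + 3 * \<delta>) * D"
    and "\<bar>force c z x - force c z' x\<bar> \<le> (2 + \<bar>c\<bar>) * \<delta> * D + 4 * ((4 * \<rho> + 3 * \<delta>) * D) + 2 * (2 * \<rho>\<^sup>2 + 4 * \<delta>) * D"
proof -
  obtain \<phi> \<psi> \<tau> where zz: "z = (\<phi>, \<psi>, \<tau>)" by (cases z)
  obtain \<phi>' \<psi>' \<tau>' where zz': "z' = (\<phi>', \<psi>', \<tau>')" by (cases z')
  note b = near_bounds[OF z(1) zz] and b' = near_bounds[OF z(2) zz']
  have "dist \<phi> \<phi>' \<le> D" using dist_fst_le[of z z'] d by (simp add: zz zz')
  moreover have "dist (snd z) (snd z') \<le> D" using dist_snd_le[of z z'] d by simp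
  then have "dist \<psi> \<psi>' \<le> D" "dist \<tau> \<tau>' \<le> D"
    using dist_fst_le[of "snd z" "snd z'"] dist_snd_le[of "snd z" "snd z'"] by (auto simp: zz zz')
  ultimately have D: "\<bar>\<phi> y - \<phi>' y\<bar> \<le> D" "\<bar>\<psi> y - \<psi>' y\<bar> \<le> D" "\<bar>\<tau> - \<tau>'\<bar> \<le> D" for y
    using dist_bounded[of \<phi> y \<phi>'] dist_bounded[of \<psi> y \<psi>'] by (auto simp: dist_real_def)
  have D0: "D \<ge> 0" using d by auto
  have 1: "\<bar>r1 \<tau> (\<psi> (fold_angle x)) - r1 \<tau>' (\<psi>' (fold_angle x))\<bar> \<le> 2 * \<delta> * D" for x
  proof -
    have "\<delta> * (\<bar>\<tau> - \<tau>'\<bar> + \<bar>\<psi> (fold_angle x) - \<psi>' (fold_angle x)\<bar>) \<le> \<delta> * (D + D)"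
      using D small(2) by (intro mult_left_mono add_mono) auto
    then show ?thesis using r1(1)[of \<tau> "\<psi> (fold_angle x)" \<tau>' "\<psi>' (fold_angle x)"] by (simp add: algebra_simps)
  qed
  have 2: "\<bar>r2 (\<phi> (fold_angle x)) - r2 (\<phi>' (fold_angle x))\<bar> \<le> \<delta> * D" for x
  proof -
    have "\<delta> * \<bar>\<phi> (fold_angle x) - \<phi>' (fold_angle x)\<bar> \<le> \<delta> * D"
      using D small(2) by (intro mult_left_mono) auto
    then show ?thesis using r2(1)[of "\<phi> (fold_angle x)" "\<phi>' (fold_angle x)"] by simp
  qed
  have "\<bar>err z x - err z' x\<bar> \<le> (4 * \<rho> + 3 * \<delta>) * D" for x
  proof -
    have "\<tau> * (\<psi> (fold_angle x) - cos x) - \<tau>' * (\<psi>' (fold_angle x) - cos x)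
        = (\<tau> - \<tau>') * (\<psi> (fold_angle x) - cos x) + \<tau>' * (\<psi> (fold_angle x) - \<psi>' (fold_angle x))" by (simp add: algebra_simps)
    also have "\<bar>\<dots>\<bar> \<le> D * \<rho> + \<rho> * D"
      by (rule order_trans[OF abs_triangle_ineq], unfold abs_mult, intro add_mono mult_mono) (use D b b' small D0 in auto)
    finally have "\<bar>\<tau> * (\<psi> (fold_angle x) - cos x) - \<tau>' * (\<psi>' (fold_angle x) - cos x)\<bar> \<le> 2 * \<rho> * D" by (simp add: mult.commute)
    then show ?thesis using 1[of x] 2[of x] unfolding zz zz' err_def by (simp add: algebra_simps)
  qed
  then have "norm (fourier_coeff (\<lambda>x. err z x - err z' x) 1) \<le> (4 * \<rho> + 3 * \<delta>) * D"
    by (intro norm_fourier_coeff_le circle_cont_diff circle_cont_err)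
  moreover have "fourier_coeff (\<lambda>x. err z x - err z' x) 1 = fourier_coeff (err z) 1 - fourier_coeff (err z') 1"
    by (intro fourier_coeff_diff circle_cont_integrable circle_cont_err)
  ultimately show np: "\<bar>new_par z - new_par z'\<bar> \<le> (4 * \<rho> + 3 * \<delta>) * D"
    using abs_Re_le_cmod[of "fourier_coeff (err z) 1 - fourier_coeff (err z') 1"] by (simp add: new_par_def abs_minus_commute)
  have "new_par z * \<psi> (fold_angle x) - new_par z' * \<psi>' (fold_angle x)
      = (new_par z - new_par z') * \<psi> (fold_angle x) + new_par z' * (\<psi> (fold_angle x) - \<psi>' (fold_angle x))" by (simp add: algebra_simps)
  also have "\<bar>\<dots>\<bar> \<le> ((4 * \<rho> + 3 * \<delta>) * D) * 2 + (2 * \<rho>\<^sup>2 + 4 * \<delta>) * D"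
    by (rule order_trans[OF abs_triangle_ineq], unfold abs_mult, intro add_mono mult_mono np new_par_le z)
      (use D b small D0 in auto)
  finally have 3: "\<bar>new_par z * \<psi> (fold_angle x) - new_par z' * \<psi>' (fold_angle x)\<bar> \<le> 2 * ((4 * \<rho> + 3 * \<delta>) * D) + (2 * \<rho>\<^sup>2 + 4 * \<delta>) * D" by simp
  have 4: "\<bar>c * r2 (\<phi> (fold_angle x)) - c * r2 (\<phi>' (fold_angle x))\<bar> \<le> \<bar>c\<bar> * (\<delta> * D)"
    unfolding right_diff_distrib[symmetric] abs_mult using 2 by (intro mult_left_mono) auto
  have "force c z x - force c z' x = 2 * (new_par z * \<psi> (fold_angle x) - new_par z' * \<psi>' (fold_angle x))
    + (r1 \<tau> (\<psi> (fold_angle x)) - r1 \<tau>' (\<psi>' (fold_angle x))) + (c * r2 (\<phi> (fold_angle x)) - c * r2 (\<phi>' (fold_angle x)))"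
    unfolding zz zz' force_def by simp
  then have "\<bar>force c z x - force c z' x\<bar> \<le> 2 * (2 * ((4 * \<rho> + 3 * \<delta>) * D) + (2 * \<rho>\<^sup>2 + 4 * \<delta>) * D) + 2 * \<delta> * D + \<bar>c\<bar> * (\<delta> * D)"
    by (rule abs_combination_le[OF _ 3 1[of x] 4])
  also have "\<dots> = (2 + \<bar>c\<bar>) * \<delta> * D + 4 * ((4 * \<rho> + 3 * \<delta>) * D) + 2 * (2 * \<rho>\<^sup>2 + 4 * \<delta>) * D" by (simp add: algebra_simps)
  finally show "\<bar>force c z x - force c z' x\<bar> \<le> (2 + \<bar>c\<bar>) * \<delta> * D + 4 * ((4 * \<rho> + 3 * \<delta>) * D) + 2 * (2 * \<rho>\<^sup>2 + 4 * \<delta>) * D" .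
qed

lemma force_le:
  assumes z: "z \<in> near" and c: "\<bar>c\<bar> = 1"
  shows "\<bar>force c z x\<bar> \<le> 8 * \<rho>\<^sup>2 + 20 * \<delta>"
proof -
  obtain \<phi> \<psi> \<tau> where zz: "z = (\<phi>, \<psi>, \<tau>)" by (cases z)
  note b = near_bounds[OF z zz]
  have "\<bar>new_par z * \<psi> (fold_angle x)\<bar> \<le> (2 * \<rho>\<^sup>2 + 4 * \<delta>) * 2"
    unfolding abs_mult using b(2)[of x] new_par_le[OF z] by (intro mult_mono) auto
  moreover have "\<bar>c * r2 (\<phi> (fold_angle x))\<bar> \<le> 2 * \<delta>" unfolding abs_mult c using b(6) by simp
  moreover have "force c z x = 2 * (new_par z * \<psi> (fold_angle x)) + r1 \<tau> (\<psi> (fold_angle x)) + c * r2 (\<phi> (fold_angle x))"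
    by (simp add: zz force_def)
  ultimately have "\<bar>force c z x\<bar> \<le> 2 * ((2 * \<rho>\<^sup>2 + 4 * \<delta>) * 2) + 2 * \<delta> + 2 * \<delta>"
    using abs_combination_le[OF _ _ b(5)[of x]] by blast
  then show ?thesis by simp
qed

lemma new_state_near:
  assumes z: "z \<in> near"
  shows "new_state z \<in> near"
proof -
  have "C * (8 * \<rho>\<^sup>2 + 20 * \<delta>) \<le> \<rho>" using small(1,4,7) by (simp add: algebra_simps)
  moreover have nn: "0 \<le> 8 * \<rho>\<^sup>2 + 20 * \<delta>" using small by simp
  ultimately have "mult_const S_symbol * (8 * \<rho>\<^sup>2 + 20 * \<delta>) \<le> \<rho>" "mult_const R_symbol * (8 * \<rho>\<^sup>2 + 20 * \<delta>) \<le> \<rho>"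
    using mult_right_mono[OF C(2) nn] mult_right_mono[OF C(3) nn] by linarith+
  then have "\<bar>new_S z x - 2 * cos x\<bar> \<le> \<rho>" "\<bar>new_R z x\<bar> \<le> \<rho>" for x
    using abs_fourier_mult_bounded[OF summable_S_symbol circle_cont_force force_le[OF z, of 1], of x]
      abs_fourier_mult_bounded[OF summable_R_symbol circle_cont_force force_le[OF z, of "-1"], of x]
    unfolding new_S_def new_R_def by fastforce+
  then have "\<bar>(new_S z x + new_R z x) / 2 - cos x\<bar> \<le> \<rho>" "\<bar>(new_S z x - new_R z x) / 2 - cos x\<bar> \<le> \<rho>" for x
    by (intro abs_half_sum_le; simp)+
  moreover have "\<bar>new_par z\<bar> \<le> \<rho>" using new_par_le[OF z] small(1,6,8) by linarith
  moreover obtain \<phi> \<psi> \<tau> where "new_state z = (\<phi>, \<psi>, \<tau>)" by (cases "new_state z")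
  ultimately show ?thesis using apply_new_state[of z] by (auto simp: near_def)
qed

lemma new_state_contraction:
  assumes z: "z \<in> near" "z' \<in> near"
  shows "dist (new_state z) (new_state z') \<le> 1 / 2 * dist z z'"
proof -
  define D where "D = dist z z'"
  have D0: "D \<ge> 0" by (simp add: D_def)
  note d = new_par_diff_le[OF z D_def[symmetric]]
  \<comment> \<open>Collects the bound for |c| = 1, namely 16 \<rho> + 23 \<delta> + 4 \<rho>^2,
    with the square absorbed into 2 \<rho>.\<close>
  define E where "E = 18 * \<rho> + 23 * \<delta>"
  have "4 * \<rho>\<^sup>2 \<le> 2 * \<rho>" using small(1,8) by linarith
  then have "3 * \<delta> + 4 * (4 * \<rho> + 3 * \<delta>) + 2 * (2 * \<rho>\<^sup>2 + 4 * \<delta>) \<le> E" by (simp add: E_def)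
  then have "(3 * \<delta> + 4 * (4 * \<rho> + 3 * \<delta>) + 2 * (2 * \<rho>\<^sup>2 + 4 * \<delta>)) * D \<le> E * D" by (rule mult_right_mono[OF _ D0])
  then have f: "\<bar>force c z x - force c z' x\<bar> \<le> E * D" if "\<bar>c\<bar> = 1" for c x
    using d(2)[of c x] that by (simp add: algebra_simps)
  have "C * E \<le> 1 / 5" using small(3,4,5) by (simp add: E_def algebra_simps)
  then have CE: "C * (E * D) \<le> D / 5" using mult_right_mono[OF _ D0, of "C * E" "1 / 5"] by simp
  have nn: "0 \<le> E * D" using small D0 by (simp add: E_def)
  have "mult_const S_symbol * (E * D) \<le> D / 5" "mult_const R_symbol * (E * D) \<le> D / 5"
    using mult_right_mono[OF C(2) nn] mult_right_mono[OF C(3) nn] CE by linarith+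
  then have SR: "\<bar>new_S z x - new_S z' x\<bar> \<le> D / 5" "\<bar>new_R z x - new_R z' x\<bar> \<le> D / 5" for x
    using fourier_mult_diff_le[OF summable_S_symbol circle_cont_force circle_cont_force f[of 1], of x]
      fourier_mult_diff_le[OF summable_R_symbol circle_cont_force circle_cont_force f[of "-1"], of x]
    unfolding new_S_def new_R_def by fastforce+
  have h: "\<bar>(a + b) / 2 - (a' + b') / 2\<bar> \<le> D / 5" "\<bar>(a - b) / 2 - (a' - b') / 2\<bar> \<le> D / 5"
    if "\<bar>a - a'\<bar> \<le> D / 5" "\<bar>b - b'\<bar> \<le> D / 5" for a a' b b' :: real
  proof -
    have eq: "(a + b) / 2 - (a' + b') / 2 = ((a - a') + (b - b')) / 2 - 0" "(a - b) / 2 - (a' - b') / 2 = ((a - a') - (b - b')) / 2 - 0"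
      by (simp_all add: field_simps)
    have "\<bar>(a - a') - 2 * 0\<bar> \<le> D / 5" using that by simp
    from abs_half_sum_le[OF this that(2)]
    show "\<bar>(a + b) / 2 - (a' + b') / 2\<bar> \<le> D / 5" "\<bar>(a - b) / 2 - (a' - b') / 2\<bar> \<le> D / 5"
      unfolding eq .
  qed
  have 1: "dist (fst (new_state z)) (fst (new_state z')) \<le> D / 5"
    by (rule dist_bound) (use h(1) SR in \<open>simp add: apply_new_state dist_real_def\<close>)
  have 2: "dist (fst (snd (new_state z))) (fst (snd (new_state z'))) \<le> D / 5"
    by (rule dist_bound) (use h(2) SR in \<open>simp add: apply_new_state dist_real_def\<close>)
  have "(4 * \<rho> + 3 * \<delta>) * D \<le> (1 / 10) * D" using small by (intro mult_right_mono[OF _ D0]) linarith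
  then have 3: "dist (snd (snd (new_state z))) (snd (snd (new_state z'))) \<le> D / 10"
    using d(1) by (simp add: apply_new_state dist_real_def)
  \<comment> \<open>The product metric is at most the sum of the coordinate distances, and 1/5 + 1/5
    + 1/10 = 1/2.\<close>
  have prod: "dist p p' \<le> dist (fst p) (fst p') + dist (snd p) (snd p')" for p p' :: "'x::metric_space \<times> 'y::metric_space"
    unfolding dist_prod_def by (rule sqrt_sum_squares_le_sum) auto
  have "dist (new_state z) (new_state z') \<le> dist (fst (new_state z)) (fst (new_state z')) + dist (snd (new_state z)) (snd (new_state z'))"
    by (rule prod)
  also have "dist (snd (new_state z)) (snd (new_state z')) \<le> dist (fst (snd (new_state z))) (fst (snd (new_state z'))) + dist (snd (snd (new_state z))) (snd (snd (new_state z')))"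
    by (rule prod)
  finally show ?thesis using 1 2 3 unfolding D_def[symmetric] by linarith
qed

lemma near_complete: "complete near" "near \<noteq> {}"
proof -
  have "bounded (range (cos :: real \<Rightarrow> real))" by (rule boundedI[of _ 1]) auto
  then have cb: "(cos :: real \<Rightarrow> real) \<in> bcontfun" by (auto simp: bcontfun_def intro: continuous_intros)
  define c where "c = Bcontfun (cos :: real \<Rightarrow> real)"
  have c: "apply_bcontfun c = cos" unfolding c_def using cb by (rule Bcontfun_inverse)
  have ball: "f \<in> cball c \<rho> \<longleftrightarrow> (\<forall>x. \<bar>f x - cos x\<bar> \<le> \<rho>)" for f
  proof
    assume "f \<in> cball c \<rho>"
    then show "\<forall>x. \<bar>f x - cos x\<bar> \<le> \<rho>"
      using dist_bounded[of c _ f] order_trans by (fastforce simp: c dist_real_def abs_minus_commute)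
  next
    assume "\<forall>x. \<bar>f x - cos x\<bar> \<le> \<rho>"
    then have "dist c f \<le> \<rho>" by (intro dist_bound) (simp add: c dist_real_def abs_minus_commute)
    then show "f \<in> cball c \<rho>" by simp
  qed
  have "near = cball c \<rho> \<times> cball c \<rho> \<times> cball 0 \<rho>"
    unfolding near_def by (auto simp: ball dist_real_def simp del: mem_cball)
  moreover have "closed (cball c \<rho> \<times> cball c \<rho> \<times> cball (0::real) \<rho>)" by (intro closed_Times closed_cball)
  ultimately show "complete near" by (simp add: complete_eq_closed)
  have "(c, c, 0) \<in> near" unfolding near_def using small(1) by (simp add: c)
  then show "near \<noteq> {}" by blast
qed

text \<open>A fixed point solves the equations because its parameter removes the resonant frequency
  from the forcing of the sum. It is nonconstant since it stays within \<rho> of cos.\<close>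

theorem resonant_solution:
  "\<exists>\<phi> \<psi> \<phi>' \<psi>' \<tau>. circle_cont \<phi> \<and> circle_cont \<psi> \<and> circle_cont \<phi>' \<and> circle_cont \<psi>' \<and>
     \<bar>\<tau>\<bar> \<le> 1 / 2 \<and> (\<forall>x. \<bar>\<phi> x\<bar> \<le> 2) \<and> (\<forall>x. \<bar>\<psi> x\<bar> \<le> 2) \<and> \<phi> 0 \<noteq> \<phi> pi \<and>
     (\<forall>x. (\<phi> has_real_derivative \<phi>' x) (at x)) \<and>
     (\<forall>x. (\<phi>' has_real_derivative \<phi> x - (2 * (1 + \<tau>) * \<psi> x + r1 \<tau> (\<psi> x))) (at x)) \<and>
     (\<forall>x. (\<psi> has_real_derivative \<psi>' x) (at x)) \<and>
     (\<forall>x. (\<psi>' has_real_derivative \<psi> x - (2 * \<phi> x + r2 (\<phi> x))) (at x))"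
proof -
  have "\<exists>!z\<in>near. new_state z = z"
  proof (rule Banach_fix[OF near_complete])
    show "0 \<le> (1 / 2 :: real)" "1 / 2 < (1 :: real)" by simp_all
    show "new_state ` near \<subseteq> near" using new_state_near by blast
  qed (rule new_state_contraction)
  then obtain z where z: "z \<in> near" "new_state z = z" by blast
  obtain f g \<tau> where zz: "z = (f, g, \<tau>)" by (cases z)
  define \<phi> \<psi> where "\<phi> = apply_bcontfun f" and "\<psi> = apply_bcontfun g"
  have fix_eq: "\<phi> = (\<lambda>x. (new_S z x + new_R z x) / 2)" "\<psi> = (\<lambda>x. (new_S z x - new_R z x) / 2)" "new_par z = \<tau>"
    using apply_new_state[of z] unfolding z(2) by (simp_all add: zz \<phi>_def \<psi>_def)
  have cS: "circle_cont (new_S z)" and cR: "circle_cont (new_R z)" by (rule circle_cont_new)+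
  have c: "circle_cont \<phi>" "circle_cont \<psi>"
    unfolding fix_eq(1,2) by (intro circle_cont_divide circle_cont_add circle_cont_diff cS cR)+
  have fold: "\<phi> (fold_angle x) = \<phi> x" "\<psi> (fold_angle x) = \<psi> x" for x
    by (rule apply_fold_angle_eq, rule c, simp add: fix_eq(1,2) new_even)+
  have force: "force e z = (\<lambda>x. 2 * \<tau> * \<psi> x + r1 \<tau> (\<psi> x) + e * r2 (\<phi> x))" for e
    using fix_eq(3) fold unfolding force_def[abs_def] zz by (simp add: \<phi>_def[symmetric] \<psi>_def[symmetric])
  have err: "force 1 z = (\<lambda>x. 2 * \<tau> * cos x + err z x)"
    using fold unfolding force unfolding err_def zz by (simp add: \<phi>_def[symmetric] \<psi>_def[symmetric] algebra_simps)
  \<comment> \<open>The term 2 \<tau> cos contributes \<tau> at frequency 1, and \<tau> =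
    \<open>new_par z\<close> is minus the real part of the contribution of
    \<open>err\<close>.\<close>
  have Re0: "Re (fourier_coeff (force 1 z) 1) = 0"
  proof -
    have "fourier_coeff (force 1 z) 1 = fourier_coeff (\<lambda>x. 2 * \<tau> * cos x) 1 + fourier_coeff (err z) 1"
      unfolding err by (intro fourier_coeff_add circle_cont_integrable circle_cont_err circle_cont_mult circle_cont_const circle_cont_cos)
    moreover have "fourier_coeff (\<lambda>x. 2 * \<tau> * cos x) 1 = complex_of_real \<tau>"
      using fourier_coeff_cmult[of "2 * \<tau>" cos 1] by (simp add: fourier_coeff_cos)
    ultimately show ?thesis using fix_eq(3) by (simp add: new_par_def)
  qed
  have "Im (fourier_coeff (force 1 z) 1) = 0" by (rule Im_fourier_coeff_even[OF circle_cont_force new_even(1)])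
  with Re0 have f1: "fourier_coeff (force 1 z) 1 = 0" by (simp add: complex_eq_iff)
  then have f1': "fourier_coeff (force 1 z) k = 0" if "\<bar>k\<bar> = 1" for k
    using that fourier_coeff_uminus_freq[of "force 1 z" 1] by (cases "k = 1") (auto simp: abs_if split: if_splits)
  note int = circle_cont_integrable
  \<comment> \<open>\<open>hS\<close> and \<open>hR\<close> are the candidates for the second
    derivatives of the sum and of the difference.\<close>
  define hS where "hS x = - new_S z x - force 1 z x" for x
  define hR where "hR x = 3 * new_R z x - force (- 1) z x" for x
  have chS: "circle_cont hS"
    using circle_cont_diff[OF circle_cont_diff[OF circle_cont_const[of 0] cS] circle_cont_force[of 1 z]] by (simp add: hS_def[abs_def])
  have chR: "circle_cont hR"
    unfolding hR_def[abs_def] by (intro circle_cont_diff circle_cont_mult circle_cont_const cR circle_cont_force)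
  have "\<exists>S'. circle_cont S' \<and> (\<forall>x. (new_S z has_real_derivative S' x) (at x)) \<and> (\<forall>x. (S' has_real_derivative hS x) (at x))"
  proof (rule second_derivative_from_fourier_coeff[OF cS chS])
    fix k
    have cm: "circle_cont (fourier_mult S_symbol (force 1 z))"
      by (intro circle_cont_fourier_mult summable_fourier_mult summable_S_symbol circle_cont_force)
    have "fourier_coeff (new_S z) k = fourier_coeff (\<lambda>x. 2 * cos x) k + fourier_coeff (fourier_mult S_symbol (force 1 z)) k"
      unfolding new_S_def[abs_def] by (intro fourier_coeff_add int cm circle_cont_mult circle_cont_const circle_cont_cos)
    also have "fourier_coeff (fourier_mult S_symbol (force 1 z)) k = of_real (S_symbol (of_int k)) * fourier_coeff (force 1 z) k"
      by (intro fourier_coeff_fourier_mult summable_fourier_mult summable_S_symbol circle_cont_force symbol_even)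
    also have "fourier_coeff (\<lambda>x. 2 * cos x) k = (if \<bar>k\<bar> = 1 then 1 else 0)"
      using fourier_coeff_cmult[of 2 cos k] by (simp add: fourier_coeff_cos)
    finally have S: "fourier_coeff (new_S z) k = (if \<bar>k\<bar> = 1 then 1 else 0) + of_real (S_symbol (of_int k)) * fourier_coeff (force 1 z) k" .
    \<comment> \<open>At |k| = 1 the left side is zero whatever the amplitude, so the equation holds
      only because the forcing vanishes there.\<close>
    have key: "(1 - (of_int k)\<^sup>2) * fourier_coeff (new_S z) k = - fourier_coeff (force 1 z) k"
    proof (cases "\<bar>k\<bar> = 1")
      case True
      then have "(of_int k)\<^sup>2 = (1::complex)" by (metis of_int_1 of_int_power power2_abs one_power2)
      then show ?thesis using f1'[OF True] by simp
    next
      case False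
      then have "k\<^sup>2 \<noteq> 1" by (simp add: power2_eq_1_iff abs_if split: if_splits)
      then have "(real_of_int k)\<^sup>2 \<noteq> 1" by (metis of_int_1 of_int_eq_iff of_int_power)
      then have "(1 - (real_of_int k)\<^sup>2) * S_symbol (of_int k) = - 1"
        using False by (simp add: S_symbol_def field_simps)
      then have "complex_of_real ((1 - (real_of_int k)\<^sup>2) * S_symbol (of_int k)) = - 1" by simp
      then have "(1 - (of_int k)\<^sup>2) * complex_of_real (S_symbol (of_int k)) = - 1" by simp
      then show ?thesis unfolding S using False by (simp add: mult.assoc[symmetric])
    qed
    have hS: "fourier_coeff hS k = - fourier_coeff (new_S z) k - fourier_coeff (force 1 z) k"
    proof -
      have "fourier_coeff (\<lambda>x. (- 1) * new_S z x - force 1 z x) k = fourier_coeff (\<lambda>x. (- 1) * new_S z x) k - fourier_coeff (force 1 z) k"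
        by (intro fourier_coeff_diff int circle_cont_mult circle_cont_const cS circle_cont_force)
      then show ?thesis using fourier_coeff_cmult[of "- 1" "new_S z" k] by (simp add: hS_def[abs_def])
    qed
    have F: "fourier_coeff (force 1 z) k = - ((1 - (of_int k)\<^sup>2) * fourier_coeff (new_S z) k)"
      using key by (simp only: minus_minus)
    show "fourier_coeff hS k = - (of_int k)\<^sup>2 * fourier_coeff (new_S z) k"
      unfolding hS F by (simp add: algebra_simps)
  qed
  then obtain S' where S': "circle_cont S'" "\<And>x. (new_S z has_real_derivative S' x) (at x)" "\<And>x. (S' has_real_derivative hS x) (at x)" by blast
  have "\<exists>R'. circle_cont R' \<and> (\<forall>x. (new_R z has_real_derivative R' x) (at x)) \<and> (\<forall>x. (R' has_real_derivative hR x) (at x))"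
  proof (rule second_derivative_from_fourier_coeff[OF cR chR])
    fix k
    have R: "fourier_coeff (new_R z) k = of_real (R_symbol (of_int k)) * fourier_coeff (force (-1) z) k"
      unfolding new_R_def by (intro fourier_coeff_fourier_mult summable_fourier_mult summable_R_symbol circle_cont_force symbol_even)
    have "(real_of_int k)\<^sup>2 + 3 \<noteq> 0" using zero_le_power2[of "real_of_int k"] by linarith
    then have "complex_of_real (((real_of_int k)\<^sup>2 + 3) * R_symbol (of_int k)) = 1" by (simp add: R_symbol_def del: of_real_mult of_real_add)
    then have "((of_int k)\<^sup>2 + 3) * complex_of_real (R_symbol (of_int k)) = 1" by simp
    then have key: "((of_int k)\<^sup>2 + 3) * fourier_coeff (new_R z) k = fourier_coeff (force (-1) z) k"
      unfolding R by (simp add: mult.assoc[symmetric])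
    have "fourier_coeff hR k = fourier_coeff (\<lambda>x. 3 * new_R z x) k - fourier_coeff (force (-1) z) k"
      unfolding hR_def[abs_def] by (intro fourier_coeff_diff int circle_cont_mult circle_cont_const cR circle_cont_force)
    also have "fourier_coeff (\<lambda>x. 3 * new_R z x) k = 3 * fourier_coeff (new_R z) k"
      using fourier_coeff_cmult[of 3 "new_R z" k] by simp
    finally show "fourier_coeff hR k = - (of_int k)\<^sup>2 * fourier_coeff (new_R z) k"
      unfolding key[symmetric] by (simp add: algebra_simps)
  qed
  then obtain R' where R': "circle_cont R'" "\<And>x. (new_R z has_real_derivative R' x) (at x)" "\<And>x. (R' has_real_derivative hR x) (at x)" by blast
  define \<phi>' \<psi>' where "\<phi>' x = (S' x + R' x) / 2" and "\<psi>' x = (S' x - R' x) / 2" for x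
  have c': "circle_cont \<phi>'" "circle_cont \<psi>'"
    unfolding \<phi>'_def[abs_def] \<psi>'_def[abs_def]
    by (intro circle_cont_divide circle_cont_add circle_cont_diff S'(1) R'(1))+
  have D1: "(\<phi> has_real_derivative \<phi>' x) (at x)" "(\<psi> has_real_derivative \<psi>' x) (at x)" for x
    unfolding fix_eq(1,2) \<phi>'_def \<psi>'_def using S'(2) R'(2) by (auto intro!: derivative_eq_intros)
  have SR: "new_S z x = \<phi> x + \<psi> x" "new_R z x = \<phi> x - \<psi> x" for x by (auto simp: fix_eq field_simps)
  have D2: "(\<phi>' has_real_derivative (hS x + hR x) / 2) (at x)" "(\<psi>' has_real_derivative (hS x - hR x) / 2) (at x)" for x
    unfolding \<phi>'_def[abs_def] \<psi>'_def[abs_def] using S'(3) R'(3) by (auto intro!: derivative_eq_intros)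
  have "(hS x + hR x) / 2 = \<phi> x - (2 * (1 + \<tau>) * \<psi> x + r1 \<tau> (\<psi> x))" "(hS x - hR x) / 2 = \<psi> x - (2 * \<phi> x + r2 (\<phi> x))" for x
    unfolding hS_def hR_def force SR by (simp_all add: field_simps)
  with D2 have D2': "(\<phi>' has_real_derivative \<phi> x - (2 * (1 + \<tau>) * \<psi> x + r1 \<tau> (\<psi> x))) (at x)"
    "(\<psi>' has_real_derivative \<psi> x - (2 * \<phi> x + r2 (\<phi> x))) (at x)" for x by auto
  have near: "\<bar>\<phi> x - cos x\<bar> \<le> \<rho>" "\<bar>\<tau>\<bar> \<le> \<rho>" for x using z(1) unfolding zz near_def \<phi>_def by auto
  have "\<phi> 0 \<noteq> \<phi> pi" using near(1)[of 0] near(1)[of pi] small(5) by auto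
  moreover have "\<bar>\<tau>\<bar> \<le> 1 / 2" using near(2) small(5) by linarith
  moreover have "\<bar>\<phi> x\<bar> \<le> 2" "\<bar>\<psi> x\<bar> \<le> 2" for x
    using near_bounds(1,2)[OF z(1) zz, of x] fold[of x] by (auto simp: \<phi>_def \<psi>_def)
  ultimately show ?thesis
    by (intro exI[of _ \<phi>] exI[of _ \<psi>] exI[of _ \<phi>'] exI[of _ \<psi>'] exI[of _ \<tau>] conjI allI c c' D1 D2')
qed

end

section \<open>Nonlinear remainders and regularity\<close>

text \<open>Strict differentiability at 0: the remainder of the linear approximation has arbitrarily
  small Lipschitz constant near 0, as the contraction needs. A derivative at the single point 0
  would only bound the size of the remainder.\<close>

definition strict_deriv :: "(real \<Rightarrow> real) \<Rightarrow> real \<Rightarrow> bool" where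
  "strict_deriv k c \<longleftrightarrow> (\<forall>d>0. \<exists>w>0. \<forall>z z'. \<bar>z\<bar> \<le> w \<longrightarrow> \<bar>z'\<bar> \<le> w \<longrightarrow> \<bar>k z - k z' - c * (z - z')\<bar> \<le> d * \<bar>z - z'\<bar>)"

lemma strict_derivI:
  assumes r: "r > 0" and k: "\<And>z. \<bar>z\<bar> < r \<Longrightarrow> (k has_real_derivative k' z) (at z)" and c: "isCont k' 0"
  shows "strict_deriv k (k' 0)"
  unfolding strict_deriv_def
proof (intro allI impI)
  fix d :: real assume "d > 0"
  then obtain s where s: "s > 0" "\<And>z. \<bar>z\<bar> < s \<Longrightarrow> \<bar>k' z - k' 0\<bar> < d"
    using c unfolding isCont_def LIM_eq by (metis abs_zero diff_zero real_norm_def diff_self)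
  define w where "w = min r s / 2"
  have w: "w > 0" "w < r" "w < s" using r s by (auto simp: w_def)
  have "\<bar>k z - k z' - k' 0 * (z - z')\<bar> \<le> d * \<bar>z - z'\<bar>" if z: "\<bar>z\<bar> \<le> w" "\<bar>z'\<bar> \<le> w" for z z'
  proof -
    have "norm ((k z - k' 0 * z) - (k z' - k' 0 * z')) \<le> d * norm (z - z')"
    proof (rule field_differentiable_bound[of "{- w..w}"])
      show "((\<lambda>z. k z - k' 0 * z) has_real_derivative (k' y - k' 0)) (at y within {- w..w})" if "y \<in> {- w..w}" for y
        by (rule DERIV_diff[OF has_field_derivative_at_within[OF k] DERIV_cmult_Id[of "k' 0"]]) (use that w in auto)
      show "norm (k' y - k' 0) \<le> d" if "y \<in> {- w..w}" for y
        using s(2)[of y] that w by fastforce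
    qed (use z in auto)
    then show ?thesis by (simp add: algebra_simps)
  qed
  then show "\<exists>w>0. \<forall>z z'. \<bar>z\<bar> \<le> w \<longrightarrow> \<bar>z'\<bar> \<le> w \<longrightarrow> \<bar>k z - k z' - k' 0 * (z - z')\<bar> \<le> d * \<bar>z - z'\<bar>"
    using w by blast
qed

lemma strict_deriv_power: "strict_deriv (\<lambda>z. (1 + z) ^ n - 1) (real n)"
proof -
  have "strict_deriv (\<lambda>z. (1 + z) ^ n - 1) ((\<lambda>z. real n * (1 + z) ^ (n - 1)) 0)"
    by (rule strict_derivI[of 1]) (auto intro!: derivative_eq_intros continuous_intros)
  then show ?thesis by simp
qed

lemma strict_deriv_powr: "strict_deriv (\<lambda>z. (1 + z) powr e - 1) e"
proof -
  have "strict_deriv (\<lambda>z. (1 + z) powr e - 1) ((\<lambda>z. e * (1 + z) powr (e - 1)) 0)"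
    by (rule strict_derivI[of 1]) (auto intro!: derivative_eq_intros continuous_intros simp: abs_less_iff)
  then show ?thesis by simp
qed

text \<open>The nonlinearity is rescaled to amplitude \<epsilon> and compared with its linear part.
  The ranges 1/2 and 2 are the bounds supplied by \<open>resonant_solution\<close>; the first
  conjunct keeps the base 1 + x P of the real power positive.\<close>

definition remainder_le :: "(real \<Rightarrow> real) \<Rightarrow> (real \<Rightarrow> real) \<Rightarrow> real \<Rightarrow> real \<Rightarrow> real \<Rightarrow> real \<Rightarrow> bool" where
  "remainder_le P h x0 c \<delta> \<epsilon> \<longleftrightarrow>
     (\<forall>\<tau> t. \<bar>\<tau>\<bar> \<le> 1 / 2 \<longrightarrow> \<bar>t\<bar> \<le> 2 \<longrightarrow> \<bar>x0 * (1 + \<tau>) * P (\<epsilon> * t)\<bar> \<le> 1 / 2 \<and>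
       (\<forall>\<tau>' t'. \<bar>\<tau>'\<bar> \<le> 1 / 2 \<longrightarrow> \<bar>t'\<bar> \<le> 2 \<longrightarrow>
         \<bar>(h (x0 * (1 + \<tau>) * P (\<epsilon> * t)) / \<epsilon> - c * (1 + \<tau>) * t) - (h (x0 * (1 + \<tau>') * P (\<epsilon> * t')) / \<epsilon> - c * (1 + \<tau>') * t')\<bar>
           \<le> \<delta> * (\<bar>\<tau> - \<tau>'\<bar> + \<bar>t - t'\<bar>)))"

lemma remainder_leD:
  assumes "remainder_le P h x0 c \<delta> \<epsilon>" "\<bar>\<tau>\<bar> \<le> 1 / 2" "\<bar>t\<bar> \<le> 2"
  shows "\<bar>x0 * (1 + \<tau>) * P (\<epsilon> * t)\<bar> \<le> 1 / 2"
    and "\<bar>\<tau>'\<bar> \<le> 1 / 2 \<Longrightarrow> \<bar>t'\<bar> \<le> 2 \<Longrightarrow>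
      \<bar>(h (x0 * (1 + \<tau>) * P (\<epsilon> * t)) / \<epsilon> - c * (1 + \<tau>) * t) - (h (x0 * (1 + \<tau>') * P (\<epsilon> * t')) / \<epsilon> - c * (1 + \<tau>') * t')\<bar>
        \<le> \<delta> * (\<bar>\<tau> - \<tau>'\<bar> + \<bar>t - t'\<bar>)"
  using assms unfolding remainder_le_def by blast+

text \<open>Dividing by \<epsilon> keeps the linear part and the Lipschitz constants of the strict
  remainders, while arguments shrink with \<epsilon>. Hence any \<delta> is reached by small
  amplitudes.\<close>

lemma remainder_small:
  assumes P: "strict_deriv P p'" "P 0 = 0" and h: "strict_deriv h e'" "h 0 = 0" and \<delta>: "\<delta> > 0"
  shows "\<exists>\<epsilon>0>0. \<forall>\<epsilon>. \<epsilon> \<noteq> 0 \<longrightarrow> \<bar>\<epsilon>\<bar> \<le> \<epsilon>0 \<longrightarrow> remainder_le P h x0 (e' * x0 * p') \<delta> \<epsilon>"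
proof -
  define K where "K = \<bar>x0\<bar>"
  have K: "K \<ge> 0" by (simp add: K_def)
  \<comment> \<open>\<open>dP\<close> and \<open>dh\<close> are the tolerances for P and h, each
    responsible for \<delta>/2; the + 1 in the denominators covers x0 = 0 or e' = 0.\<close>
  define dP where "dP = min 1 (\<delta> / (2 * (4 * \<bar>e'\<bar> * K + 1)))"
  define dh where "dh = \<delta> / (2 * (4 * K * (1 + \<bar>p'\<bar>) + 1))"
  have dP: "dP > 0" "dP \<le> 1" "4 * \<bar>e'\<bar> * K * dP \<le> \<delta> / 2"
  proof -
    have pos: "4 * \<bar>e'\<bar> * K + 1 > 0" using K by (intro add_nonneg_pos) auto
    then show "dP > 0" "dP \<le> 1" using \<delta> by (auto simp: dP_def)
    have "4 * \<bar>e'\<bar> * K * dP \<le> (4 * \<bar>e'\<bar> * K + 1) * (\<delta> / (2 * (4 * \<bar>e'\<bar> * K + 1)))"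
      using K \<open>dP > 0\<close> pos by (intro mult_mono) (auto simp: dP_def)
    also have "\<dots> = \<delta> / 2" using pos by (simp add: field_simps)
    finally show "4 * \<bar>e'\<bar> * K * dP \<le> \<delta> / 2" .
  qed
  have dh: "dh > 0" "dh * (4 * K * (1 + \<bar>p'\<bar>)) \<le> \<delta> / 2"
  proof -
    have pos: "4 * K * (1 + \<bar>p'\<bar>) + 1 > 0" using K by (intro add_nonneg_pos) auto
    then show dh0: "dh > 0" using \<delta> by (auto simp: dh_def)
    have "dh * (4 * K * (1 + \<bar>p'\<bar>)) \<le> dh * (4 * K * (1 + \<bar>p'\<bar>) + 1)" using dh0 by (intro mult_left_mono) auto
    also have "\<dots> = \<delta> / 2" using pos by (simp add: dh_def field_simps)
    finally show "dh * (4 * K * (1 + \<bar>p'\<bar>)) \<le> \<delta> / 2" .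
  qed
  obtain wP where wP: "wP > 0" "\<And>z z'. \<bar>z\<bar> \<le> wP \<Longrightarrow> \<bar>z'\<bar> \<le> wP \<Longrightarrow> \<bar>P z - P z' - p' * (z - z')\<bar> \<le> dP * \<bar>z - z'\<bar>"
    using P(1) dP(1) unfolding strict_deriv_def by blast
  obtain wh where wh: "wh > 0" "\<And>z z'. \<bar>z\<bar> \<le> wh \<Longrightarrow> \<bar>z'\<bar> \<le> wh \<Longrightarrow> \<bar>h z - h z' - e' * (z - z')\<bar> \<le> dh * \<bar>z - z'\<bar>"
    using h(1) dh(1) unfolding strict_deriv_def by blast
  \<comment> \<open>Bounds the argument of h per unit of |\<epsilon>|, so that
    \<open>\<epsilon>0\<close> keeps it within the range of \<open>wh\<close> and below 1/2.\<close>
  define Z where "Z = 4 * K * (1 + \<bar>p'\<bar>) + 1"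
  have Z: "Z > 0" "4 * K * (1 + \<bar>p'\<bar>) \<le> Z" using K by (auto simp: Z_def intro!: add_nonneg_pos)
  define \<epsilon>0 where "\<epsilon>0 = min (wP / 2) (min wh (1 / 2) / Z)"
  have \<epsilon>0: "\<epsilon>0 > 0" using wP wh Z by (simp add: \<epsilon>0_def)
  show ?thesis
    unfolding remainder_le_def
  proof (intro exI[of _ \<epsilon>0] conjI[OF \<epsilon>0] allI impI conjI)
    fix \<epsilon> \<tau> \<tau>' t t' :: real
    assume \<epsilon>: "\<epsilon> \<noteq> 0" "\<bar>\<epsilon>\<bar> \<le> \<epsilon>0" and \<tau>: "\<bar>\<tau>\<bar> \<le> 1 / 2" "\<bar>\<tau>'\<bar> \<le> 1 / 2" and t: "\<bar>t\<bar> \<le> 2" "\<bar>t'\<bar> \<le> 2"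
    have et: "\<bar>\<epsilon> * s\<bar> \<le> wP" if "\<bar>s\<bar> \<le> 2" for s
    proof -
      have "\<bar>\<epsilon>\<bar> * \<bar>s\<bar> \<le> (wP / 2) * 2" using \<epsilon>(2) that wP(1) by (intro mult_mono) (auto simp: \<epsilon>0_def)
      then show ?thesis by (simp add: abs_mult)
    qed
    define g where "g s = P (\<epsilon> * s) / \<epsilon> - p' * s" for s
    have g: "\<bar>g s - g s'\<bar> \<le> dP * \<bar>s - s'\<bar>" if "\<bar>s\<bar> \<le> 2" "\<bar>s'\<bar> \<le> 2" for s s'
    proof -
      have "g s - g s' = (P (\<epsilon> * s) - P (\<epsilon> * s') - p' * (\<epsilon> * s - \<epsilon> * s')) / \<epsilon>"
        using \<epsilon>(1) by (simp add: g_def field_simps)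
      also have "\<bar>\<dots>\<bar> \<le> dP * \<bar>\<epsilon> * s - \<epsilon> * s'\<bar> / \<bar>\<epsilon>\<bar>"
        unfolding abs_divide using wP(2)[OF et et, OF that] by (intro divide_right_mono) auto
      also have "\<dots> = dP * \<bar>s - s'\<bar>"
        using \<epsilon>(1) by (simp add: abs_mult flip: right_diff_distrib)
      finally show ?thesis .
    qed
    have g0: "\<bar>g s\<bar> \<le> 2" "\<bar>g s\<bar> \<le> 2 * dP" if "\<bar>s\<bar> \<le> 2" for s
    proof -
      have "\<bar>g s\<bar> \<le> dP * \<bar>s\<bar>" using g[OF that, of 0] P(2) by (simp add: g_def)
      also have "\<dots> \<le> dP * 2" using that dP by (intro mult_left_mono) auto
      finally show "\<bar>g s\<bar> \<le> 2 * dP" by simp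
      then show "\<bar>g s\<bar> \<le> 2" using dP by linarith
    qed
    define W where "W \<sigma> s = x0 * (1 + \<sigma>) * P (\<epsilon> * s)" for \<sigma> s
    have W: "W \<sigma> s / \<epsilon> = x0 * ((1 + \<sigma>) * g s) + x0 * p' * ((1 + \<sigma>) * s)" for \<sigma> s
      by (simp add: W_def g_def algebra_simps)
    have Wle: "\<bar>W \<sigma> s\<bar> \<le> min wh (1 / 2)" if "\<bar>\<sigma>\<bar> \<le> 1 / 2" "\<bar>s\<bar> \<le> 2" for \<sigma> s
    proof -
      have "\<bar>P (\<epsilon> * s) / \<epsilon>\<bar> \<le> \<bar>g s\<bar> + \<bar>p'\<bar> * \<bar>s\<bar>" unfolding g_def by (simp add: abs_mult[symmetric])
      also have "\<dots> \<le> 2 + \<bar>p'\<bar> * 2" using g0(1)[OF that(2)] that(2) by (intro add_mono mult_left_mono) auto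
      finally have a: "\<bar>P (\<epsilon> * s) / \<epsilon>\<bar> \<le> 2 * (1 + \<bar>p'\<bar>)" by simp
      have "W \<sigma> s = \<epsilon> * (x0 * (1 + \<sigma>) * (P (\<epsilon> * s) / \<epsilon>))" using \<epsilon>(1) by (simp add: W_def)
      also have "\<bar>\<dots>\<bar> \<le> \<epsilon>0 * (K * 2 * (2 * (1 + \<bar>p'\<bar>)))"
        unfolding abs_mult K_def using \<epsilon>(2) a that(1) \<epsilon>0 by (intro mult_mono) auto
      also have "\<dots> = \<epsilon>0 * (4 * K * (1 + \<bar>p'\<bar>))" by simp
      also have "\<dots> \<le> \<epsilon>0 * Z" using Z(2) \<epsilon>0 by (intro mult_left_mono) auto
      also have "\<dots> \<le> (min wh (1 / 2) / Z) * Z" using Z(1) by (intro mult_right_mono) (auto simp: \<epsilon>0_def)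
      also have "\<dots> = min wh (1 / 2)" using Z(1) by simp
      finally show ?thesis .
    qed
    show "\<bar>x0 * (1 + \<tau>) * P (\<epsilon> * t)\<bar> \<le> 1 / 2" using Wle[OF \<tau>(1) t(1)] unfolding W_def by simp
    define s where "s = \<bar>\<tau> - \<tau>'\<bar> + \<bar>t - t'\<bar>"
    have s: "s \<ge> 0" by (simp add: s_def)
    have bil: "\<bar>(1 + \<tau>) * y - (1 + \<tau>') * y'\<bar> \<le> 4 * e * s"
      if "\<bar>y\<bar> \<le> 2 * e" "\<bar>y - y'\<bar> \<le> e * \<bar>t - t'\<bar>" "e \<ge> 0" for y y' e
    proof -
      have "(1 + \<tau>) * y - (1 + \<tau>') * y' = (\<tau> - \<tau>') * y + (1 + \<tau>') * (y - y')" by (simp add: algebra_simps)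
      also have "\<bar>\<dots>\<bar> \<le> \<bar>\<tau> - \<tau>'\<bar> * (2 * e) + 2 * (e * \<bar>t - t'\<bar>)"
        by (rule order_trans[OF abs_triangle_ineq], unfold abs_mult, intro add_mono mult_mono) (use that \<tau> in auto)
      also have "\<dots> \<le> \<bar>\<tau> - \<tau>'\<bar> * (4 * e) + \<bar>t - t'\<bar> * (4 * e)"
      proof -
        have "0 \<le> \<bar>\<tau> - \<tau>'\<bar> * e" "0 \<le> \<bar>t - t'\<bar> * e" using that by auto
        then show ?thesis by (simp add: algebra_simps)
      qed
      also have "\<dots> = 4 * e * s" by (simp add: s_def algebra_simps)
      finally show ?thesis .
    qed
    have b1: "\<bar>(1 + \<tau>) * g t - (1 + \<tau>') * g t'\<bar> \<le> 4 * dP * s"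
      using g0(2)[OF t(1)] g[OF t] dP by (intro bil) auto
    have b2: "\<bar>(1 + \<tau>) * t - (1 + \<tau>') * t'\<bar> \<le> 4 * 1 * s"
      using t by (intro bil) auto
    have "W \<tau> t / \<epsilon> - W \<tau>' t' / \<epsilon> = x0 * ((1 + \<tau>) * g t - (1 + \<tau>') * g t') + x0 * p' * ((1 + \<tau>) * t - (1 + \<tau>') * t')"
      unfolding W by (simp add: algebra_simps)
    also have "\<bar>\<dots>\<bar> \<le> K * (4 * dP * s) + K * \<bar>p'\<bar> * (4 * 1 * s)"
      by (rule order_trans[OF abs_triangle_ineq], unfold abs_mult K_def[symmetric], intro add_mono mult_left_mono b1 b2) (use K in auto)
    also have "\<dots> \<le> K * (4 * 1 * s) + K * \<bar>p'\<bar> * (4 * 1 * s)"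
      using K dP s by (intro add_mono mult_left_mono mult_right_mono) auto
    also have "\<dots> = 4 * K * (1 + \<bar>p'\<bar>) * s" by (simp add: algebra_simps)
    finally have dW: "\<bar>W \<tau> t / \<epsilon> - W \<tau>' t' / \<epsilon>\<bar> \<le> 4 * K * (1 + \<bar>p'\<bar>) * s" .
    have "\<bar>h (W \<tau> t) - h (W \<tau>' t') - e' * (W \<tau> t - W \<tau>' t')\<bar> / \<bar>\<epsilon>\<bar> \<le> dh * \<bar>W \<tau> t - W \<tau>' t'\<bar> / \<bar>\<epsilon>\<bar>"
      using wh(2) Wle[OF \<tau>(1) t(1)] Wle[OF \<tau>(2) t(2)] by (intro divide_right_mono) auto
    also have "\<dots> = dh * \<bar>W \<tau> t / \<epsilon> - W \<tau>' t' / \<epsilon>\<bar>" by (simp add: abs_divide flip: diff_divide_distrib)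
    also have "\<dots> \<le> dh * (4 * K * (1 + \<bar>p'\<bar>) * s)" using dW dh(1) by (intro mult_left_mono) auto
    also have "\<dots> = dh * (4 * K * (1 + \<bar>p'\<bar>)) * s" by simp
    also have "\<dots> \<le> \<delta> / 2 * s" using dh(2) s by (rule mult_right_mono)
    finally have 1: "\<bar>(h (W \<tau> t) - h (W \<tau>' t') - e' * (W \<tau> t - W \<tau>' t')) / \<epsilon>\<bar> \<le> \<delta> / 2 * s" by (simp add: abs_divide)
    have "\<bar>e' * x0 * ((1 + \<tau>) * g t - (1 + \<tau>') * g t')\<bar> \<le> \<bar>e'\<bar> * K * (4 * dP * s)"
      unfolding abs_mult K_def[symmetric] by (intro mult_left_mono b1) (use K in auto)
    also have "\<dots> = 4 * \<bar>e'\<bar> * K * dP * s" by simp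
    also have "\<dots> \<le> \<delta> / 2 * s" using dP(3) s by (rule mult_right_mono)
    finally have 2: "\<bar>e' * x0 * ((1 + \<tau>) * g t - (1 + \<tau>') * g t')\<bar> \<le> \<delta> / 2 * s" .
    have "(h (W \<tau> t) / \<epsilon> - e' * x0 * p' * (1 + \<tau>) * t) - (h (W \<tau>' t') / \<epsilon> - e' * x0 * p' * (1 + \<tau>') * t')
      = (h (W \<tau> t) - h (W \<tau>' t') - e' * (W \<tau> t - W \<tau>' t')) / \<epsilon> + e' * (W \<tau> t / \<epsilon> - W \<tau>' t' / \<epsilon>)
        - e' * x0 * p' * ((1 + \<tau>) * t - (1 + \<tau>') * t')"
      by (simp add: diff_divide_distrib right_diff_distrib mult.assoc)
    \<comment> \<open>The linear contributions with p' cancel exactly, leaving only the strict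
      remainders of h and P.\<close>
    also have "\<dots> = (h (W \<tau> t) - h (W \<tau>' t') - e' * (W \<tau> t - W \<tau>' t')) / \<epsilon> + e' * x0 * ((1 + \<tau>) * g t - (1 + \<tau>') * g t')"
      unfolding W by (simp add: algebra_simps)
    also have "\<bar>\<dots>\<bar> \<le> \<delta> / 2 * s + \<delta> / 2 * s" using 1 2 by (intro order_trans[OF abs_triangle_ineq] add_mono)
    finally show "\<bar>(h (x0 * (1 + \<tau>) * P (\<epsilon> * t)) / \<epsilon> - e' * x0 * p' * (1 + \<tau>) * t) - (h (x0 * (1 + \<tau>') * P (\<epsilon> * t')) / \<epsilon> - e' * x0 * p' * (1 + \<tau>') * t')\<bar>
       \<le> \<delta> * (\<bar>\<tau> - \<tau>'\<bar> + \<bar>t - t'\<bar>)"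
      unfolding W_def s_def by simp
  qed
qed

text \<open>Extends remainders controlled only on a bounded range to globally Lipschitz functions.
  The solution found lies inside the range, where clipping has no effect.\<close>

definition clip :: "real \<Rightarrow> real \<Rightarrow> real" where "clip c x = max (- c) (min c x)"

lemma clip: "c \<ge> 0 \<Longrightarrow> \<bar>clip c x\<bar> \<le> c" "\<bar>clip c x - clip c y\<bar> \<le> \<bar>x - y\<bar>" "\<bar>x\<bar> \<le> c \<Longrightarrow> clip c x = x"
  by (auto simp: clip_def max_def min_def)

section \<open>Smoothness from a differential algebra of functions\<close>

inductive poly_in :: "(real \<Rightarrow> real) set \<Rightarrow> (real \<Rightarrow> real) \<Rightarrow> bool" for X where
  base: "f \<in> X \<Longrightarrow> poly_in X f"
| const: "poly_in X (\<lambda>x. c)"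
| add: "poly_in X f \<Longrightarrow> poly_in X g \<Longrightarrow> poly_in X (\<lambda>x. f x + g x)"
| mult: "poly_in X f \<Longrightarrow> poly_in X g \<Longrightarrow> poly_in X (\<lambda>x. f x * g x)"

lemma poly_in_power: "poly_in X f \<Longrightarrow> poly_in X (\<lambda>x. f x ^ n)"
  by (induction n) (auto intro: poly_in.intros)

lemma poly_in_diff: "poly_in X f \<Longrightarrow> poly_in X g \<Longrightarrow> poly_in X (\<lambda>x. f x - g x)"
  using poly_in.add[OF _ poly_in.mult[OF poly_in.const[of X "- 1"]], of f g] by simp

text \<open>If the derivatives of the generators lie in the algebra they generate, the product rule
  makes the algebra closed under differentiation, and all higher derivatives exist at once.\<close>

lemma poly_in_smooth_chain:
  assumes X: "\<And>f. f \<in> X \<Longrightarrow> (\<forall>x. f (x + 2 * pi) = f x) \<and> (\<exists>f'. poly_in X f' \<and> (\<forall>x. (f has_real_derivative f' x) (at x)))"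
    and f: "poly_in X f"
  shows "\<exists>F. smooth_chain F \<and> F 0 = f"
proof -
  have D: "(\<forall>x. f (x + 2 * pi) = f x) \<and> (\<exists>f'. poly_in X f' \<and> (\<forall>x. (f has_real_derivative f' x) (at x)))" if "poly_in X f" for f
    using that
  proof induction
    case (base f)
    then show ?case by (rule X)
  next
    case (const c)
    have "((\<lambda>x. c) has_real_derivative (\<lambda>x. 0) x) (at x)" for x by simp
    then show ?case using poly_in.const[of X 0] by blast
  next
    case (add f g)
    then obtain f' g' where *: "poly_in X f'" "\<And>x. (f has_real_derivative f' x) (at x)" "poly_in X g'" "\<And>x. (g has_real_derivative g' x) (at x)" by blast
    have "poly_in X (\<lambda>x. f' x + g' x)" "\<And>x. ((\<lambda>x. f x + g x) has_real_derivative (f' x + g' x)) (at x)"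
      using * by (auto intro: poly_in.intros DERIV_add)
    then show ?case using add by auto
  next
    case (mult f g)
    then obtain f' g' where *: "poly_in X f'" "\<And>x. (f has_real_derivative f' x) (at x)" "poly_in X g'" "\<And>x. (g has_real_derivative g' x) (at x)" by blast
    have "poly_in X (\<lambda>x. f' x * g x + g' x * f x)" "\<And>x. ((\<lambda>x. f x * g x) has_real_derivative (f' x * g x + g' x * f x)) (at x)"
      using * mult by (auto intro: poly_in.intros DERIV_mult)
    then show ?case using mult by auto
  qed
  have "\<forall>f. \<exists>f'. poly_in X f \<longrightarrow> poly_in X f' \<and> (\<forall>x. (f has_real_derivative f' x) (at x))" using D by blast
  then obtain nxt where nxt: "\<And>f. poly_in X f \<Longrightarrow> poly_in X (nxt f) \<and> (\<forall>x. (f has_real_derivative nxt f x) (at x))" by metis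
  define F where "F n = (nxt ^^ n) f" for n
  have F: "poly_in X (F n)" for n by (induction n) (use f nxt in \<open>auto simp: F_def\<close>)
  have "smooth_chain F" unfolding smooth_chain_def
  proof (intro allI conjI)
    fix n x
    have "F (Suc n) = nxt (F n)" by (simp add: F_def)
    then show "(F n has_real_derivative F (Suc n) x) (at x)" using nxt[OF F] by simp
    show "F n (x + 2 * pi) = F n x" using D[OF F] by blast
  qed
  then show ?thesis by (intro exI[of _ F]) (simp add: F_def)
qed

text \<open>Chains arise by choosing derivatives; uniqueness of the derivative identifies their
  entries with explicit formulas.\<close>

lemma smooth_chain_unique:
  assumes "smooth_chain F" "\<And>x. (F n has_real_derivative g x) (at x)"
  shows "F (Suc n) = g"
  using DERIV_unique[OF smooth_chain_deriv[OF assms(1)] assms(2)] by blast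

text \<open>The exponent lowered by one is written as the same power times an inverse, so that the
  derivative is a polynomial in V, V', the power and the inverse.\<close>

lemma power_law_deriv:
  assumes p: "p \<ge> 1" and V: "(V has_real_derivative V') (at t)" and pos: "1 + x * (V t ^ p - 1) > 0"
  shows "((\<lambda>t. (1 + x * (V t ^ p - 1)) powr (- a / real p)) has_real_derivative
     - a * x * V t ^ (p - 1) * V' * (1 + x * (V t ^ p - 1)) powr (- a / real p) * inverse (1 + x * (V t ^ p - 1))) (at t)"
proof -
  let ?b = "1 + x * (V t ^ p - 1)"
  have b: "((\<lambda>t. 1 + x * (V t ^ p - 1)) has_real_derivative x * (real p * (V' * V t ^ (p - 1)))) (at t)"
    using V by (auto intro!: derivative_eq_intros)
  have "((\<lambda>y. y powr (- a / real p)) has_real_derivative (- a / real p) * ?b powr (- a / real p - 1)) (at ?b)"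
    using pos by (rule has_real_derivative_powr)
  from DERIV_chain2[OF this b]
  have "((\<lambda>t. (1 + x * (V t ^ p - 1)) powr (- a / real p)) has_real_derivative
     ((- a / real p) * ?b powr (- a / real p - 1)) * (x * (real p * (V' * V t ^ (p - 1))))) (at t)" .
  moreover have "?b powr (- a / real p - 1) = ?b powr (- a / real p) * inverse ?b"
    using pos by (simp add: powr_diff divide_inverse)
  ultimately show ?thesis using p by (simp add: field_simps)
qed

text \<open>The first integral in normalised form: with v = \<beta> V and \<beta>^p = x/(x-1), v^p -
  1 is the base 1 + x (V^p - 1) divided by x - 1. The base stays positive even where v^p - 1 is
  negative, so a real power is available for every exponent.\<close>

lemma momentum_eq_power_law:
  assumes F: "smooth_chain F" and G: "smooth_chain G" and p: "p \<ge> 1" and x: "x / (x - 1) \<ge> 0" "x \<noteq> 1"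
    and pos: "\<And>t. 1 + x * (G 0 t ^ p - 1) > 0"
    and eq: "\<And>t. F 2 t = F 0 t - (1 + x * (G 0 t ^ p - 1)) powr (- a / real p)"
  shows "momentum_eq p a 1 (\<lambda>n t. \<alpha> * F n t) (\<lambda>n t. root p (x / (x - 1)) * G n t)"
  unfolding momentum_eq_def
proof
  fix t
  define \<beta> where "\<beta> = root p (x / (x - 1))"
  define B where "B = 1 + x * (G 0 t ^ p - 1)"
  define M where "M = B powr (- a / real p)"
  have \<beta>: "\<beta> ^ p = x / (x - 1)" unfolding \<beta>_def using p x by (intro real_root_pow_pos2) auto
  have \<beta>': "\<beta> ^ (p - 1) * \<beta> = x / (x - 1)" using \<beta> p by (simp add: power_eq_if mult.commute)
  have DF: "(F 0 has_real_derivative F 1 s) (at s)" and DG: "(G 0 has_real_derivative G 1 s) (at s)" for s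
    using smooth_chain_deriv[OF F, of 0 s] smooth_chain_deriv[OF G, of 0 s] by simp_all
  have "F (Suc 2) = (\<lambda>t. F 1 t - (- a * x * G 0 t ^ (p - 1) * G 1 t * (1 + x * (G 0 t ^ p - 1)) powr (- a / real p) * inverse (1 + x * (G 0 t ^ p - 1))))"
  proof (rule smooth_chain_unique[OF F])
    fix s
    have "F 2 = (\<lambda>t. F 0 t - (1 + x * (G 0 t ^ p - 1)) powr (- a / real p))" using eq by blast
    then show "(F 2 has_real_derivative F 1 s - (- a * x * G 0 s ^ (p - 1) * G 1 s * (1 + x * (G 0 s ^ p - 1)) powr (- a / real p) * inverse (1 + x * (G 0 s ^ p - 1)))) (at s)"
      using DERIV_diff[OF DF power_law_deriv[where V="G 0", OF p DG pos]] by simp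
  qed
  then have F3: "F 3 t = F 1 t + a * x * G 0 t ^ (p - 1) * G 1 t * M * inverse B"
    by (simp add: eval_nat_numeral B_def M_def)
  have F2: "F 2 t = F 0 t - M" by (simp add: eq M_def B_def)
  have B: "B > 0" using pos by (simp add: B_def)
  have "(\<beta> * G 0 t) ^ p - 1 = B / (x - 1)"
    unfolding power_mult_distrib \<beta> B_def using x(2) by (simp add: field_simps)
  then have "((\<beta> * G 0 t) ^ p - 1) * (\<alpha> * F 1 t - \<alpha> * F 3 t) + a * (\<beta> * G 0 t) ^ (p - 1) * (\<beta> * G 1 t) * (\<alpha> * F 0 t - \<alpha> * F 2 t)
    = B / (x - 1) * (- \<alpha> * (a * x * G 0 t ^ (p - 1) * G 1 t * M * inverse B)) + (\<beta> ^ (p - 1) * \<beta>) * (a * G 0 t ^ (p - 1) * G 1 t * \<alpha> * M)"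
    unfolding F3 F2 power_mult_distrib by (simp add: algebra_simps)
  also have "\<dots> = 0" unfolding \<beta>' using B x(2) by (simp add: field_simps)
  finally show "((\<beta> * G 0 t) ^ p - 1) * (\<alpha> * F 1 t - \<alpha> * F 3 t) + a * (\<beta> * G 0 t) ^ (p - 1) * (\<beta> * G 1 t) * (\<alpha> * F 0 t - \<alpha> * F 2 t) = 0" .
qed

section \<open>Existence of travelling waves\<close>

lemma travelling_profile:
  assumes p: "p \<ge> 1" and q: "q \<ge> 1" and ab: "a * b \<noteq> 0"
  shows "\<exists>F G. smooth_chain F \<and> smooth_chain G \<and> momentum_eq p a 1 F G \<and> momentum_eq q b 1 G F \<and> F 0 0 \<noteq> F 0 pi"
proof -
  \<comment> \<open>The resonance condition, with signs making x/(x-1) and y0/(y0-1) positive; for x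
    this survives the factor 1 + \<tau> \<ge> 1/2. The sign of a b decides between y0 = -1 and y0 =
    2.\<close>
  have "\<exists>x0 y0. a * b * x0 * y0 = 4 \<and> x0 < 0 \<and> (y0 = -1 \<or> y0 = 2)"
  proof (cases "a * b > 0")
    case True
    then show ?thesis by (intro exI[of _ "- 4 / (a * b)"] exI[of _ "-1"]) (auto simp: field_simps)
  next
    case False
    then show ?thesis using ab by (intro exI[of _ "2 / (a * b)"] exI[of _ 2]) (auto simp: field_simps mult_less_0_iff zero_less_mult_iff)
  qed
  then obtain x0 y0 where xy: "a * b * x0 * y0 = 4" "x0 < 0" "y0 = -1 \<or> y0 = 2" by blast
  define A where "A = - a * x0"
  have A0: "A \<noteq> 0" using xy by (auto simp: A_def)
  have "(- b * y0) * A = 4" using xy(1) by (simp add: A_def algebra_simps)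
  then have aA: "- b * y0 = 4 / A" using A0 eq_divide_imp by blast
  define C where "C = max 1 (max (mult_const S_symbol) (mult_const R_symbol))"
  define \<rho> where "\<rho> = 1 / (200 * C)"
  define \<delta> where "\<delta> = \<rho> / (200 * C)"
  have C: "C \<ge> 1" "mult_const S_symbol \<le> C" "mult_const R_symbol \<le> C" by (auto simp: C_def)
  have \<delta>0: "\<delta> > 0" using C(1) by (simp add: \<delta>_def \<rho>_def)
  define e1 where "e1 = - a / real p"
  define e2 where "e2 = - b / real q"
  define P where "P z = (1 + z) ^ p - 1" for z :: real
  define Q where "Q z = (1 + z) ^ q - 1" for z :: real
  define h1 where "h1 z = (1 + z) powr e1 - 1" for z :: real
  define h2 where "h2 z = (1 + z) powr e2 - 1" for z :: real
  have sd: "strict_deriv P (real p)" "P 0 = 0" "strict_deriv Q (real q)" "Q 0 = 0" "strict_deriv h1 e1" "h1 0 = 0" "strict_deriv h2 e2" "h2 0 = 0"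
    unfolding P_def[abs_def] Q_def[abs_def] h1_def[abs_def] h2_def[abs_def]
    by (simp_all add: strict_deriv_power strict_deriv_powr)
  \<comment> \<open>These undo the factors 2/A and A/2 in the definitions of \<open>r1\<close> and
    \<open>r2\<close>.\<close>
  define \<delta>1 where "\<delta>1 = \<delta> * \<bar>A\<bar> / 2"
  define \<delta>2 where "\<delta>2 = \<delta> * 2 / \<bar>A\<bar>"
  have \<delta>12: "\<delta>1 > 0" "\<delta>2 > 0" using \<delta>0 A0 by (auto simp: \<delta>1_def \<delta>2_def)
  obtain \<epsilon>1 where \<epsilon>1: "\<epsilon>1 > 0" "\<And>\<epsilon>. \<epsilon> \<noteq> 0 \<Longrightarrow> \<bar>\<epsilon>\<bar> \<le> \<epsilon>1 \<Longrightarrow> remainder_le P h1 x0 (e1 * x0 * real p) \<delta>1 \<epsilon>"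
    using remainder_small[OF sd(1,2,5,6) \<delta>12(1), of x0] by blast
  obtain \<epsilon>2 where \<epsilon>2: "\<epsilon>2 > 0" "\<And>\<epsilon>. \<epsilon> \<noteq> 0 \<Longrightarrow> \<bar>\<epsilon>\<bar> \<le> \<epsilon>2 \<Longrightarrow> remainder_le Q h2 y0 (e2 * y0 * real q) \<delta>2 \<epsilon>"
    using remainder_small[OF sd(3,4,7,8) \<delta>12(2), of y0] by blast
  have e1: "e1 * x0 * real p = A" and e2: "e2 * y0 * real q = 4 / A" using p q aA by (auto simp: e1_def e2_def A_def)
  define \<eta> where "\<eta> = min \<epsilon>1 (\<epsilon>2 * 2 / \<bar>A\<bar>)"
  \<comment> \<open>\<eta> and \<mu> are the amplitudes of V - 1 and U - 1. This ratio balances the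
    linear coefficients A and 4/A: A \<eta>/\<mu> = 2 = (4/A) \<mu>/\<eta>.\<close>
  define \<mu> where "\<mu> = \<eta> * A / 2"
  have "\<eta> > 0" using \<epsilon>1(1) \<epsilon>2(1) A0 by (simp add: \<eta>_def)
  moreover have "\<eta> \<le> \<epsilon>1" by (simp add: \<eta>_def)
  ultimately have \<eta>: "\<eta> > 0" "\<bar>\<eta>\<bar> \<le> \<epsilon>1" "\<eta> \<noteq> 0" by auto
  have "\<eta> * \<bar>A\<bar> \<le> (\<epsilon>2 * 2 / \<bar>A\<bar>) * \<bar>A\<bar>" by (intro mult_right_mono) (auto simp: \<eta>_def)
  then have \<mu>: "\<bar>\<mu>\<bar> \<le> \<epsilon>2" "\<mu> \<noteq> 0" using A0 \<eta>(1) by (auto simp: \<mu>_def abs_mult)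
  have R1: "remainder_le P h1 x0 A \<delta>1 \<eta>" and R2: "remainder_le Q h2 y0 (4 / A) \<delta>2 \<mu>"
    using \<epsilon>1(2)[OF \<eta>(3,2)] \<epsilon>2(2)[OF \<mu>(2,1)] unfolding e1 e2 .
  define r1 where "r1 \<tau> t = 2 / A * (h1 (x0 * (1 + clip (1/2) \<tau>) * P (\<eta> * clip 2 t)) / \<eta> - A * (1 + clip (1/2) \<tau>) * clip 2 t)" for \<tau> t
  define r2 where "r2 t = A / 2 * (h2 (y0 * Q (\<mu> * clip 2 t)) / \<mu> - 4 / A * clip 2 t)" for t
  interpret resonant_perturbation C \<rho> \<delta> r1 r2
  proof
    show "C \<ge> 1" "mult_const S_symbol \<le> C" "mult_const R_symbol \<le> C" "\<rho> = 1 / (200 * C)" "\<delta> = \<rho> / (200 * C)"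
      using C by (simp_all add: \<rho>_def \<delta>_def)
    show "r1 \<tau> 0 = 0" for \<tau> using sd(2,6) by (simp add: r1_def clip_def)
    show "r2 0 = 0" using sd(4,8) by (simp add: r2_def clip_def)
    fix \<tau> \<tau>' x x' :: real
    have cl: "\<bar>clip (1/2) \<tau> - clip (1/2) \<tau>'\<bar> \<le> \<bar>\<tau> - \<tau>'\<bar>" "\<bar>clip 2 x - clip 2 x'\<bar> \<le> \<bar>x - x'\<bar>"
      by (simp_all add: clip)
    have "r1 \<tau> x - r1 \<tau>' x' = 2 / A * ((h1 (x0 * (1 + clip (1/2) \<tau>) * P (\<eta> * clip 2 x)) / \<eta> - A * (1 + clip (1/2) \<tau>) * clip 2 x)
      - (h1 (x0 * (1 + clip (1/2) \<tau>') * P (\<eta> * clip 2 x')) / \<eta> - A * (1 + clip (1/2) \<tau>') * clip 2 x'))"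
      unfolding r1_def by (simp only: right_diff_distrib)
    also have "\<bar>\<dots>\<bar> \<le> 2 / \<bar>A\<bar> * (\<delta>1 * (\<bar>clip (1/2) \<tau> - clip (1/2) \<tau>'\<bar> + \<bar>clip 2 x - clip 2 x'\<bar>))"
      unfolding abs_mult abs_divide
      using remainder_leD(2)[OF R1 clip(1) clip(1) clip(1) clip(1), of \<tau> x \<tau>' x']
      by (intro mult_mono) auto
    also have "\<dots> \<le> 2 / \<bar>A\<bar> * (\<delta>1 * (\<bar>\<tau> - \<tau>'\<bar> + \<bar>x - x'\<bar>))"
      using cl \<delta>12 by (intro mult_left_mono add_mono) auto
    also have "\<dots> = \<delta> * (\<bar>\<tau> - \<tau>'\<bar> + \<bar>x - x'\<bar>)" using A0 by (simp add: \<delta>1_def)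
    finally show "\<bar>r1 \<tau> x - r1 \<tau>' x'\<bar> \<le> \<delta> * (\<bar>\<tau> - \<tau>'\<bar> + \<bar>x - x'\<bar>)" .
    have "r2 x - r2 x' = A / 2 * ((h2 (y0 * Q (\<mu> * clip 2 x)) / \<mu> - 4 / A * clip 2 x) - (h2 (y0 * Q (\<mu> * clip 2 x')) / \<mu> - 4 / A * clip 2 x'))"
      unfolding r2_def by (simp only: right_diff_distrib)
    also have "\<bar>\<dots>\<bar> \<le> \<bar>A\<bar> / 2 * (\<delta>2 * \<bar>clip 2 x - clip 2 x'\<bar>)"
      unfolding abs_mult abs_divide
      using remainder_leD(2)[OF R2, of 0 "clip 2 x" 0 "clip 2 x'"] clip(1)[of 2]
      by (intro mult_mono) auto
    also have "\<dots> \<le> \<bar>A\<bar> / 2 * (\<delta>2 * \<bar>x - x'\<bar>)"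
      using cl \<delta>12 by (intro mult_left_mono) auto
    also have "\<dots> = \<delta> * \<bar>x - x'\<bar>" using A0 by (simp add: \<delta>2_def)
    finally show "\<bar>r2 x - r2 x'\<bar> \<le> \<delta> * \<bar>x - x'\<bar>" .
  qed
  obtain \<phi> \<psi> \<phi>' \<psi>' \<tau> where cc: "circle_cont \<phi>" "circle_cont \<psi>" "circle_cont \<phi>'" "circle_cont \<psi>'"
    and \<tau>: "\<bar>\<tau>\<bar> \<le> 1 / 2" and le2: "\<And>x. \<bar>\<phi> x\<bar> \<le> 2" "\<And>x. \<bar>\<psi> x\<bar> \<le> 2" and ne: "\<phi> 0 \<noteq> \<phi> pi"
    and D: "\<And>x. (\<phi> has_real_derivative \<phi>' x) (at x)"
     "\<And>x. (\<phi>' has_real_derivative \<phi> x - (2 * (1 + \<tau>) * \<psi> x + r1 \<tau> (\<psi> x))) (at x)"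
     "\<And>x. (\<psi> has_real_derivative \<psi>' x) (at x)"
     "\<And>x. (\<psi>' has_real_derivative \<psi> x - (2 * \<phi> x + r2 (\<phi> x))) (at x)"
    using resonant_solution by blast
  define x where "x = x0 * (1 + \<tau>)"
  have x: "x < 0" using xy(2) \<tau> by (simp add: x_def mult_neg_pos abs_le_iff)
  define U where "U t = 1 + \<mu> * \<phi> t" for t
  define V where "V t = 1 + \<eta> * \<psi> t" for t
  define U' where "U' t = \<mu> * \<phi>' t" for t
  define V' where "V' t = \<eta> * \<psi>' t" for t
  define BV where "BV t = 1 + x * (V t ^ p - 1)" for t
  define BU where "BU t = 1 + y0 * (U t ^ q - 1)" for t
  define M where "M t = BV t powr e1" for t
  define N where "N t = BU t powr e2" for t
  have BV: "BV t = 1 + x * P (\<eta> * \<psi> t)" and BU: "BU t = 1 + y0 * Q (\<mu> * \<phi> t)" for t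
    by (simp_all add: BV_def BU_def P_def Q_def U_def V_def)
  have pos: "BV t > 0" "BU t > 0" for t
    using remainder_leD(1)[OF R1 \<tau> le2(2), of t] remainder_leD(1)[OF R2 _ le2(1), of 0 t]
    unfolding BV BU x_def by (auto simp: abs_le_iff)
  \<comment> \<open>Within the bounds of the solution the clips disappear, and linear part plus
    remainder is the exact nonlinearity.\<close>
  have "2 * (1 + \<tau>) * \<psi> t + r1 \<tau> (\<psi> t) = (M t - 1) / \<mu>" for t
    using \<tau> le2(2)[of t] A0 \<eta>(1) by (simp add: r1_def clip(3) M_def BV h1_def x_def \<mu>_def field_simps)
  then have DU: "(U has_real_derivative U' t) (at t)" "(U' has_real_derivative U t - M t) (at t)" for t
    unfolding U_def[abs_def] U'_def[abs_def] using \<mu>(2) by (auto intro!: derivative_eq_intros D(1) DERIV_cmult[OF D(2), THEN DERIV_cong] simp: field_simps)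
  have "2 * \<phi> t + r2 (\<phi> t) = (N t - 1) / \<eta>" for t
    using le2(1)[of t] A0 \<eta>(1) by (simp add: r2_def clip(3) N_def BU h2_def \<mu>_def field_simps)
  then have DV: "(V has_real_derivative V' t) (at t)" "(V' has_real_derivative V t - N t) (at t)" for t
    unfolding V_def[abs_def] V'_def[abs_def] using \<eta>(3) by (auto intro!: derivative_eq_intros D(3) DERIV_cmult[OF D(4), THEN DERIV_cong] simp: field_simps)
  define IV where "IV t = inverse (BV t)" for t
  define IU where "IU t = inverse (BU t)" for t
  have DM: "(M has_real_derivative - a * x * V t ^ (p - 1) * V' t * M t * IV t) (at t)" for t
    using power_law_deriv[OF p DV(1), of x t a] pos(1)[of t] unfolding M_def[abs_def] BV_def[abs_def] IV_def e1_def by simp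
  have DN: "(N has_real_derivative - b * y0 * U t ^ (q - 1) * U' t * N t * IU t) (at t)" for t
    using power_law_deriv[OF q DU(1), of y0 t b] pos(2)[of t] unfolding N_def[abs_def] BU_def[abs_def] IU_def e2_def by simp
  have DIV: "(IV has_real_derivative - (x * real p) * V t ^ (p - 1) * V' t * (IV t * IV t)) (at t)" for t
    unfolding IV_def[abs_def] BV_def[abs_def]
    by (rule DERIV_cong[OF DERIV_inverse'[OF DERIV_add[OF DERIV_const DERIV_cmult[OF DERIV_diff[OF DERIV_power[OF DV(1)] DERIV_const]]]]])
      (use pos(1)[of t] in \<open>auto simp: BV_def power2_eq_square field_simps\<close>)
  have DIU: "(IU has_real_derivative - (y0 * real q) * U t ^ (q - 1) * U' t * (IU t * IU t)) (at t)" for t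
    unfolding IU_def[abs_def] BU_def[abs_def]
    by (rule DERIV_cong[OF DERIV_inverse'[OF DERIV_add[OF DERIV_const DERIV_cmult[OF DERIV_diff[OF DERIV_power[OF DU(1)] DERIV_const]]]]])
      (use pos(2)[of t] in \<open>auto simp: BU_def power2_eq_square field_simps\<close>)
  \<comment> \<open>The inverses are included because differentiating the real powers produces them;
    with them the set is closed up to polynomials.\<close>
  define X where "X = {U, U', V, V', M, N, IV, IU}"
  have inX: "poly_in X U" "poly_in X U'" "poly_in X V" "poly_in X V'" "poly_in X M" "poly_in X N" "poly_in X IV" "poly_in X IU"
    by (auto simp: X_def intro: poly_in.base)
  note pin = poly_in.mult poly_in.const poly_in_power poly_in_diff inX
  have per: "U (t + 2 * pi) = U t" "V (t + 2 * pi) = V t" "U' (t + 2 * pi) = U' t" "V' (t + 2 * pi) = V' t" for t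
    using cc by (simp_all add: U_def V_def U'_def V'_def circle_cont_periodic)
  have per2: "M (t + 2 * pi) = M t" "N (t + 2 * pi) = N t" "IV (t + 2 * pi) = IV t" "IU (t + 2 * pi) = IU t" for t
    by (simp_all add: M_def N_def IV_def IU_def BV_def BU_def per)
  have d: "poly_in X U'" "poly_in X (\<lambda>t. U t - M t)" "poly_in X V'" "poly_in X (\<lambda>t. V t - N t)"
    "poly_in X (\<lambda>t. - a * x * V t ^ (p - 1) * V' t * M t * IV t)" "poly_in X (\<lambda>t. - b * y0 * U t ^ (q - 1) * U' t * N t * IU t)"
    "poly_in X (\<lambda>t. - (x * real p) * V t ^ (p - 1) * V' t * (IV t * IV t))" "poly_in X (\<lambda>t. - (y0 * real q) * U t ^ (q - 1) * U' t * (IU t * IU t))"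
    by (intro pin)+
  have closed: "(\<forall>t. f (t + 2 * pi) = f t) \<and> (\<exists>f'. poly_in X f' \<and> (\<forall>t. (f has_real_derivative f' t) (at t)))" if "f \<in> X" for f
  proof -
    have ex: "\<exists>f'. poly_in X f' \<and> (\<forall>t. (f has_real_derivative f' t) (at t))"
      if "poly_in X g" "\<And>t. (f has_real_derivative g t) (at t)" for f g using that by blast
    from \<open>f \<in> X\<close> consider "f = U" | "f = U'" | "f = V" | "f = V'" | "f = M" | "f = N" | "f = IV" | "f = IU" unfolding X_def by blast
    then show ?thesis
      by cases (simp_all only: per per2 simp_thms ex[OF d(1) DU(1)] ex[OF d(2) DU(2)] ex[OF d(3) DV(1)] ex[OF d(4) DV(2)]
        ex[OF d(5) DM] ex[OF d(6) DN] ex[OF d(7) DIV] ex[OF d(8) DIU])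
  qed
  obtain F where F: "smooth_chain F" "F 0 = U" using poly_in_smooth_chain[OF closed inX(1)] by blast
  obtain G where G: "smooth_chain G" "G 0 = V" using poly_in_smooth_chain[OF closed inX(3)] by blast
  have "F (Suc 0) = U'" by (rule smooth_chain_unique[OF F(1)]) (use DU(1) F(2) in simp)
  then have "F (Suc (Suc 0)) = (\<lambda>t. U t - M t)" by (intro smooth_chain_unique[OF F(1)]) (use DU(2) in simp)
  then have F2: "F 2 t = F 0 t - (1 + x * (G 0 t ^ p - 1)) powr (- a / real p)" for t
    by (simp add: F(2) G(2) M_def BV_def e1_def numeral_2_eq_2)
  have "G (Suc 0) = V'" by (rule smooth_chain_unique[OF G(1)]) (use DV(1) G(2) in simp)
  then have "G (Suc (Suc 0)) = (\<lambda>t. V t - N t)" by (intro smooth_chain_unique[OF G(1)]) (use DV(2) in simp)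
  then have G2: "G 2 t = G 0 t - (1 + y0 * (F 0 t ^ q - 1)) powr (- b / real q)" for t
    by (simp add: F(2) G(2) N_def BU_def e2_def numeral_2_eq_2)
  define \<alpha> where "\<alpha> = root q (y0 / (y0 - 1))"
  define \<beta> where "\<beta> = root p (x / (x - 1))"
  have xx: "x / (x - 1) \<ge> 0" "x \<noteq> 1" using x by (auto simp: divide_nonpos_neg)
  have yy: "y0 / (y0 - 1) > 0" "y0 \<noteq> 1" using xy(3) by auto
  have "momentum_eq p a 1 (\<lambda>n t. \<alpha> * F n t) (\<lambda>n t. \<beta> * G n t)"
    unfolding \<beta>_def by (rule momentum_eq_power_law[OF F(1) G(1) p xx _ F2]) (use pos(1) G(2) in \<open>simp add: BV_def\<close>)
  moreover have "momentum_eq q b 1 (\<lambda>n t. \<beta> * G n t) (\<lambda>n t. \<alpha> * F n t)"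
    unfolding \<alpha>_def by (rule momentum_eq_power_law[OF G(1) F(1) q less_imp_le[OF yy(1)] yy(2) _ G2]) (use pos(2) F(2) in \<open>simp add: BU_def\<close>)
  moreover have "\<alpha> * F 0 0 \<noteq> \<alpha> * F 0 pi"
  proof -
    have "\<alpha> > 0" unfolding \<alpha>_def using q yy(1) by (intro real_root_gt_zero) auto
    then show ?thesis using ne \<mu>(2) by (simp add: F(2) U_def)
  qed
  ultimately show ?thesis using smooth_chain_cmult[OF F(1), of \<alpha>] smooth_chain_cmult[OF G(1), of \<beta>]
    by (intro exI[of _ "\<lambda>n t. \<alpha> * F n t"] exI[of _ "\<lambda>n t. \<beta> * G n t"] conjI)
qed

text \<open>With v = 1 the coefficients v^p - 1 and v_x vanish, so the first equation holds for any
  u; the second is trivial since b = 0 and v is constant.\<close>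

lemma travelling_profile_b_eq_0:
  "\<exists>F G. smooth_chain F \<and> smooth_chain G \<and> momentum_eq p a 1 F G \<and> momentum_eq q 0 1 G F \<and> F 0 0 \<noteq> F 0 pi"
proof -
  define F where "F n t = cos (t + real n * (pi / 2))" for n t
  define G where "G n t = (if n = 0 then 1 else 0 :: real)" for n :: nat and t :: real
  have "smooth_chain F"
    unfolding smooth_chain_def
  proof (intro allI conjI)
    fix n t
    have "F (Suc n) t = - sin (t + real n * (pi / 2))"
    proof -
      have "F (Suc n) t = cos ((t + real n * (pi / 2)) + pi / 2)" by (simp add: F_def algebra_simps add_divide_distrib)
      then show ?thesis by (simp add: cos_add)
    qed
    then show "(F n has_real_derivative F (Suc n) t) (at t)"
      unfolding F_def[of n, abs_def] by (auto intro!: derivative_eq_intros)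
    have "F n (t + 2 * pi) = cos ((t + real n * (pi / 2)) + 2 * pi)" by (simp add: F_def algebra_simps)
    then show "F n (t + 2 * pi) = F n t" by (simp only: cos_periodic F_def)
  qed
  moreover have "smooth_chain G" unfolding smooth_chain_def G_def by auto
  moreover have "momentum_eq p a 1 F G" "momentum_eq q 0 1 G F" unfolding momentum_eq_def G_def by auto
  moreover have "F 0 0 \<noteq> F 0 pi" by (simp add: F_def)
  ultimately show ?thesis by blast
qed

lemma nonuniform_swap:
  assumes "nonuniform q p b a s" shows "nonuniform p q a b s"
proof -
  obtain T \<epsilon> u v w y where *: "T > 0" "\<epsilon> > 0"
    "\<And>n. is_solution q p b a s T (u n) (v n)" "\<And>n. is_solution q p b a s T (w n) (y n)"
    "(\<lambda>n. sobolev_norm s (\<lambda>x. u n 0 x - w n 0 x) + sobolev_norm s (\<lambda>x. v n 0 x - y n 0 x)) \<longlonglongrightarrow> 0"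
    "\<And>n. (SUP t\<in>{0..T}. sobolev_norm s (\<lambda>x. u n t x - w n t x) + sobolev_norm s (\<lambda>x. v n t x - y n t x)) \<ge> \<epsilon>"
    using assms unfolding nonuniform_def by (elim exE conjE) blast
  show ?thesis
    unfolding nonuniform_def
    by (rule exI[of _ T], rule conjI[OF *(1)], rule exI[of _ \<epsilon>], rule conjI[OF *(2)],
        rule exI[of _ v], rule exI[of _ u], rule exI[of _ y], rule exI[of _ w], intro conjI allI)
      (use * in \<open>simp_all only: is_solution_swap[of p q a b] add.commute\<close>)
qed

theorem theorem1p1:
  fixes p q :: nat and a b s :: real
  assumes "p \<ge> 1" and "q \<ge> 1" and "s > 5 / 2"
  shows "\<exists>T>0. \<exists>\<epsilon>>0. \<exists>u v w y :: nat \<Rightarrow> real \<Rightarrow> real \<Rightarrow> real.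
    (\<forall>n. is_solution p q a b s T (u n) (v n)) \<and>
    (\<forall>n. is_solution p q a b s T (w n) (y n)) \<and>
    (\<lambda>n. sobolev_norm s (\<lambda>x. u n 0 x - w n 0 x) +
          sobolev_norm s (\<lambda>x. v n 0 x - y n 0 x)) \<longlonglongrightarrow> 0 \<and>
    (\<forall>n. (SUP t\<in>{0..T}. sobolev_norm s (\<lambda>x. u n t x - w n t x) +
                         sobolev_norm s (\<lambda>x. v n t x - y n t x)) \<ge> \<epsilon>)"
proof -
  \<comment> \<open>Stated for arbitrary parameters because the case a = 0 applies it with the two
    components exchanged.\<close>
  have nonconst: "nonuniform p q a b s"
    if pq: "p \<ge> 1" "q \<ge> 1"
      and ex: "\<exists>F G. smooth_chain F \<and> smooth_chain G \<and> momentum_eq p a 1 F G \<and> momentum_eq q b 1 G F \<and> F 0 0 \<noteq> F 0 pi"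
    for p q a b
  proof -
    obtain F G where FG: "smooth_chain F" "smooth_chain G" "momentum_eq p a 1 F G" "momentum_eq q b 1 G F" "F 0 0 \<noteq> F 0 pi"
      using ex by blast
    obtain k where "k \<noteq> 0" "fourier_coeff (F 0) k \<noteq> 0"
      using exists_nonzero_frequency[OF smooth_chain_circle_cont[OF FG(1)] FG(5)] by blast
    then show ?thesis
      using assms(3) by (intro nonuniform_if_travelling[OF FG(1,2) pq _ FG(3,4)]) auto
  qed
  have "nonuniform p q a b s"
  proof (cases "b = 0")
    case True
    then show ?thesis using nonconst[OF assms(1,2) travelling_profile_b_eq_0] by simp
  next
    case b: False
    show ?thesis
    proof (cases "a = 0")
      case True
      then show ?thesis using nonuniform_swap[OF nonconst[OF assms(2,1) travelling_profile_b_eq_0]] by simp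
    next
      case False
      then show ?thesis using b by (intro nonconst assms travelling_profile) auto
    qed
  qed
  then show ?thesis unfolding nonuniform_def .
qed

end
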